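(* Let $\mathbf{C}$ be a possibly non-unital $C^{*}$-category and let $\mathbf{M}\mathbf{C}$ be its multiplier category as defined in the context. Then: (1) $\mathbf{M}\mathbf{C}$, with the norm $\|(L,R)\|:=\max\{\|L\|,\|R\|\}$, is a unital $C^{*}$-category (and in fact $\|L\|=\|R\|$); (2) the functor $\mathbf{C}\to\mathbf{M}\mathbf{C}$, identity on objects and $f\mapsto (f\circ -,\,-\circ f)$ on morphisms, is the inclusion of an ideal; (3) for every unital $C^{*}$-category $\mathbf{D}$ and every ideal inclusion $\mathbf{C}\to\mathbf{D}$ there exists a unique unital $*$-functor $\mathbf{D}\to\mathbf{M}\mathbf{C}$ whose composition with $\mathbf{C}\to\mathbf{D}$ is the functor $\mathbf{C}\to\mathbf{M}\mathbf{C}$.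
   Context: A possibly non-unital $C^*$-category is a $C^*$-category in which identity morphisms need not exist. For objects $C,D$ of $\mathbf{C}$, a multiplier morphism $C\to D$ is a pair $(L,R)$ where $L=(L_E)_{E}$ is a family of linear maps $L_E\colon \mathrm{Hom}(E,C)\to\mathrm{Hom}(E,D)$ with $L_F(hg)=L_E(h)g$ for all $h\colon E\to C$, $g\colon F\to E$ and $\|L\|:=\sup_E\|L_E\|<\infty$; $R=(R_E)_E$ is a family of linear maps $R_E\colon\mathrm{Hom}(D,E)\to\mathrm{Hom}(C,E)$ with $R_F(gh)=gR_E(h)$ for all $h\colon D\to E$, $g\colon E\to F$ and $\|R\|:=\sup_E\|R_E\|<\infty$; and $gL_F(f)=R_E(g)f$ for all $f\colon F\to C$, $g\colon D\to E$. The multiplier category $\mathbf{M}\mathbf{C}$ has the objects of $\mathbf{C}$, multiplier morphisms as morphisms, composition $(L',R')\circ(L,R):=(L'L,RR')$, and involution $(L,R)^*:=(R^*,L^* )$ with $L^*_E(f):=R_E(f^* )^*$ and $R^*_E(f):=L_E(f^* )^*$. A $*$-functor $i\colon\mathbf{C}\to\mathbf{D}$ between possibly non-unital $C^*$-categories is an ideal inclusion if it is bijective on objects, an isometric embedding with closed image on morphism spaces, and the composition of any morphism in the image of $i$ with any morphism of $\mathbf{D}$ lies in the image of $i$. *)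

theory Defs
  imports Complex_Main
begin

text \<open>A (possibly non-unital) C*-category, encoded with an object set and
  hom-indexed operations: every hom set Hom(C,D) carries its own zero, addition,
  scalar multiplication and norm. Composition c_comp C D E g f is g o f for
  f : C -> D, g : D -> E; involution c_star C D maps Hom(C,D) to Hom(D,C).\<close>

record ('o,'m) cstarcat =
  c_obj :: "'o set"
  c_hom :: "'o \<Rightarrow> 'o \<Rightarrow> 'm set"
  c_zero :: "'o \<Rightarrow> 'o \<Rightarrow> 'm"
  c_add :: "'o \<Rightarrow> 'o \<Rightarrow> 'm \<Rightarrow> 'm \<Rightarrow> 'm"
  c_scale :: "'o \<Rightarrow> 'o \<Rightarrow> complex \<Rightarrow> 'm \<Rightarrow> 'm"
  c_norm :: "'o \<Rightarrow> 'o \<Rightarrow> 'm \<Rightarrow> real"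
  c_comp :: "'o \<Rightarrow> 'o \<Rightarrow> 'o \<Rightarrow> 'm \<Rightarrow> 'm \<Rightarrow> 'm"
  c_star :: "'o \<Rightarrow> 'o \<Rightarrow> 'm \<Rightarrow> 'm"

definition banach_on ::
  "'m set \<Rightarrow> 'm \<Rightarrow> ('m \<Rightarrow> 'm \<Rightarrow> 'm) \<Rightarrow> (complex \<Rightarrow> 'm \<Rightarrow> 'm) \<Rightarrow> ('m \<Rightarrow> real) \<Rightarrow> bool" where
"banach_on V z ad sc nm \<longleftrightarrow>
  z \<in> V \<and> (\<forall>x\<in>V. \<forall>y\<in>V. ad x y \<in> V) \<and> (\<forall>a. \<forall>x\<in>V. sc a x \<in> V) \<and>
  (\<forall>x\<in>V. \<forall>y\<in>V. \<forall>w\<in>V. ad (ad x y) w = ad x (ad y w)) \<and>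
  (\<forall>x\<in>V. \<forall>y\<in>V. ad x y = ad y x) \<and>
  (\<forall>x\<in>V. ad z x = x) \<and>
  (\<forall>x\<in>V. \<exists>y\<in>V. ad x y = z) \<and>
  (\<forall>x\<in>V. sc 1 x = x) \<and>
  (\<forall>a b. \<forall>x\<in>V. sc a (sc b x) = sc (a * b) x) \<and>
  (\<forall>a b. \<forall>x\<in>V. sc (a + b) x = ad (sc a x) (sc b x)) \<and>
  (\<forall>a. \<forall>x\<in>V. \<forall>y\<in>V. sc a (ad x y) = ad (sc a x) (sc a y)) \<and>
  (\<forall>x\<in>V. nm x = 0 \<longleftrightarrow> x = z) \<and>
  (\<forall>x\<in>V. \<forall>y\<in>V. nm (ad x y) \<le> nm x + nm y) \<and>
  (\<forall>a. \<forall>x\<in>V. nm (sc a x) = cmod a * nm x) \<and>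
  (\<forall>X. (\<forall>n. X n \<in> V) \<and>
       (\<forall>e>0. \<exists>N. \<forall>m\<ge>N. \<forall>n\<ge>N. nm (ad (X m) (sc (-1) (X n))) < e) \<longrightarrow>
       (\<exists>x\<in>V. (\<lambda>n. nm (ad (X n) (sc (-1) x))) \<longlonglongrightarrow> 0))"

text \<open>Positivity of an element a of the (possibly non-unital) C*-algebra End(C):
  a is self-adjoint and its spectrum (computed in the unitization) lies in [0,oo).
  For lambda \<noteq> 0, lambda is not in the spectrum iff a - lambda 1 is invertible in the
  unitization, i.e. there is b with (a - lambda 1)(-1/lambda 1 + b) = 1 = (-1/lambda 1 + b)(a - lambda 1),
  i.e. a b - lambda b - a/lambda = 0 = b a - lambda b - a/lambda.\<close>
definition positive_el :: "('o,'m) cstarcat \<Rightarrow> 'o \<Rightarrow> 'm \<Rightarrow> bool" where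
"positive_el A C a \<longleftrightarrow>
  a \<in> c_hom A C C \<and> c_star A C C a = a \<and>
  (\<forall>l::complex. \<not> (l \<in> \<real> \<and> 0 \<le> Re l) \<longrightarrow>
     (\<exists>b\<in>c_hom A C C.
        c_add A C C (c_add A C C (c_comp A C C C a b) (c_scale A C C (- l) b))
                    (c_scale A C C (- (1 / l)) a) = c_zero A C C \<and>
        c_add A C C (c_add A C C (c_comp A C C C b a) (c_scale A C C (- l) b))
                    (c_scale A C C (- (1 / l)) a) = c_zero A C C))"

definition cstar_cat :: "('o,'m) cstarcat \<Rightarrow> bool" where
"cstar_cat A \<longleftrightarrow>
  (\<forall>C\<in>c_obj A. \<forall>D\<in>c_obj A.
     banach_on (c_hom A C D) (c_zero A C D) (c_add A C D) (c_scale A C D) (c_norm A C D)) \<and>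
  (\<forall>C\<in>c_obj A. \<forall>D\<in>c_obj A. \<forall>E\<in>c_obj A. \<forall>f\<in>c_hom A C D. \<forall>g\<in>c_hom A D E.
     c_comp A C D E g f \<in> c_hom A C E) \<and>
  (\<forall>C\<in>c_obj A. \<forall>D\<in>c_obj A. \<forall>E\<in>c_obj A. \<forall>F\<in>c_obj A.
     \<forall>f\<in>c_hom A C D. \<forall>g\<in>c_hom A D E. \<forall>h\<in>c_hom A E F.
     c_comp A C E F h (c_comp A C D E g f) = c_comp A C D F (c_comp A D E F h g) f) \<and>
  (\<forall>C\<in>c_obj A. \<forall>D\<in>c_obj A. \<forall>E\<in>c_obj A. \<forall>f\<in>c_hom A C D. \<forall>f'\<in>c_hom A C D. \<forall>g\<in>c_hom A D E.
     c_comp A C D E g (c_add A C D f f') = c_add A C E (c_comp A C D E g f) (c_comp A C D E g f')) \<and>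
  (\<forall>C\<in>c_obj A. \<forall>D\<in>c_obj A. \<forall>E\<in>c_obj A. \<forall>f\<in>c_hom A C D. \<forall>g\<in>c_hom A D E. \<forall>g'\<in>c_hom A D E.
     c_comp A C D E (c_add A D E g g') f = c_add A C E (c_comp A C D E g f) (c_comp A C D E g' f)) \<and>
  (\<forall>C\<in>c_obj A. \<forall>D\<in>c_obj A. \<forall>E\<in>c_obj A. \<forall>f\<in>c_hom A C D. \<forall>g\<in>c_hom A D E. \<forall>a.
     c_comp A C D E g (c_scale A C D a f) = c_scale A C E a (c_comp A C D E g f) \<and>
     c_comp A C D E (c_scale A D E a g) f = c_scale A C E a (c_comp A C D E g f)) \<and>
  (\<forall>C\<in>c_obj A. \<forall>D\<in>c_obj A. \<forall>E\<in>c_obj A. \<forall>f\<in>c_hom A C D. \<forall>g\<in>c_hom A D E.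
     c_norm A C E (c_comp A C D E g f) \<le> c_norm A D E g * c_norm A C D f) \<and>
  (\<forall>C\<in>c_obj A. \<forall>D\<in>c_obj A. \<forall>f\<in>c_hom A C D. c_star A C D f \<in> c_hom A D C) \<and>
  (\<forall>C\<in>c_obj A. \<forall>D\<in>c_obj A. \<forall>f\<in>c_hom A C D. \<forall>g\<in>c_hom A C D.
     c_star A C D (c_add A C D f g) = c_add A D C (c_star A C D f) (c_star A C D g)) \<and>
  (\<forall>C\<in>c_obj A. \<forall>D\<in>c_obj A. \<forall>f\<in>c_hom A C D. \<forall>a.
     c_star A C D (c_scale A C D a f) = c_scale A D C (cnj a) (c_star A C D f)) \<and>
  (\<forall>C\<in>c_obj A. \<forall>D\<in>c_obj A. \<forall>f\<in>c_hom A C D. c_star A D C (c_star A C D f) = f) \<and>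
  (\<forall>C\<in>c_obj A. \<forall>D\<in>c_obj A. \<forall>E\<in>c_obj A. \<forall>f\<in>c_hom A C D. \<forall>g\<in>c_hom A D E.
     c_star A C E (c_comp A C D E g f) = c_comp A E D C (c_star A C D f) (c_star A D E g)) \<and>
  (\<forall>C\<in>c_obj A. \<forall>D\<in>c_obj A. \<forall>f\<in>c_hom A C D.
     c_norm A C C (c_comp A C D C (c_star A C D f) f) = (c_norm A C D f)\<^sup>2) \<and>
  (\<forall>C\<in>c_obj A. \<forall>D\<in>c_obj A. \<forall>f\<in>c_hom A C D.
     positive_el A C (c_comp A C D C (c_star A C D f) f))"

definition is_unit :: "('o,'m) cstarcat \<Rightarrow> 'o \<Rightarrow> 'm \<Rightarrow> bool" where
"is_unit A C u \<longleftrightarrow> u \<in> c_hom A C C \<and>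
   (\<forall>D\<in>c_obj A. \<forall>f\<in>c_hom A C D. c_comp A C C D f u = f) \<and>
   (\<forall>D\<in>c_obj A. \<forall>g\<in>c_hom A D C. c_comp A D C C u g = g)"

definition unital :: "('o,'m) cstarcat \<Rightarrow> bool" where
"unital A \<longleftrightarrow> (\<forall>C\<in>c_obj A. \<exists>u. is_unit A C u)"

type_synonym ('o1,'m1,'o2,'m2) cfun = "('o1 \<Rightarrow> 'o2) \<times> ('o1 \<Rightarrow> 'o1 \<Rightarrow> 'm1 \<Rightarrow> 'm2)"

definition star_functor :: "('o1,'m1) cstarcat \<Rightarrow> ('o2,'m2) cstarcat \<Rightarrow> ('o1,'m1,'o2,'m2) cfun \<Rightarrow> bool" where
"star_functor A B F \<longleftrightarrow>
  (\<forall>C\<in>c_obj A. fst F C \<in> c_obj B) \<and>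
  (\<forall>C\<in>c_obj A. \<forall>D\<in>c_obj A. \<forall>f\<in>c_hom A C D. snd F C D f \<in> c_hom B (fst F C) (fst F D)) \<and>
  (\<forall>C\<in>c_obj A. \<forall>D\<in>c_obj A. \<forall>f\<in>c_hom A C D. \<forall>g\<in>c_hom A C D.
     snd F C D (c_add A C D f g) = c_add B (fst F C) (fst F D) (snd F C D f) (snd F C D g)) \<and>
  (\<forall>C\<in>c_obj A. \<forall>D\<in>c_obj A. \<forall>f\<in>c_hom A C D. \<forall>a.
     snd F C D (c_scale A C D a f) = c_scale B (fst F C) (fst F D) a (snd F C D f)) \<and>
  (\<forall>C\<in>c_obj A. \<forall>D\<in>c_obj A. \<forall>E\<in>c_obj A. \<forall>f\<in>c_hom A C D. \<forall>g\<in>c_hom A D E.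
     snd F C E (c_comp A C D E g f) = c_comp B (fst F C) (fst F D) (fst F E) (snd F D E g) (snd F C D f)) \<and>
  (\<forall>C\<in>c_obj A. \<forall>D\<in>c_obj A. \<forall>f\<in>c_hom A C D.
     snd F D C (c_star A C D f) = c_star B (fst F C) (fst F D) (snd F C D f))"

definition unital_functor :: "('o1,'m1) cstarcat \<Rightarrow> ('o2,'m2) cstarcat \<Rightarrow> ('o1,'m1,'o2,'m2) cfun \<Rightarrow> bool" where
"unital_functor A B F \<longleftrightarrow>
  (\<forall>C\<in>c_obj A. \<forall>u. is_unit A C u \<longrightarrow> is_unit B (fst F C) (snd F C C u))"

definition ideal_inclusion :: "('o1,'m1) cstarcat \<Rightarrow> ('o2,'m2) cstarcat \<Rightarrow> ('o1,'m1,'o2,'m2) cfun \<Rightarrow> bool" where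
"ideal_inclusion A B F \<longleftrightarrow>
  star_functor A B F \<and>
  bij_betw (fst F) (c_obj A) (c_obj B) \<and>
  (\<forall>C\<in>c_obj A. \<forall>D\<in>c_obj A. inj_on (snd F C D) (c_hom A C D)) \<and>
  (\<forall>C\<in>c_obj A. \<forall>D\<in>c_obj A. \<forall>f\<in>c_hom A C D.
     c_norm B (fst F C) (fst F D) (snd F C D f) = c_norm A C D f) \<and>
  (\<forall>C\<in>c_obj A. \<forall>D\<in>c_obj A. \<forall>X g.
     (\<forall>n. X n \<in> snd F C D ` c_hom A C D) \<and> g \<in> c_hom B (fst F C) (fst F D) \<and>
     (\<lambda>n. c_norm B (fst F C) (fst F D)
            (c_add B (fst F C) (fst F D) (X n) (c_scale B (fst F C) (fst F D) (-1) g))) \<longlonglongrightarrow> 0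
     \<longrightarrow> g \<in> snd F C D ` c_hom A C D) \<and>
  (\<forall>C\<in>c_obj A. \<forall>D\<in>c_obj A. \<forall>E\<in>c_obj A. \<forall>f\<in>c_hom A C D. \<forall>g\<in>c_hom B (fst F D) (fst F E).
     c_comp B (fst F C) (fst F D) (fst F E) g (snd F C D f) \<in> snd F C E ` c_hom A C E) \<and>
  (\<forall>C\<in>c_obj A. \<forall>D\<in>c_obj A. \<forall>E\<in>c_obj A. \<forall>f\<in>c_hom A C D. \<forall>g\<in>c_hom B (fst F E) (fst F C).
     c_comp B (fst F E) (fst F C) (fst F D) (snd F C D f) g \<in> snd F E D ` c_hom A E D)"

definition functor_comp :: "('o1,'m1,'o2,'m2) cfun \<Rightarrow> ('o2,'m2,'o3,'m3) cfun \<Rightarrow> ('o1,'m1,'o3,'m3) cfun" where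
"functor_comp F G = (\<lambda>C. fst G (fst F C), \<lambda>C D f. snd G (fst F C) (fst F D) (snd F C D f))"

definition functor_eq_on :: "('o1,'m1) cstarcat \<Rightarrow> ('o1,'m1,'o2,'m2) cfun \<Rightarrow> ('o1,'m1,'o2,'m2) cfun \<Rightarrow> bool" where
"functor_eq_on A F G \<longleftrightarrow>
  (\<forall>C\<in>c_obj A. fst F C = fst G C) \<and>
  (\<forall>C\<in>c_obj A. \<forall>D\<in>c_obj A. \<forall>f\<in>c_hom A C D. snd F C D f = snd G C D f)"

type_synonym ('o,'m) mult = "('o \<Rightarrow> 'm \<Rightarrow> 'm) \<times> ('o \<Rightarrow> 'm \<Rightarrow> 'm)"

text \<open>Multiplier morphisms C -> D: L E : Hom(E,C) -> Hom(E,D), R E : Hom(D,E) -> Hom(C,E);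
  families are made extensional (undefined outside their domains) so that equality of
  multiplier morphisms is equality of the families on their domains.\<close>
definition mult_hom :: "('o,'m) cstarcat \<Rightarrow> 'o \<Rightarrow> 'o \<Rightarrow> ('o,'m) mult set" where
"mult_hom A C D = {(L, R). C \<in> c_obj A \<and> D \<in> c_obj A \<and>
  (\<forall>E\<in>c_obj A. \<forall>h\<in>c_hom A E C. L E h \<in> c_hom A E D) \<and>
  (\<forall>E h. (E \<notin> c_obj A \<or> h \<notin> c_hom A E C) \<longrightarrow> L E h = undefined) \<and>
  (\<forall>E\<in>c_obj A. \<forall>h\<in>c_hom A E C. \<forall>h'\<in>c_hom A E C.
     L E (c_add A E C h h') = c_add A E D (L E h) (L E h')) \<and>
  (\<forall>E\<in>c_obj A. \<forall>h\<in>c_hom A E C. \<forall>a. L E (c_scale A E C a h) = c_scale A E D a (L E h)) \<and>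
  (\<forall>E\<in>c_obj A. \<forall>F\<in>c_obj A. \<forall>h\<in>c_hom A E C. \<forall>g\<in>c_hom A F E.
     L F (c_comp A F E C h g) = c_comp A F E D (L E h) g) \<and>
  (\<exists>K. \<forall>E\<in>c_obj A. \<forall>h\<in>c_hom A E C. c_norm A E D (L E h) \<le> K * c_norm A E C h) \<and>
  (\<forall>E\<in>c_obj A. \<forall>h\<in>c_hom A D E. R E h \<in> c_hom A C E) \<and>
  (\<forall>E h. (E \<notin> c_obj A \<or> h \<notin> c_hom A D E) \<longrightarrow> R E h = undefined) \<and>
  (\<forall>E\<in>c_obj A. \<forall>h\<in>c_hom A D E. \<forall>h'\<in>c_hom A D E.
     R E (c_add A D E h h') = c_add A C E (R E h) (R E h')) \<and>
  (\<forall>E\<in>c_obj A. \<forall>h\<in>c_hom A D E. \<forall>a. R E (c_scale A D E a h) = c_scale A C E a (R E h)) \<and>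
  (\<forall>E\<in>c_obj A. \<forall>F\<in>c_obj A. \<forall>h\<in>c_hom A D E. \<forall>g\<in>c_hom A E F.
     R F (c_comp A D E F g h) = c_comp A C E F g (R E h)) \<and>
  (\<exists>K. \<forall>E\<in>c_obj A. \<forall>h\<in>c_hom A D E. c_norm A C E (R E h) \<le> K * c_norm A D E h) \<and>
  (\<forall>E\<in>c_obj A. \<forall>F\<in>c_obj A. \<forall>f\<in>c_hom A F C. \<forall>g\<in>c_hom A D E.
     c_comp A F D E g (L F f) = c_comp A F C E (R E g) f)}"

text \<open>||L|| = sup_E ||L_E|| (operator norms); 0 is inserted to cover the empty case.\<close>
definition mult_normL :: "('o,'m) cstarcat \<Rightarrow> 'o \<Rightarrow> 'o \<Rightarrow> ('o \<Rightarrow> 'm \<Rightarrow> 'm) \<Rightarrow> real" where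
"mult_normL A C D L = Sup (insert 0 {c_norm A E D (L E h) | E h.
    E \<in> c_obj A \<and> h \<in> c_hom A E C \<and> c_norm A E C h \<le> 1})"

definition mult_normR :: "('o,'m) cstarcat \<Rightarrow> 'o \<Rightarrow> 'o \<Rightarrow> ('o \<Rightarrow> 'm \<Rightarrow> 'm) \<Rightarrow> real" where
"mult_normR A C D R = Sup (insert 0 {c_norm A C E (R E h) | E h.
    E \<in> c_obj A \<and> h \<in> c_hom A D E \<and> c_norm A D E h \<le> 1})"

definition mult_cat :: "('o,'m) cstarcat \<Rightarrow> ('o, ('o,'m) mult) cstarcat" where
"mult_cat A = \<lparr>
  c_obj = c_obj A,
  c_hom = mult_hom A,
  c_zero = (\<lambda>C D.
     (\<lambda>E h. if E \<in> c_obj A \<and> h \<in> c_hom A E C then c_zero A E D else undefined,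
      \<lambda>E h. if E \<in> c_obj A \<and> h \<in> c_hom A D E then c_zero A C E else undefined)),
  c_add = (\<lambda>C D LR LR'.
     (\<lambda>E h. if E \<in> c_obj A \<and> h \<in> c_hom A E C
             then c_add A E D (fst LR E h) (fst LR' E h) else undefined,
      \<lambda>E h. if E \<in> c_obj A \<and> h \<in> c_hom A D E
             then c_add A C E (snd LR E h) (snd LR' E h) else undefined)),
  c_scale = (\<lambda>C D a LR.
     (\<lambda>E h. if E \<in> c_obj A \<and> h \<in> c_hom A E C
             then c_scale A E D a (fst LR E h) else undefined,
      \<lambda>E h. if E \<in> c_obj A \<and> h \<in> c_hom A D E
             then c_scale A C E a (snd LR E h) else undefined)),
  c_norm = (\<lambda>C D LR. max (mult_normL A C D (fst LR)) (mult_normR A C D (snd LR))),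
  c_comp = (\<lambda>C D E LR' LR.
     (\<lambda>F h. if F \<in> c_obj A \<and> h \<in> c_hom A F C then fst LR' F (fst LR F h) else undefined,
      \<lambda>F h. if F \<in> c_obj A \<and> h \<in> c_hom A E F then snd LR F (snd LR' F h) else undefined)),
  c_star = (\<lambda>C D LR.
     (\<lambda>E f. if E \<in> c_obj A \<and> f \<in> c_hom A E D
             then c_star A C E (snd LR E (c_star A E D f)) else undefined,
      \<lambda>E f. if E \<in> c_obj A \<and> f \<in> c_hom A C E
             then c_star A E D (fst LR E (c_star A C E f)) else undefined))
  \<rparr>"

definition mult_embed :: "('o,'m) cstarcat \<Rightarrow> ('o,'m,'o,('o,'m) mult) cfun" where
"mult_embed A = (\<lambda>C. C, \<lambda>C D f.
   (\<lambda>E h. if E \<in> c_obj A \<and> h \<in> c_hom A E C then c_comp A E C D f h else undefined,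
    \<lambda>E h. if E \<in> c_obj A \<and> h \<in> c_hom A D E then c_comp A C D E h f else undefined))"

end

theory Submission
  imports Defs
begin

text \<open>A multiplier is determined by the compatibility \<open>g L(f) = R(g) f\<close>: composition in a
  C*-category separates morphisms, so linearity, the module property and the equality of the two
  norms all follow from it, and the C*-identity is inherited from
  \<open>(T f)\<^sup>* (T f) = f\<^sup>* (T\<^sup>* T) f\<close>.

  The serious point is that \<open>T\<^sup>* T\<close> has spectrum in \<open>[0,\<infinity>)\<close>. For \<open>s > 0\<close> the positive
  elements \<open>p = (T f)\<^sup>* (T f)\<close> and \<open>q = s f\<^sup>* f\<close> satisfy \<open>\<parallel>q\<parallel> \<le> \<parallel>p + q\<parallel>\<close>, so \<open>T\<^sup>* T + s\<close> is bounded
  below by \<open>s\<close>, and a self-adjoint element that is bounded below is invertible. The norm estimate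
  rests on the fact that the norm of a self-adjoint \<open>x\<close> belongs, up to sign, to its spectrum: if
  \<open>\<parallel>x\<parallel> = 1\<close> and both \<open>1 - x\<close> and \<open>1 + x\<close> were bounded below, then the Cayley transforms
  \<open>(1 + u) (1 - u)\<inverse>\<close> of \<open>u = x\<^bsup>2\<^sup>n\<^esup>\<close> would have bounds tending to 1, whereas each has norm at least
  \<open>\<surd>2\<close>.

  A morphism \<open>b\<close> of a unital category containing the given one as an ideal acts on the ideal by
  composition; this multiplier is the only possible value at \<open>b\<close> of an extension.\<close>

lemma square_le_mult_imp_le:
  fixes x c :: real
  assumes "0 \<le> x" "0 \<le> c" "x * x \<le> c * x"
  shows "x \<le> c"
  using assms by (cases "x = 0") auto

section \<open>Spectra in seminormed C*-algebras\<close>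

locale seminormed_cstar_algebra =
  fixes scalar :: "complex \<Rightarrow> 'a::{ring,monoid_mult}"
    and star :: "'a \<Rightarrow> 'a"
    and seminorm :: "'a \<Rightarrow> real" ("\<parallel>_\<parallel>")
  assumes scalar_add: "scalar (a + b) = scalar a + scalar b"
    and scalar_mult: "scalar (a * b) = scalar a * scalar b"
    and scalar_one: "scalar 1 = 1"
    and scalar_central: "x * scalar a = scalar a * x"
    and star_diff: "star (x - y) = star x - star y"
    and star_mult: "star (x * y) = star y * star x"
    and star_star: "star (star x) = x"
    and star_scalar: "star (scalar a) = scalar (cnj a)"
    and seminorm_triangle: "\<parallel>x + y\<parallel> \<le> \<parallel>x\<parallel> + \<parallel>y\<parallel>"
    and seminorm_mult_le: "\<parallel>x * y\<parallel> \<le> \<parallel>x\<parallel> * \<parallel>y\<parallel>"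
    and seminorm_scalar_mult: "\<parallel>scalar a * x\<parallel> = cmod a * \<parallel>x\<parallel>"
    and seminorm_star_mult: "\<parallel>star x * x\<parallel> = \<parallel>x\<parallel>\<^sup>2"
    and complete: "(\<And>e. e > 0 \<Longrightarrow> \<exists>M. \<forall>m\<ge>M. \<forall>n\<ge>M. \<parallel>X m - X n\<parallel> < e) \<Longrightarrow>
      \<exists>x. (\<lambda>n. \<parallel>X n - x\<parallel>) \<longlonglongrightarrow> 0"
begin

lemma scalar_zero: "scalar 0 = 0"
  using scalar_add[of 0 0] by simp

lemma scalar_minus: "scalar (- a) = - scalar a"
  using scalar_add[of a "- a"] by (simp add: scalar_zero eq_neg_iff_add_eq_0 add.commute)

lemma scalar_diff: "scalar (a - b) = scalar a - scalar b"
  using scalar_add[of a "- b"] by (simp add: scalar_minus)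

lemma scalar_left_commute: "x * (scalar a * y) = scalar a * (x * y)"
  by (metis scalar_central mult.assoc)

lemma scalar_scalar_mult: "scalar a * (scalar b * x) = scalar (a * b) * x"
  by (simp add: scalar_mult mult.assoc)

lemma star_zero: "star 0 = 0"
  using star_diff[of 0 0] by simp

lemma star_add: "star (x + y) = star x + star y"
  using star_diff[of x "0 - y"] star_diff[of 0 y] by (simp add: star_zero)

lemma star_one: "star 1 = 1"
  using star_scalar[of 1] by (simp add: scalar_one)

lemma star_power: "star x = x \<Longrightarrow> star (x ^ n) = x ^ n"
  by (induction n) (simp_all add: star_one star_mult power_commutes)

lemma seminorm_zero: "\<parallel>0\<parallel> = 0"
  using seminorm_scalar_mult[of 0 0] by (simp add: scalar_zero)

lemma seminorm_minus: "\<parallel>- x\<parallel> = \<parallel>x\<parallel>"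
  using seminorm_scalar_mult[of "-1" x] by (simp add: scalar_minus scalar_one)

lemma seminorm_nonneg: "0 \<le> \<parallel>x\<parallel>"
  using seminorm_triangle[of x "- x"] by (simp add: seminorm_minus seminorm_zero)

lemma seminorm_triangle_diff: "\<parallel>x - y\<parallel> \<le> \<parallel>x\<parallel> + \<parallel>y\<parallel>"
  using seminorm_triangle[of x "- y"] by (simp add: seminorm_minus)

lemma seminorm_diff_ge: "\<parallel>x\<parallel> - \<parallel>y\<parallel> \<le> \<parallel>x - y\<parallel>"
  using seminorm_triangle[of "x - y" y] by simp

lemma seminorm_one_le: "\<parallel>1\<parallel> \<le> 1"
  using seminorm_star_mult[of 1] by (cases "\<parallel>1\<parallel> = 0") (simp_all add: star_one power2_eq_square)

lemma seminorm_power_le: "\<parallel>x ^ n\<parallel> \<le> \<parallel>x\<parallel> ^ n"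
proof (induction n)
  case 0
  then show ?case using seminorm_one_le by simp
next
  case (Suc n)
  have "\<parallel>x ^ Suc n\<parallel> \<le> \<parallel>x\<parallel> * \<parallel>x ^ n\<parallel>" using seminorm_mult_le[of x "x ^ n"] by simp
  also have "\<dots> \<le> \<parallel>x\<parallel> * \<parallel>x\<parallel> ^ n" using Suc seminorm_nonneg[of x] by (rule mult_left_mono)
  finally show ?case by simp
qed

lemma seminorm_sum_le: "finite I \<Longrightarrow> \<parallel>sum f I\<parallel> \<le> (\<Sum>i\<in>I. \<parallel>f i\<parallel>)"
proof (induction I rule: finite_induct)
  case empty
  then show ?case by (simp add: seminorm_zero)
next
  case (insert a I)
  then show ?case using seminorm_triangle[of "f a" "sum f I"] by simp
qed

lemma seminorm_self_adjoint_power: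
  assumes "star x = x"
  shows "\<parallel>x ^ 2 ^ n\<parallel> = \<parallel>x\<parallel> ^ 2 ^ n"
proof (induction n)
  case 0
  then show ?case by simp
next
  case (Suc n)
  then show ?case
    using seminorm_star_mult[of "x ^ 2 ^ n"] star_power[OF assms, of "2 ^ n"]
    by (simp add: power2_eq_square mult_2 power_add)
qed

lemma seminorm_mult_cong:
  assumes "star x * x = star y * y"
  shows "\<parallel>x * m\<parallel> = \<parallel>y * m\<parallel>"
proof -
  have "\<parallel>x * m\<parallel>\<^sup>2 = \<parallel>star m * (star x * x) * m\<parallel>"
    using seminorm_star_mult[of "x * m"] by (simp add: star_mult mult.assoc)
  also have "\<dots> = \<parallel>y * m\<parallel>\<^sup>2"
    unfolding assms using seminorm_star_mult[of "y * m"] by (simp add: star_mult mult.assoc)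
  finally show ?thesis by (simp add: seminorm_nonneg)
qed

subsection \<open>Self-adjoint elements\<close>

lemma
  assumes "star e = e" "star f = f" "e * f = f * e"
  shows seminorm_conjugate: "\<parallel>(e - scalar \<i> * f) * m\<parallel> = \<parallel>(e + scalar \<i> * f) * m\<parallel>"
    and seminorm_real_part_le: "\<parallel>e * m\<parallel> \<le> \<parallel>(e + scalar \<i> * f) * m\<parallel>"
    and seminorm_imaginary_part_le: "\<parallel>f * m\<parallel> \<le> \<parallel>(e + scalar \<i> * f) * m\<parallel>"
proof -
  define a where "a = e + scalar \<i> * f"
  define b where "b = e - scalar \<i> * f"
  have "star a = b" "star b = a"
    using assms by (simp_all add: a_def b_def star_add star_diff star_mult star_scalar
        scalar_minus scalar_central)
  moreover have "a * b = b * a"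
    using assms(3) by (simp add: a_def b_def algebra_simps scalar_left_commute[of e]
        scalar_left_commute[of f] scalar_central[of e] scalar_central[of f])
  ultimately have conjugate: "\<parallel>b * m\<parallel> = \<parallel>a * m\<parallel>" by (intro seminorm_mult_cong) simp
  then show "\<parallel>(e - scalar \<i> * f) * m\<parallel> = \<parallel>(e + scalar \<i> * f) * m\<parallel>" by (simp add: a_def b_def)
  have "a * m + b * m = scalar 2 * (e * m)"
    using scalar_add[of 1 1] by (simp add: a_def b_def algebra_simps scalar_one)
  then show "\<parallel>e * m\<parallel> \<le> \<parallel>(e + scalar \<i> * f) * m\<parallel>"
    using seminorm_triangle[of "a * m" "b * m"] by (simp add: conjugate seminorm_scalar_mult a_def)
  have "a * m - b * m = scalar (2 * \<i>) * (f * m)"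
    unfolding mult_2 scalar_add by (simp add: a_def b_def algebra_simps)
  then show "\<parallel>f * m\<parallel> \<le> \<parallel>(e + scalar \<i> * f) * m\<parallel>"
    using seminorm_triangle_diff[of "a * m" "b * m"]
    by (simp add: conjugate seminorm_scalar_mult norm_mult a_def)
qed

text \<open>Both left-hand sides are parts of \<open>(e + \<i> f)\<^sup>2\<close>, and \<open>(e + \<i> f)\<^sup>2\<close> acts with the norm of
  \<open>(e - \<i> f) (e + \<i> f) = e\<^sup>2 + f\<^sup>2\<close>.\<close>

lemma
  assumes ef: "star e = e" "star f = f" "e * f = f * e"
  shows seminorm_diff_squares_le: "\<parallel>(e * e - f * f) * m\<parallel> \<le> \<parallel>(e * e + f * f) * m\<parallel>"
    and seminorm_two_mult_le: "\<parallel>(scalar 2 * (e * f)) * m\<parallel> \<le> \<parallel>(e * e + f * f) * m\<parallel>"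
proof -
  let ?a = "e + scalar \<i> * f" and ?b = "e - scalar \<i> * f"
  let ?re = "e * e - f * f" and ?im = "scalar 2 * (e * f)"
  have left_commute: "e * (f * x) = f * (e * x)" for x using ef(3) by (metis mult.assoc)
  note central = scalar_left_commute[of e] scalar_left_commute[of f] scalar_central[of e]
    scalar_central[of f] scalar_scalar_mult scalar_minus scalar_one
  have "scalar 2 * (e * f) = e * f + e * f"
    using scalar_add[of 1 1] by (simp add: scalar_one distrib_right)
  then have square: "?a * ?a = ?re + scalar \<i> * ?im"
    using ef(3) by (simp add: algebra_simps central)
  have "\<parallel>?a * (?a * m)\<parallel> = \<parallel>?b * (?a * m)\<parallel>" by (rule seminorm_conjugate[OF ef, symmetric])
  also have "?b * (?a * m) = (e * e + f * f) * m" by (simp add: algebra_simps central left_commute)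
  finally have norm_square: "\<parallel>(?re + scalar \<i> * ?im) * m\<parallel> = \<parallel>(e * e + f * f) * m\<parallel>"
    by (simp only: mult.assoc flip: square)
  have parts: "star ?re = ?re" "star ?im = ?im" "?re * ?im = ?im * ?re"
    by (simp_all add: star_diff star_mult star_scalar ef algebra_simps central left_commute)
  show "\<parallel>?re * m\<parallel> \<le> \<parallel>(e * e + f * f) * m\<parallel>"
    using seminorm_real_part_le[OF parts, of m] by (simp only: norm_square)
  show "\<parallel>?im * m\<parallel> \<le> \<parallel>(e * e + f * f) * m\<parallel>"
    using seminorm_imaginary_part_le[OF parts, of m] by (simp only: norm_square)
qed

definition bounded_below :: "'a \<Rightarrow> real \<Rightarrow> bool" where
  "bounded_below x c \<longleftrightarrow> (\<forall>m. c * \<parallel>m\<parallel> \<le> \<parallel>x * m\<parallel>)"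

lemma bounded_belowD: "bounded_below x c \<Longrightarrow> c * \<parallel>m\<parallel> \<le> \<parallel>x * m\<parallel>"
  by (simp add: bounded_below_def)

lemma bounded_below_mono:
  assumes "bounded_below x c" "b \<le> c"
  shows "bounded_below x b"
  using assms mult_right_mono[OF assms(2) seminorm_nonneg]
  unfolding bounded_below_def by (meson order_trans)

lemma bounded_below_scalar_mult:
  "bounded_below x c \<Longrightarrow> bounded_below (scalar a * x) (cmod a * c)"
  by (simp add: bounded_below_def mult.assoc seminorm_scalar_mult mult_left_mono)

lemma bounded_below_minus: "bounded_below (- x) c \<longleftrightarrow> bounded_below x c"
  by (simp add: bounded_below_def seminorm_minus)

lemma bounded_below_minus_scalar: "bounded_below (a - scalar l) (cmod l - \<parallel>a\<parallel>)"
  unfolding bounded_below_def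
proof
  fix m
  have "\<parallel>scalar l * m\<parallel> - \<parallel>a * m\<parallel> \<le> \<parallel>(a - scalar l) * m\<parallel>"
    using seminorm_diff_ge[of "scalar l * m" "a * m"] seminorm_minus[of "(a - scalar l) * m"]
    by (simp add: algebra_simps)
  then show "(cmod l - \<parallel>a\<parallel>) * \<parallel>m\<parallel> \<le> \<parallel>(a - scalar l) * m\<parallel>"
    using seminorm_mult_le[of a m] by (simp add: seminorm_scalar_mult left_diff_distrib)
qed

text \<open>\<open>cayley_bounded u t\<close> bounds the Cayley transform \<open>(1 + u) (1 - u)\<inverse>\<close> by \<open>t\<close> without assuming
  that \<open>1 - u\<close> is invertible. Replacing \<open>u\<close> by \<open>u\<^sup>2\<close> replaces the transform by the mean of itself
  and its inverse, and for a square \<open>u = v\<^sup>2\<close> the inverse has norm at most 1; so the bounds for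
  \<open>x\<^bsup>2\<^sup>n\<^esup>\<close> decrease to 1.\<close>

definition cayley_bounded :: "'a \<Rightarrow> real \<Rightarrow> bool" where
  "cayley_bounded u t \<longleftrightarrow> (\<forall>m. \<parallel>(1 + u) * m\<parallel> \<le> t * \<parallel>(1 - u) * m\<parallel>)"

lemma cayley_bounded_square:
  assumes "star v = v" "cayley_bounded (v * v) t"
  shows "cayley_bounded ((v * v) * (v * v)) ((t + 1) / 2)"
  unfolding cayley_bounded_def
proof
  fix m
  define u where "u = v * v"
  have "(1 + u) * ((1 + u) * m) + (1 - u) * ((1 - u) * m) = scalar 2 * ((1 + u * u) * m)"
    using scalar_add[of 1 1] by (simp add: algebra_simps scalar_one)
  then have "2 * \<parallel>(1 + u * u) * m\<parallel> \<le> \<parallel>(1 + u) * ((1 + u) * m)\<parallel> + \<parallel>(1 - u) * ((1 - u) * m)\<parallel>"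
    using seminorm_triangle[of "(1 + u) * ((1 + u) * m)" "(1 - u) * ((1 - u) * m)"]
    by (simp add: seminorm_scalar_mult)
  also have "\<parallel>(1 + u) * ((1 + u) * m)\<parallel> \<le> t * \<parallel>(1 - u) * ((1 + u) * m)\<parallel>"
    using assms(2) by (simp add: cayley_bounded_def u_def)
  also have "\<parallel>(1 - u) * ((1 - u) * m)\<parallel> \<le> \<parallel>(1 + u) * ((1 - u) * m)\<parallel>"
    using seminorm_diff_squares_le[of 1 v "(1 - u) * m"] assms(1) by (simp add: star_one u_def)
  also have "(1 - u) * ((1 + u) * m) = (1 - u * u) * m" by (simp add: algebra_simps)
  also have "(1 + u) * ((1 - u) * m) = (1 - u * u) * m" by (simp add: algebra_simps)
  finally show "\<parallel>(1 + v * v * (v * v)) * m\<parallel> \<le> (t + 1) / 2 * \<parallel>(1 - v * v * (v * v)) * m\<parallel>"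
    by (simp add: u_def distrib_right)
qed

lemma cayley_bounded_power:
  assumes self_adjoint: "star x = x" and base: "cayley_bounded (x * x) (1 + K)"
  shows "cayley_bounded (x ^ 2 ^ n * x ^ 2 ^ n) (1 + K / 2 ^ n)"
proof (induction n)
  case 0
  then show ?case using base by simp
next
  case (Suc n)
  have "x ^ 2 ^ Suc n = x ^ 2 ^ n * x ^ 2 ^ n" by (simp add: mult_2 power_add)
  moreover have "1 + K / 2 ^ Suc n = ((1 + K / 2 ^ n) + 1) / 2" by (simp add: field_simps)
  ultimately show ?case using cayley_bounded_square[OF star_power[OF self_adjoint] Suc]
    by (simp only:)
qed

lemma cayley_bounded_bounded_below:
  assumes "cayley_bounded u t"
  shows "2 * \<parallel>m\<parallel> \<le> (t + 1) * \<parallel>(1 - u) * m\<parallel>"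
proof -
  have "2 * \<parallel>m\<parallel> = \<parallel>(1 + u) * m + (1 - u) * m\<parallel>"
    using seminorm_scalar_mult[of 2 m] scalar_add[of 1 1]
    by (simp add: scalar_one algebra_simps)
  also have "\<dots> \<le> \<parallel>(1 + u) * m\<parallel> + \<parallel>(1 - u) * m\<parallel>" by (rule seminorm_triangle)
  also have "\<dots> \<le> (t + 1) * \<parallel>(1 - u) * m\<parallel>"
    using assms unfolding cayley_bounded_def distrib_right by (simp add: add_right_mono)
  finally show ?thesis .
qed

text \<open>With \<open>a = 1 - v\<^sup>2\<close>, the identity \<open>a\<^sup>2 + (2 v)\<^sup>2 = (1 + v\<^sup>2)\<^sup>2\<close> bounds \<open>4 v a\<close> by
  \<open>(1 + v\<^sup>2)\<^sup>2\<close>.\<close>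

lemma cayley_bounded_contraction:
  assumes v: "star v = v" "\<parallel>v\<parallel> \<le> 1" and bounded: "cayley_bounded (v * v) t" "0 \<le> t"
  shows "2 * \<parallel>v * ((1 - v * v) * m)\<parallel> \<le> t\<^sup>2 * \<parallel>(1 - v * v) * m\<parallel>"
proof -
  define p where "p = 1 + v * v"
  define a where "a = 1 - v * v"
  have p_le_a: "\<parallel>p * y\<parallel> \<le> t * \<parallel>a * y\<parallel>" for y
    using bounded(1) by (simp add: cayley_bounded_def p_def a_def)
  have commute: "p * a = a * p" by (simp add: p_def a_def algebra_simps)
  have squares: "p * p = a * a + (scalar 2 * v) * (scalar 2 * v)"
    using scalar_add[of 1 1] by (simp add: p_def a_def algebra_simps scalar_one)
  have "\<parallel>scalar 2 * (a * (scalar 2 * v)) * m\<parallel> \<le> \<parallel>p * p * m\<parallel>"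
    unfolding squares
    by (rule seminorm_two_mult_le)
      (simp_all add: a_def star_diff star_one star_mult star_scalar v(1) algebra_simps
        scalar_left_commute[of v] scalar_central[of v])
  also have "scalar 2 * (a * (scalar 2 * v)) * m = scalar 4 * (v * (a * m))"
    by (simp add: a_def algebra_simps scalar_left_commute[of v] scalar_scalar_mult)
  finally have "4 * \<parallel>v * (a * m)\<parallel> \<le> \<parallel>p * (p * m)\<parallel>"
    by (simp add: seminorm_scalar_mult mult.assoc)
  also have "\<dots> \<le> t * \<parallel>p * (a * m)\<parallel>"
    using p_le_a[of "p * m"] by (simp add: commute flip: mult.assoc)
  also have "\<dots> \<le> t * (t * \<parallel>a * (a * m)\<parallel>)"
    using p_le_a[of "a * m"] bounded(2) by (rule mult_left_mono)
  also have "\<parallel>a * (a * m)\<parallel> \<le> 2 * \<parallel>a * m\<parallel>"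
  proof -
    have "\<parallel>a\<parallel> \<le> \<parallel>1\<parallel> + \<parallel>v\<parallel> * \<parallel>v\<parallel>"
      using seminorm_triangle_diff[of 1 "v * v"] seminorm_mult_le[of v v] by (simp add: a_def)
    also have "\<dots> \<le> 2"
      using seminorm_one_le mult_le_one[OF v(2) seminorm_nonneg v(2)] by simp
    finally have "\<parallel>a\<parallel> * \<parallel>a * m\<parallel> \<le> 2 * \<parallel>a * m\<parallel>" using seminorm_nonneg by (rule mult_right_mono)
    then show ?thesis using seminorm_mult_le[of a "a * m"] by simp
  qed
  finally show ?thesis using bounded(2) by (simp add: a_def power2_eq_square mult_left_mono)
qed

lemma cayley_bounded_norm_one:
  assumes v: "star v = v" "\<parallel>v\<parallel> = 1" and bounded: "cayley_bounded (v * v) t" "0 \<le> t"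
  shows "2 \<le> t\<^sup>2"
proof (rule ccontr)
  define a where "a = 1 - v * v"
  define r where "r = t\<^sup>2 / 2"
  assume "\<not> 2 \<le> t\<^sup>2"
  then have r_bounds: "0 \<le> r" "r < 1" by (simp_all add: r_def)
  have commute: "v * a = a * v" by (simp add: a_def algebra_simps)
  have contract: "\<parallel>v * (a * m)\<parallel> \<le> r * \<parallel>a * m\<parallel>" for m
    using cayley_bounded_contraction[of v t m] v bounded by (simp add: a_def r_def)
  have decay: "\<parallel>a * v ^ j\<parallel> \<le> r ^ j * \<parallel>a\<parallel>" for j
  proof (induction j)
    case 0
    then show ?case by simp
  next
    case (Suc j)
    have "\<parallel>a * v ^ Suc j\<parallel> = \<parallel>v * (a * v ^ j)\<parallel>" by (simp add: commute flip: mult.assoc)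
    also have "\<dots> \<le> r * \<parallel>a * v ^ j\<parallel>" by (rule contract)
    also have "\<dots> \<le> r * (r ^ j * \<parallel>a\<parallel>)" using Suc r_bounds(1) by (rule mult_left_mono)
    finally show ?case by simp
  qed
  define b where "b = (t + 1) * (\<parallel>a\<parallel> + 1)"
  have b_pos: "0 < b" using bounded(2) seminorm_nonneg[of a] by (simp add: b_def)
  obtain n where small: "r ^ n < 2 / b" using real_arch_pow_inv[of "2 / b" r] b_pos r_bounds by auto
  have "2 = 2 * \<parallel>v ^ 2 ^ n\<parallel>" using v by (simp add: seminorm_self_adjoint_power)
  also have "\<dots> \<le> (t + 1) * \<parallel>a * v ^ 2 ^ n\<parallel>"
    unfolding a_def using bounded(1) by (rule cayley_bounded_bounded_below)
  also have "\<dots> \<le> (t + 1) * (r ^ 2 ^ n * (\<parallel>a\<parallel> + 1))"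
    using decay[of "2 ^ n"] mult_left_mono[of "\<parallel>a\<parallel>" "\<parallel>a\<parallel> + 1" "r ^ 2 ^ n"] r_bounds(1) bounded(2)
    by (intro mult_left_mono) auto
  also have "\<dots> \<le> r ^ n * b"
    using power_decreasing[of n "2 ^ n" r] r_bounds bounded(2) seminorm_nonneg[of a]
    by (simp add: b_def mult_right_mono ac_simps less_imp_le)
  also have "\<dots> < 2" using small b_pos by (simp add: less_divide_eq)
  finally show False by simp
qed

lemma self_adjoint_norm_one_not_bounded_below:
  assumes x: "star x = x" "\<parallel>x\<parallel> = 1"
    and bounded: "0 < c" "bounded_below (1 - x) c" "bounded_below (1 + x) c"
  shows False
proof -
  define K where "K = 2 / c\<^sup>2"
  have K_pos: "0 < K" using bounded(1) by (simp add: K_def)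
  have base: "cayley_bounded (x * x) (1 + K)"
    unfolding cayley_bounded_def
  proof
    fix m
    have "c\<^sup>2 * \<parallel>m\<parallel> \<le> c * \<parallel>(1 + x) * m\<parallel>"
      using bounded_belowD[OF bounded(3), of m] bounded(1) by (simp add: power2_eq_square)
    also have "\<dots> \<le> \<parallel>(1 - x) * ((1 + x) * m)\<parallel>" using bounded(2) by (rule bounded_belowD)
    also have "(1 - x) * ((1 + x) * m) = (1 - x * x) * m" by (simp add: algebra_simps)
    finally have "2 * \<parallel>m\<parallel> \<le> K * \<parallel>(1 - x * x) * m\<parallel>"
      using bounded(1) by (simp add: K_def field_simps)
    moreover have "\<parallel>(1 + x * x) * m\<parallel> \<le> \<parallel>m\<parallel> + \<parallel>x\<parallel> * (\<parallel>x\<parallel> * \<parallel>m\<parallel>)"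
      using seminorm_triangle[of m "x * (x * m)"] seminorm_mult_le[of x "x * m"]
        seminorm_mult_le[of x m] x(2)
      by (simp add: distrib_right mult.assoc)
    ultimately show "\<parallel>(1 + x * x) * m\<parallel> \<le> (1 + K) * \<parallel>(1 - x * x) * m\<parallel>"
      using seminorm_nonneg[of "(1 - x * x) * m"] by (simp add: x(2) distrib_right)
  qed
  obtain n where small: "(1/2) ^ n < 1 / (4 * K)"
    using real_arch_pow_inv[of "1 / (4 * K)" "1/2"] K_pos by auto
  define t where "t = 1 + K / 2 ^ n"
  have "2 \<le> t\<^sup>2"
  proof (rule cayley_bounded_norm_one)
    show "star (x ^ 2 ^ n) = x ^ 2 ^ n" using x(1) by (rule star_power)
    show "\<parallel>x ^ 2 ^ n\<parallel> = 1" using x by (simp add: seminorm_self_adjoint_power)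
    show "cayley_bounded (x ^ 2 ^ n * x ^ 2 ^ n) t"
      unfolding t_def using x(1) base by (rule cayley_bounded_power)
  qed (use K_pos in \<open>simp add: t_def\<close>)
  moreover have "0 \<le> t" "t \<le> 5/4" using small K_pos by (simp_all add: t_def field_simps)
  then have "t\<^sup>2 \<le> (5/4)\<^sup>2" by (intro power_mono)
  ultimately show False by (simp add: power2_eq_square)
qed

lemma self_adjoint_norm_le:
  assumes "star x = x" "0 \<le> t"
    and bounded: "\<And>s. t < \<bar>s\<bar> \<Longrightarrow> \<exists>c>0. bounded_below (x - scalar (of_real s)) c"
  shows "\<parallel>x\<parallel> \<le> t"
proof (rule ccontr)
  assume "\<not> \<parallel>x\<parallel> \<le> t"
  then have large: "t < \<parallel>x\<parallel>" "0 < \<parallel>x\<parallel>" using assms(2) by auto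
  define a :: complex where "a = of_real (1 / \<parallel>x\<parallel>)"
  have scale: "cmod a = 1 / \<parallel>x\<parallel>" "a * of_real \<parallel>x\<parallel> = 1"
    using large by (simp_all add: a_def norm_divide)
  obtain c where below_right: "0 < c" "bounded_below (x - scalar (of_real \<parallel>x\<parallel>)) c"
    using bounded[of "\<parallel>x\<parallel>"] large by auto
  obtain d where below_left: "0 < d" "bounded_below (x - scalar (of_real (- \<parallel>x\<parallel>))) d"
    using bounded[of "- \<parallel>x\<parallel>"] large by auto
  define y where "y = scalar a * x"
  have "1 - y = - (scalar a * (x - scalar (of_real \<parallel>x\<parallel>)))"
    using scale(2) by (simp add: y_def right_diff_distrib scalar_one flip: scalar_mult)
  then have "bounded_below (1 - y) (c / \<parallel>x\<parallel>)"
    using bounded_below_scalar_mult[OF below_right(2), of a]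
    by (simp add: bounded_below_minus scale(1))
  moreover have "1 + y = scalar a * (x - scalar (of_real (- \<parallel>x\<parallel>)))"
    using scale(2) by (simp add: y_def distrib_left scalar_one scalar_minus flip: scalar_mult)
  then have "bounded_below (1 + y) (d / \<parallel>x\<parallel>)"
    using bounded_below_scalar_mult[OF below_left(2), of a] by (simp add: scale(1))
  moreover have "star y = y"
    by (simp add: y_def star_mult star_scalar assms(1) scalar_central a_def)
  moreover have "\<parallel>y\<parallel> = 1" using large by (simp add: y_def seminorm_scalar_mult scale(1))
  ultimately show False
    using self_adjoint_norm_one_not_bounded_below[of y "min c d / \<parallel>x\<parallel>"] large below_right(1)
      below_left(1)
      bounded_below_mono[of _ _ "min c d / \<parallel>x\<parallel>"] by (simp add: divide_right_mono)
qed

subsection \<open>Positive elements\<close>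

definition positive :: "'a \<Rightarrow> bool" where
  "positive p \<longleftrightarrow> star p = p \<and> (\<forall>s>0. \<exists>c>0. bounded_below (p + scalar (of_real s)) c)"

lemma positive_star: "positive p \<Longrightarrow> star p = p"
  by (simp add: positive_def)

lemma positive_bounded_below:
  "positive p \<Longrightarrow> 0 < s \<Longrightarrow> \<exists>c>0. bounded_below (p + scalar (of_real s)) c"
  by (simp add: positive_def)

lemma bounded_below_add_scalar:
  "\<parallel>a\<parallel> < cmod l \<Longrightarrow> \<exists>c>0. bounded_below (a + scalar l) c"
  using bounded_below_minus_scalar[of a "- l"]
  by (intro exI[of _ "cmod l - \<parallel>a\<parallel>"]) (simp add: scalar_minus)

lemma positive_norm_minus_le:
  assumes "positive p"
  shows "\<parallel>scalar (of_real \<parallel>p\<parallel>) - p\<parallel> \<le> \<parallel>p\<parallel>"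
proof (rule self_adjoint_norm_le)
  show "star (scalar (of_real \<parallel>p\<parallel>) - p) = scalar (of_real \<parallel>p\<parallel>) - p"
    using assms by (simp add: positive_star star_diff star_scalar)
  fix s assume outside: "\<parallel>p\<parallel> < \<bar>s\<bar>"
  have "\<exists>c>0. bounded_below (p + scalar (of_real (s - \<parallel>p\<parallel>))) c"
  proof (cases "0 < s")
    case True
    then show ?thesis using assms outside by (intro positive_bounded_below) auto
  next
    case False
    then have "\<parallel>p\<parallel> < cmod (of_real (s - \<parallel>p\<parallel>))"
      using outside seminorm_nonneg[of p] by (simp only: norm_of_real)
    then show ?thesis by (rule bounded_below_add_scalar)
  qed
  moreover have "scalar (of_real \<parallel>p\<parallel>) - p - scalar (of_real s) = - (p + scalar (of_real (s - \<parallel>p\<parallel>)))"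
    by (simp add: scalar_diff)
  ultimately show "\<exists>c>0. bounded_below (scalar (of_real \<parallel>p\<parallel>) - p - scalar (of_real s)) c"
    by (simp only: bounded_below_minus)
qed (rule seminorm_nonneg)

lemma positiveI:
  assumes "star p = p" "\<parallel>scalar (of_real t) - p\<parallel> \<le> t"
  shows "positive p"
  unfolding positive_def
proof (intro conjI allI impI assms(1))
  fix s :: real assume "0 < s"
  then have "\<parallel>p - scalar (of_real t)\<parallel> < cmod (of_real (t + s))"
    using assms(2) seminorm_minus[of "p - scalar (of_real t)"]
      seminorm_nonneg[of "p - scalar (of_real t)"]
    by (simp only: norm_of_real minus_diff_eq)
  then have "\<exists>c>0. bounded_below (p - scalar (of_real t) + scalar (of_real (t + s))) c"
    by (rule bounded_below_add_scalar)
  then show "\<exists>c>0. bounded_below (p + scalar (of_real s)) c" by (simp add: scalar_add)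
qed

lemma positive_add:
  assumes "positive p" "positive q"
  shows "positive (p + q)"
proof (rule positiveI)
  show "star (p + q) = p + q" using assms by (simp add: positive_star star_add)
  have "scalar (of_real (\<parallel>p\<parallel> + \<parallel>q\<parallel>)) - (p + q)
      = (scalar (of_real \<parallel>p\<parallel>) - p) + (scalar (of_real \<parallel>q\<parallel>) - q)"
    by (simp add: scalar_add)
  also have "\<parallel>\<dots>\<parallel> \<le> \<parallel>p\<parallel> + \<parallel>q\<parallel>"
    using positive_norm_minus_le[OF assms(1)] positive_norm_minus_le[OF assms(2)]
    by (intro order_trans[OF seminorm_triangle] add_mono)
  finally show "\<parallel>scalar (of_real (\<parallel>p\<parallel> + \<parallel>q\<parallel>)) - (p + q)\<parallel> \<le> \<parallel>p\<parallel> + \<parallel>q\<parallel>" .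
qed

lemma positive_norm_mono:
  assumes p: "positive p" and q: "positive q"
  shows "\<parallel>q\<parallel> \<le> \<parallel>p + q\<parallel>"
proof (rule self_adjoint_norm_le)
  let ?t = "\<parallel>p + q\<parallel>"
  have "positive (scalar (of_real ?t) - (p + q))"
    by (rule positiveI[where t = ?t])
      (simp_all add: positive_star[OF p] positive_star[OF q] star_diff star_add star_scalar
        add.commute)
  then have upper: "positive (scalar (of_real ?t) - q)" using positive_add[OF _ p] by fastforce
  show "star q = q" using q by (rule positive_star)
  fix s assume outside: "?t < \<bar>s\<bar>"
  show "\<exists>c>0. bounded_below (q - scalar (of_real s)) c"
  proof (cases "0 < s")
    case True
    then have "\<exists>c>0. bounded_below (scalar (of_real ?t) - q + scalar (of_real (s - ?t))) c"
      using outside by (intro positive_bounded_below upper) simp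
    moreover have "scalar (of_real ?t) - q + scalar (of_real (s - ?t)) = - (q - scalar (of_real s))"
      by (simp add: scalar_diff)
    ultimately show ?thesis by (simp only: bounded_below_minus)
  next
    case False
    then have "\<exists>c>0. bounded_below (q + scalar (of_real (- s))) c"
      using outside seminorm_nonneg[of "p + q"] by (intro positive_bounded_below q) simp
    then show ?thesis by (simp add: scalar_minus)
  qed
qed (rule seminorm_nonneg)

subsection \<open>Invertibility\<close>

lemma null_add: "\<parallel>x\<parallel> = 0 \<Longrightarrow> \<parallel>y\<parallel> = 0 \<Longrightarrow> \<parallel>x + y\<parallel> = 0"
  using seminorm_triangle[of x y] seminorm_nonneg[of "x + y"] by simp

lemma null_diff: "\<parallel>x\<parallel> = 0 \<Longrightarrow> \<parallel>y\<parallel> = 0 \<Longrightarrow> \<parallel>x - y\<parallel> = 0"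
  using null_add[of x "- y"] by (simp add: seminorm_minus)

lemma null_mult_left: "\<parallel>x\<parallel> = 0 \<Longrightarrow> \<parallel>x * y\<parallel> = 0"
  using seminorm_mult_le[of x y] seminorm_nonneg[of "x * y"] by simp

lemma null_mult_right: "\<parallel>x\<parallel> = 0 \<Longrightarrow> \<parallel>y * x\<parallel> = 0"
  using seminorm_mult_le[of y x] seminorm_nonneg[of "y * x"] by simp

lemma seminorm_cong: "\<parallel>x - y\<parallel> = 0 \<Longrightarrow> \<parallel>x\<parallel> = \<parallel>y\<parallel>"
  using seminorm_diff_ge[of x y] seminorm_diff_ge[of y x] seminorm_minus[of "x - y"] by simp

definition inverse_pair :: "'a \<Rightarrow> 'a \<Rightarrow> bool" where
  "inverse_pair x y \<longleftrightarrow> \<parallel>x * y - 1\<parallel> = 0 \<and> \<parallel>y * x - 1\<parallel> = 0"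

definition invertible :: "'a \<Rightarrow> bool" where
  "invertible x \<longleftrightarrow> (\<exists>y. inverse_pair x y)"

lemma geometric_sum_dist:
  "\<parallel>(\<Sum>i<m. d ^ i) - (\<Sum>i<n. d ^ i)\<parallel> \<le> \<bar>(\<Sum>i<m. \<parallel>d\<parallel> ^ i) - (\<Sum>i<n. \<parallel>d\<parallel> ^ i)\<bar>"
proof (induction m n rule: linorder_wlog)
  case (le n m)
  have split: "(\<Sum>i<m. f i) = (\<Sum>i<n. f i) + (\<Sum>i\<in>{n..<m}. f i)" for f :: "nat \<Rightarrow> 'b::comm_monoid_add"
    using le by (metis lessThan_atLeast0 sum.atLeastLessThan_concat zero_le)
  have "\<parallel>(\<Sum>i<n. d ^ i) - (\<Sum>i<m. d ^ i)\<parallel> = \<parallel>\<Sum>i\<in>{n..<m}. d ^ i\<parallel>"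
    using seminorm_minus[of "\<Sum>i\<in>{n..<m}. d ^ i"] by (simp add: split)
  also have "\<dots> \<le> (\<Sum>i\<in>{n..<m}. \<parallel>d ^ i\<parallel>)" by (rule seminorm_sum_le) simp
  also have "\<dots> \<le> (\<Sum>i\<in>{n..<m}. \<parallel>d\<parallel> ^ i)" by (rule sum_mono) (rule seminorm_power_le)
  also have "\<dots> \<le> \<bar>(\<Sum>i<n. \<parallel>d\<parallel> ^ i) - (\<Sum>i<m. \<parallel>d\<parallel> ^ i)\<bar>" by (simp add: split)
  finally show ?case .
next
  case (sym n m)
  then show ?case
    using seminorm_minus[of "(\<Sum>i<n. d ^ i) - (\<Sum>i<m. d ^ i)"] by (simp add: abs_minus_commute)
qed

lemma geometric_series_converges:
  assumes "\<parallel>d\<parallel> < 1"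
  shows "\<exists>z. (\<lambda>n. \<parallel>(\<Sum>i<n. d ^ i) - z\<parallel>) \<longlonglongrightarrow> 0"
proof (rule complete)
  fix e :: real assume "0 < e"
  moreover have "summable (\<lambda>i. \<parallel>d\<parallel> ^ i)"
    using assms seminorm_nonneg[of d] by (simp add: summable_geometric)
  then have "Cauchy (\<lambda>n. \<Sum>i<n. \<parallel>d\<parallel> ^ i)" by (simp add: summable_iff_convergent convergent_Cauchy)
  ultimately show "\<exists>M. \<forall>m\<ge>M. \<forall>n\<ge>M. \<parallel>(\<Sum>i<m. d ^ i) - (\<Sum>i<n. d ^ i)\<parallel> < e"
    using geometric_sum_dist unfolding Cauchy_def dist_real_def by (meson le_less_trans)
qed

lemma invertible_one_minus:
  assumes "\<parallel>d\<parallel> < 1"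
  shows "invertible (1 - d)"
proof -
  let ?S = "\<lambda>n. \<Sum>i<n. d ^ i"
  obtain z where limit: "(\<lambda>n. \<parallel>?S n - z\<parallel>) \<longlonglongrightarrow> 0" using geometric_series_converges[OF assms] by blast
  have telescope_right: "(1 - d) * ?S n = 1 - d ^ n" for n
    by (induction n) (simp_all add: distrib_left, simp add: left_diff_distrib)
  have telescope_left: "?S n * (1 - d) = 1 - d ^ n" for n
    by (induction n) (simp_all add: distrib_right, simp add: right_diff_distrib power_commutes)
  have null: "\<parallel>w - 1\<parallel> = 0"
    if bound: "\<And>n. \<parallel>(w - 1) + d ^ n\<parallel> \<le> \<parallel>1 - d\<parallel> * \<parallel>?S n - z\<parallel>" for w
  proof -
    have "\<parallel>w - 1\<parallel> \<le> \<parallel>1 - d\<parallel> * \<parallel>?S n - z\<parallel> + \<parallel>d\<parallel> ^ n" for n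
      using bound[of n] seminorm_triangle_diff[of "(w - 1) + d ^ n" "d ^ n"]
        seminorm_power_le[of d n]
      by simp
    moreover have "(\<lambda>n. \<parallel>1 - d\<parallel> * \<parallel>?S n - z\<parallel> + \<parallel>d\<parallel> ^ n) \<longlonglongrightarrow> \<parallel>1 - d\<parallel> * 0 + 0"
      using assms seminorm_nonneg by (intro tendsto_intros limit LIMSEQ_realpow_zero)
    ultimately have "\<parallel>w - 1\<parallel> \<le> 0" using LIMSEQ_le_const by fastforce
    then show ?thesis using seminorm_nonneg[of "w - 1"] by simp
  qed
  have "\<parallel>(1 - d) * z - 1\<parallel> = 0"
  proof (rule null)
    fix n
    have "(1 - d) * z - 1 + d ^ n = - ((1 - d) * (?S n - z))"
      unfolding right_diff_distrib[of "1 - d"] telescope_right by simp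
    then show "\<parallel>(1 - d) * z - 1 + d ^ n\<parallel> \<le> \<parallel>1 - d\<parallel> * \<parallel>?S n - z\<parallel>"
      by (simp only: seminorm_minus seminorm_mult_le)
  qed
  moreover have "\<parallel>z * (1 - d) - 1\<parallel> = 0"
  proof (rule null)
    fix n
    have "z * (1 - d) - 1 + d ^ n = - ((?S n - z) * (1 - d))"
      unfolding left_diff_distrib[of _ _ "1 - d"] telescope_left by simp
    then show "\<parallel>z * (1 - d) - 1 + d ^ n\<parallel> \<le> \<parallel>1 - d\<parallel> * \<parallel>?S n - z\<parallel>"
      using seminorm_mult_le[of "?S n - z" "1 - d"] by (simp add: seminorm_minus mult.commute)
  qed
  ultimately show ?thesis unfolding invertible_def inverse_pair_def by blast
qed

lemma invertible_add:
  assumes inverse: "inverse_pair x y" and small: "\<parallel>d\<parallel> * \<parallel>y\<parallel> < 1"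
  shows "invertible (x + d)"
proof -
  have "\<parallel>- (y * d)\<parallel> < 1"
    using seminorm_mult_le[of y d] small by (simp add: seminorm_minus mult.commute)
  from invertible_one_minus[OF this] obtain w where inverse_w: "inverse_pair (1 + y * d) w"
    unfolding invertible_def by auto
  note null = inverse[unfolded inverse_pair_def] inverse_w[unfolded inverse_pair_def]
  have "\<parallel>(x + d) * (w * y) - 1\<parallel> = 0"
  proof -
    have "(x + d) * (w * y) - 1
        = x * (((1 + y * d) * w - 1) * y) + (x * y - 1) - (x * y - 1) * (d * w * y)"
      by (simp add: algebra_simps)
    then show ?thesis by (simp only: null null_diff null_add null_mult_left null_mult_right)
  qed
  moreover have "\<parallel>(w * y) * (x + d) - 1\<parallel> = 0"
  proof -
    have "(w * y) * (x + d) - 1 = (w * (1 + y * d) - 1) + w * (y * x - 1)"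
      by (simp add: algebra_simps)
    then show ?thesis by (simp only: null null_add null_mult_right)
  qed
  ultimately show ?thesis unfolding invertible_def inverse_pair_def by blast
qed

lemma invertible_imp_bounded_below:
  assumes "invertible x"
  shows "\<exists>c>0. bounded_below x c"
proof -
  obtain y where inverse: "inverse_pair x y" using assms by (auto simp: invertible_def)
  have pos: "0 < \<parallel>y\<parallel> + 1" using seminorm_nonneg[of y] by simp
  have "\<parallel>m\<parallel> \<le> (\<parallel>y\<parallel> + 1) * \<parallel>x * m\<parallel>" for m
  proof -
    have "\<parallel>y * (x * m) - m\<parallel> = 0"
      using null_mult_left[of "y * x - 1" m] inverse by (simp add: inverse_pair_def algebra_simps)
    then have "\<parallel>m\<parallel> = \<parallel>y * (x * m)\<parallel>" by (simp add: seminorm_cong)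
    also have "\<dots> \<le> \<parallel>y\<parallel> * \<parallel>x * m\<parallel>" by (rule seminorm_mult_le)
    finally show ?thesis using seminorm_nonneg[of "x * m"] by (simp add: distrib_right)
  qed
  then have "bounded_below x (1 / (\<parallel>y\<parallel> + 1))"
    using pos by (simp add: bounded_below_def divide_le_eq mult.commute)
  then show ?thesis using pos by (intro exI[of _ "1 / (\<parallel>y\<parallel> + 1)"]) simp
qed

lemma inverse_pair_norm_le:
  assumes "inverse_pair x y" "bounded_below x c" "0 < c"
  shows "\<parallel>y\<parallel> \<le> 1 / c"
proof -
  have "c * \<parallel>y\<parallel> \<le> \<parallel>x * y\<parallel>" using assms(2) by (rule bounded_belowD)
  also have "\<dots> = \<parallel>1\<parallel>" using assms(1) by (simp add: inverse_pair_def seminorm_cong)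
  also have "\<dots> \<le> 1" by (rule seminorm_one_le)
  finally show ?thesis using assms(3) by (simp add: le_divide_eq mult.commute)
qed

lemma invertible_add_bounded_below:
  assumes x: "invertible x" "bounded_below x c" and small: "\<parallel>d\<parallel> < c"
  shows "invertible (x + d)"
proof -
  obtain y where inverse: "inverse_pair x y" using x(1) by (auto simp: invertible_def)
  have c_pos: "0 < c" using small seminorm_nonneg[of d] by simp
  have "\<parallel>d\<parallel> * \<parallel>y\<parallel> \<le> \<parallel>d\<parallel> * (1 / c)"
    using inverse_pair_norm_le[OF inverse x(2) c_pos] seminorm_nonneg by (rule mult_left_mono)
  also have "\<dots> < 1" using c_pos small by simp
  finally show ?thesis by (rule invertible_add[OF inverse])
qed

text \<open>The method of continuity: a uniform lower bound along a segment allows steps of a fixed size.\<close>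

lemma invertible_along_segment:
  assumes x: "invertible x" and c_pos: "0 < c"
    and bounded: "\<And>t. 0 \<le> t \<Longrightarrow> t \<le> 1 \<Longrightarrow> bounded_below (x + scalar (of_real t) * d) c"
  shows "invertible (x + d)"
proof -
  obtain M :: nat where M_large: "\<parallel>d\<parallel> / c < real M" using reals_Archimedean2 by blast
  then have M_pos: "0 < M"
    using c_pos by (metis divide_nonneg_pos gr0I not_le of_nat_0 seminorm_nonneg)
  define y where "y n = x + scalar (of_real (real n / real M)) * d" for n
  define step where "step = scalar (of_real (1 / real M)) * d"
  have step: "\<parallel>step\<parallel> < c"
    using M_large M_pos c_pos
    by (simp add: step_def seminorm_scalar_mult norm_divide divide_less_eq mult.commute)
  have "invertible (y n)" if "n \<le> M" for n
    using that
  proof (induction n)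
    case 0
    then show ?case using x by (simp add: y_def scalar_zero)
  next
    case (Suc n)
    have "invertible (y n + step)"
    proof (rule invertible_add_bounded_below)
      show "bounded_below (y n) c" unfolding y_def using Suc.prems M_pos by (intro bounded) auto
    qed (use Suc step in auto)
    moreover have "y (Suc n) = y n + step"
      by (simp add: y_def step_def add_divide_distrib scalar_add distrib_right add_ac)
    ultimately show ?case by simp
  qed
  from this[of M] show ?thesis using M_pos by (simp add: y_def scalar_one)
qed

lemma invertible_scalar_add:
  assumes "\<parallel>a\<parallel> < cmod l"
  shows "invertible (scalar l + a)"
proof (rule invertible_add_bounded_below[OF _ _ assms])
  have "l \<noteq> 0" using assms seminorm_nonneg[of a] by auto
  then have "inverse_pair (scalar l) (scalar (1 / l))"
    by (simp add: inverse_pair_def scalar_one seminorm_zero flip: scalar_mult)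
  then show "invertible (scalar l)" unfolding invertible_def by blast
  show "bounded_below (scalar l) (cmod l)" by (simp add: bounded_below_def seminorm_scalar_mult)
qed

lemma self_adjoint_bounded_below_imaginary:
  assumes "star h = h"
  shows "bounded_below (h + scalar (of_real y * \<i>)) \<bar>y\<bar>"
    and "bounded_below h c \<Longrightarrow> bounded_below (h + scalar (of_real y * \<i>)) c"
proof -
  have y: "star (scalar (of_real y)) = scalar (of_real y)" by (simp add: star_scalar)
  have split: "h + scalar (of_real y * \<i>) = h + scalar \<i> * scalar (of_real y)"
    by (simp add: mult.commute flip: scalar_mult)
  show "bounded_below (h + scalar (of_real y * \<i>)) \<bar>y\<bar>"
    using seminorm_imaginary_part_le[OF assms y scalar_central]
    by (simp add: bounded_below_def split seminorm_scalar_mult)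
  show "bounded_below (h + scalar (of_real y * \<i>)) c" if "bounded_below h c"
    using that seminorm_real_part_le[OF assms y scalar_central]
    unfolding bounded_below_def split by (meson order_trans)
qed

text \<open>On the vertical line from \<open>h + y \<i>\<close> away from the real axis the lower bound does not drop,
  and far out the element is invertible.\<close>

lemma invertible_self_adjoint_add_imaginary:
  assumes self_adjoint: "star h = h" and c_pos: "0 < c"
    and bounded: "\<And>t. \<bar>y\<bar> \<le> \<bar>t\<bar> \<Longrightarrow> bounded_below (h + scalar (of_real t * \<i>)) c"
  shows "invertible (h + scalar (of_real y * \<i>))"
proof -
  define w where "w = (if 0 \<le> y then \<parallel>h\<parallel> + 1 else - (\<parallel>h\<parallel> + 1))"
  have far_out: "\<parallel>h\<parallel> < \<bar>y + w\<bar>" "t \<le> 1 \<Longrightarrow> \<bar>y\<bar> \<le> \<bar>y + w - t * w\<bar>" for t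
  proof -
    show "\<parallel>h\<parallel> < \<bar>y + w\<bar>" using seminorm_nonneg[of h] by (simp add: w_def)
    assume "t \<le> 1"
    then have "0 \<le> (1 - t) * (\<parallel>h\<parallel> + 1)" using seminorm_nonneg[of h] by simp
    then show "\<bar>y\<bar> \<le> \<bar>y + w - t * w\<bar>" by (auto simp: w_def algebra_simps)
  qed
  let ?far = "h + scalar (of_real (y + w) * \<i>)"
  let ?d = "scalar (of_real (- w) * \<i>)"
  have "invertible (?far + ?d)"
  proof (rule invertible_along_segment[OF _ c_pos])
    show "invertible ?far"
      using far_out(1) invertible_scalar_add[of h "of_real (y + w) * \<i>"]
      by (simp add: norm_mult add.commute del: of_real_add)
    fix t :: real assume "t \<le> 1"
    then have "bounded_below (h + scalar (of_real (y + w - t * w) * \<i>)) c"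
      using far_out(2) by (intro bounded)
    also have "of_real (y + w - t * w) * \<i> = of_real (y + w) * \<i> + of_real t * (of_real (- w) * \<i>)"
      by (simp add: algebra_simps)
    finally show "bounded_below (?far + scalar (of_real t) * ?d) c"
      by (simp only: scalar_add scalar_mult add.assoc)
  qed
  moreover have "of_real (y + w) * \<i> + of_real (- w) * \<i> = of_real y * \<i>"
    by (simp add: algebra_simps)
  ultimately show ?thesis by (simp only: add.assoc flip: scalar_add)
qed

lemma self_adjoint_resolvent_off_half_line:
  assumes self_adjoint: "star a = a"
    and bounded: "\<And>s. 0 < s \<Longrightarrow> bounded_below (a + scalar (of_real s)) s"
    and off_half_line: "\<not> (l \<in> \<real> \<and> 0 \<le> Re l)"
  shows "invertible (a - scalar l)"
proof -
  define h where "h = a - scalar (of_real (Re l))"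
  have self_adjoint_h: "star h = h" using self_adjoint by (simp add: h_def star_diff star_scalar)
  have "invertible (h + scalar (of_real (- Im l) * \<i>))"
  proof (cases "Im l = 0")
    case True
    then have "0 < - Re l" using off_half_line by (auto simp: complex_is_Real_iff)
    moreover from this have "bounded_below h (- Re l)"
      using bounded[of "- Re l"] by (simp add: h_def scalar_minus)
    ultimately show ?thesis
      by (intro invertible_self_adjoint_add_imaginary self_adjoint_bounded_below_imaginary(2)
        self_adjoint_h)
  next
    case False
    then show ?thesis
      using bounded_below_mono[OF self_adjoint_bounded_below_imaginary(1)[OF self_adjoint_h]]
      by (intro invertible_self_adjoint_add_imaginary[OF self_adjoint_h, of "\<bar>Im l\<bar>"]) auto
  qed
  also have "h + scalar (of_real (- Im l) * \<i>) = a - scalar (of_real (Re l) + of_real (Im l) * \<i>)"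
    by (simp add: h_def scalar_add scalar_minus)
  also have "of_real (Re l) + of_real (Im l) * \<i> = l" by (simp add: complex_eq_iff)
  finally show ?thesis .
qed

lemma invertible_iff_quasi_inverse:
  assumes "l \<noteq> 0"
  shows "invertible (a - scalar l) \<longleftrightarrow>
    (\<exists>b. \<parallel>a * b + scalar (- l) * b + scalar (- (1 / l)) * a\<parallel> = 0 \<and>
      \<parallel>b * a + scalar (- l) * b + scalar (- (1 / l)) * a\<parallel> = 0)"
proof -
  have scalar_inverse: "scalar l * scalar (1 / l) = 1" "scalar (1 / l) * scalar l = 1"
    using assms by (simp_all add: scalar_one flip: scalar_mult)
  have "inverse_pair (a - scalar l) (b - scalar (1 / l)) \<longleftrightarrow>
      \<parallel>a * b + scalar (- l) * b + scalar (- (1 / l)) * a\<parallel> = 0 \<and>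
      \<parallel>b * a + scalar (- l) * b + scalar (- (1 / l)) * a\<parallel> = 0" for b
    unfolding inverse_pair_def
    by (simp add: left_diff_distrib right_diff_distrib scalar_minus scalar_central[of a]
        scalar_central[of b] scalar_inverse diff_right_commute[of "b * a"])
  then show ?thesis
    unfolding invertible_def by (metis add_diff_cancel_right')
qed

end

section \<open>C*-categories\<close>

definition norm_dist :: "('m \<Rightarrow> 'm \<Rightarrow> 'm) \<Rightarrow> (complex \<Rightarrow> 'm \<Rightarrow> 'm) \<Rightarrow> ('m \<Rightarrow> real) \<Rightarrow> 'm \<Rightarrow> 'm \<Rightarrow> real" where
  "norm_dist ad sc nm x y = nm (ad x (sc (-1) y))"

abbreviation c_dist :: "('o,'m) cstarcat \<Rightarrow> 'o \<Rightarrow> 'o \<Rightarrow> 'm \<Rightarrow> 'm \<Rightarrow> real" where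
  "c_dist A C D \<equiv> norm_dist (c_add A C D) (c_scale A C D) (c_norm A C D)"

definition Cauchy_seq :: "('m \<Rightarrow> 'm \<Rightarrow> real) \<Rightarrow> (nat \<Rightarrow> 'm) \<Rightarrow> bool" where
  "Cauchy_seq d X \<longleftrightarrow> (\<forall>e>0. \<exists>N. \<forall>m\<ge>N. \<forall>n\<ge>N. d (X m) (X n) < e)"

lemma Cauchy_seqD:
  assumes "Cauchy_seq d X" "0 < e"
  obtains N where "\<And>m n. N \<le> m \<Longrightarrow> N \<le> n \<Longrightarrow> d (X m) (X n) < e"
  using assms unfolding Cauchy_seq_def by blast

lemma Cauchy_seq_dominated:
  assumes Cauchy: "Cauchy_seq d X" and nonneg: "0 \<le> b"
    and dominated: "\<And>m n. d' (Y m) (Y n) \<le> d (X m) (X n) * b"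
  shows "Cauchy_seq d' Y"
  unfolding Cauchy_seq_def
proof (intro allI impI)
  fix e :: real assume e_pos: "0 < e"
  then obtain N where near: "\<And>m n. N \<le> m \<Longrightarrow> N \<le> n \<Longrightarrow> d (X m) (X n) < e / (b + 1)"
    using Cauchy_seqD[OF Cauchy, of "e / (b + 1)"] nonneg by auto
  have "d' (Y m) (Y n) < e" if "N \<le> m" "N \<le> n" for m n
  proof -
    have "d' (Y m) (Y n) \<le> e / (b + 1) * b"
      using dominated near[OF that] nonneg by (meson less_imp_le mult_right_mono order_trans)
    also have "\<dots> < e" using e_pos nonneg by (simp add: field_simps)
    finally show ?thesis .
  qed
  then show "\<exists>N. \<forall>m\<ge>N. \<forall>n\<ge>N. d' (Y m) (Y n) < e" by blast
qed

locale banach_carrier =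
  fixes V :: "'m set" and z ad sc nm
  assumes banach: "banach_on V z ad sc nm"
begin

abbreviation d :: "'m \<Rightarrow> 'm \<Rightarrow> real" where
  "d \<equiv> norm_dist ad sc nm"

lemma zero_in: "z \<in> V"
  and add_in: "x \<in> V \<Longrightarrow> y \<in> V \<Longrightarrow> ad x y \<in> V"
  and scale_in: "x \<in> V \<Longrightarrow> sc a x \<in> V"
  and add_assoc: "x \<in> V \<Longrightarrow> y \<in> V \<Longrightarrow> w \<in> V \<Longrightarrow> ad (ad x y) w = ad x (ad y w)"
  and add_commute: "x \<in> V \<Longrightarrow> y \<in> V \<Longrightarrow> ad x y = ad y x"
  and add_zero_left: "x \<in> V \<Longrightarrow> ad z x = x"
  and scale_one: "x \<in> V \<Longrightarrow> sc 1 x = x"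
  and scale_scale: "x \<in> V \<Longrightarrow> sc a (sc b x) = sc (a * b) x"
  and scale_add_left: "x \<in> V \<Longrightarrow> sc (a + b) x = ad (sc a x) (sc b x)"
  and scale_add_right: "x \<in> V \<Longrightarrow> y \<in> V \<Longrightarrow> sc a (ad x y) = ad (sc a x) (sc a y)"
  and norm_eq_0: "x \<in> V \<Longrightarrow> nm x = 0 \<longleftrightarrow> x = z"
  and norm_triangle: "x \<in> V \<Longrightarrow> y \<in> V \<Longrightarrow> nm (ad x y) \<le> nm x + nm y"
  and norm_scale: "x \<in> V \<Longrightarrow> nm (sc a x) = cmod a * nm x"
  by (insert banach[unfolded banach_on_def]; elim conjE; simp)+

lemma complete:
  assumes "\<And>n. X n \<in> V" "Cauchy_seq d X"
  shows "\<exists>x\<in>V. (\<lambda>n. d (X n) x) \<longlonglongrightarrow> 0"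
  using banach assms unfolding banach_on_def Cauchy_seq_def norm_dist_def by blast

lemma add_zero_right: "x \<in> V \<Longrightarrow> ad x z = x"
  by (metis add_commute add_zero_left zero_in)

lemma norm_zero: "nm z = 0"
  using norm_eq_0 zero_in by blast

lemma scale_zero_left: "x \<in> V \<Longrightarrow> sc 0 x = z"
  using norm_scale[of x 0] norm_eq_0[of "sc 0 x"] by (simp add: scale_in)

lemma scale_zero_right: "sc a z = z"
  using norm_scale[of z a] norm_eq_0[of "sc a z"] by (simp add: scale_in zero_in norm_zero)

lemma add_neg: "x \<in> V \<Longrightarrow> ad x (sc (-1) x) = z"
  using scale_add_left[of x 1 "-1"] by (simp add: scale_zero_left scale_one)

lemma norm_nonneg: "x \<in> V \<Longrightarrow> 0 \<le> nm x"
  using norm_triangle[of x "sc (-1) x"] by (simp add: add_neg norm_zero scale_in norm_scale)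

lemma dist_zero: "x \<in> V \<Longrightarrow> d x z = nm x"
  by (simp add: norm_dist_def scale_zero_right add_zero_right)

lemma dist_nonneg: "x \<in> V \<Longrightarrow> y \<in> V \<Longrightarrow> 0 \<le> d x y"
  by (simp add: norm_dist_def norm_nonneg add_in scale_in)

lemma dist_eq_0:
  assumes "x \<in> V" "y \<in> V" "d x y = 0"
  shows "x = y"
proof -
  have diff: "ad x (sc (-1) y) = z"
    using assms by (simp add: norm_dist_def norm_eq_0 add_in scale_in)
  have "x = ad x (ad (sc (-1) y) y)"
    using assms(1,2) by (metis add_commute add_neg add_zero_right scale_in)
  also have "\<dots> = ad (ad x (sc (-1) y)) y" using assms(1,2) by (simp add: add_assoc scale_in)
  also have "\<dots> = y" using assms(2) by (simp add: diff add_zero_left)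
  finally show ?thesis .
qed

lemma dist_triangle:
  assumes "x \<in> V" "y \<in> V" "w \<in> V"
  shows "d x w \<le> d x y + d y w"
proof -
  have "ad (ad x (sc (-1) y)) (ad y (sc (-1) w)) = ad x (ad (ad (sc (-1) y) y) (sc (-1) w))"
    using assms by (simp add: add_assoc scale_in add_in)
  also have "\<dots> = ad x (sc (-1) w)"
    using assms by (simp add: add_commute[of "sc (-1) y"] add_neg add_zero_left scale_in)
  finally show ?thesis
    unfolding norm_dist_def using norm_triangle assms by (metis add_in scale_in)
qed

lemma dist_commute:
  assumes "x \<in> V" "y \<in> V"
  shows "d x y = d y x"
proof -
  have "sc (-1) (ad x (sc (-1) y)) = ad y (sc (-1) x)"
    using assms by (simp add: scale_add_right scale_in scale_scale scale_one add_commute)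
  then show ?thesis
    using norm_scale[of "ad x (sc (-1) y)" "-1"] assms by (simp add: norm_dist_def add_in scale_in)
qed

lemma norm_le_dist_add:
  assumes "x \<in> V" "y \<in> V"
  shows "nm y \<le> d x y + nm x"
  using dist_triangle[of y x z] assms by (simp add: zero_in dist_zero dist_commute)

lemma limit_unique:
  assumes V: "\<And>n. X n \<in> V" "x \<in> V" "y \<in> V"
    and lim: "(\<lambda>n. d (X n) x) \<longlonglongrightarrow> 0" "(\<lambda>n. d (X n) y) \<longlonglongrightarrow> 0"
  shows "x = y"
proof -
  have "d x y \<le> d (X n) x + d (X n) y" for n
    using dist_triangle[of x "X n" y] V dist_commute by auto
  then have "d x y \<le> 0"
    using tendsto_add[OF lim] LIMSEQ_le_const by fastforce
  then show ?thesis using V dist_nonneg dist_eq_0 by (metis order_antisym)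
qed

lemma limit_dist_le:
  assumes V: "\<And>n. X n \<in> V" "x \<in> V" "y \<in> V"
    and lim: "(\<lambda>n. d (X n) x) \<longlonglongrightarrow> 0"
    and bound: "\<And>n. N \<le> n \<Longrightarrow> d y (X n) \<le> b"
  shows "d y x \<le> b"
proof -
  have "d y x \<le> b + d (X n) x" if "N \<le> n" for n
    using dist_triangle[of y "X n" x] bound[OF that] V by force
  then show ?thesis
    using LIMSEQ_le_const[OF tendsto_add[OF tendsto_const lim, of b]] by auto
qed

lemma convergent_imp_Cauchy_seq:
  assumes V: "\<And>n. X n \<in> V" "x \<in> V" and lim: "(\<lambda>n. d (X n) x) \<longlonglongrightarrow> 0"
  shows "Cauchy_seq d X"
  unfolding Cauchy_seq_def
proof (intro allI impI)
  fix e :: real assume "0 < e"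
  then obtain N where near: "\<And>n. N \<le> n \<Longrightarrow> d (X n) x < e / 2"
    using LIMSEQ_D[OF lim, of "e / 2"] by force
  have "d (X m) (X n) < e" if "N \<le> m" "N \<le> n" for m n
    using dist_triangle[of "X m" x "X n"] near[OF that(1)] near[OF that(2)] V
      dist_commute[of "X n" x]
    by auto
  then show "\<exists>N. \<forall>m\<ge>N. \<forall>n\<ge>N. d (X m) (X n) < e" by blast
qed

end

locale pre_cstar_category =
  fixes A :: "('o,'m) cstarcat"
  assumes hom_banach: "C \<in> c_obj A \<Longrightarrow> D \<in> c_obj A \<Longrightarrow>
      banach_carrier (c_hom A C D) (c_zero A C D) (c_add A C D) (c_scale A C D) (c_norm A C D)"
    and comp_in: "C \<in> c_obj A \<Longrightarrow> D \<in> c_obj A \<Longrightarrow> E \<in> c_obj A \<Longrightarrow>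
      f \<in> c_hom A C D \<Longrightarrow> g \<in> c_hom A D E \<Longrightarrow> c_comp A C D E g f \<in> c_hom A C E"
    and comp_assoc: "C \<in> c_obj A \<Longrightarrow> D \<in> c_obj A \<Longrightarrow> E \<in> c_obj A \<Longrightarrow> F \<in> c_obj A \<Longrightarrow>
      f \<in> c_hom A C D \<Longrightarrow> g \<in> c_hom A D E \<Longrightarrow> h \<in> c_hom A E F \<Longrightarrow>
      c_comp A C E F h (c_comp A C D E g f) = c_comp A C D F (c_comp A D E F h g) f"
    and comp_add_right: "C \<in> c_obj A \<Longrightarrow> D \<in> c_obj A \<Longrightarrow> E \<in> c_obj A \<Longrightarrow>
      f \<in> c_hom A C D \<Longrightarrow> f' \<in> c_hom A C D \<Longrightarrow> g \<in> c_hom A D E \<Longrightarrow>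
      c_comp A C D E g (c_add A C D f f') = c_add A C E (c_comp A C D E g f) (c_comp A C D E g f')"
    and comp_add_left: "C \<in> c_obj A \<Longrightarrow> D \<in> c_obj A \<Longrightarrow> E \<in> c_obj A \<Longrightarrow>
      f \<in> c_hom A C D \<Longrightarrow> g \<in> c_hom A D E \<Longrightarrow> g' \<in> c_hom A D E \<Longrightarrow>
      c_comp A C D E (c_add A D E g g') f = c_add A C E (c_comp A C D E g f) (c_comp A C D E g' f)"
    and comp_scale_right: "C \<in> c_obj A \<Longrightarrow> D \<in> c_obj A \<Longrightarrow> E \<in> c_obj A \<Longrightarrow>
      f \<in> c_hom A C D \<Longrightarrow> g \<in> c_hom A D E \<Longrightarrow>
      c_comp A C D E g (c_scale A C D a f) = c_scale A C E a (c_comp A C D E g f)"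
    and comp_scale_left: "C \<in> c_obj A \<Longrightarrow> D \<in> c_obj A \<Longrightarrow> E \<in> c_obj A \<Longrightarrow>
      f \<in> c_hom A C D \<Longrightarrow> g \<in> c_hom A D E \<Longrightarrow>
      c_comp A C D E (c_scale A D E a g) f = c_scale A C E a (c_comp A C D E g f)"
    and norm_comp_le: "C \<in> c_obj A \<Longrightarrow> D \<in> c_obj A \<Longrightarrow> E \<in> c_obj A \<Longrightarrow>
      f \<in> c_hom A C D \<Longrightarrow> g \<in> c_hom A D E \<Longrightarrow>
      c_norm A C E (c_comp A C D E g f) \<le> c_norm A D E g * c_norm A C D f"
    and star_in: "C \<in> c_obj A \<Longrightarrow> D \<in> c_obj A \<Longrightarrow> f \<in> c_hom A C D \<Longrightarrow> c_star A C D f \<in> c_hom A D C"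
    and star_add: "C \<in> c_obj A \<Longrightarrow> D \<in> c_obj A \<Longrightarrow> f \<in> c_hom A C D \<Longrightarrow> g \<in> c_hom A C D \<Longrightarrow>
      c_star A C D (c_add A C D f g) = c_add A D C (c_star A C D f) (c_star A C D g)"
    and star_scale: "C \<in> c_obj A \<Longrightarrow> D \<in> c_obj A \<Longrightarrow> f \<in> c_hom A C D \<Longrightarrow>
      c_star A C D (c_scale A C D a f) = c_scale A D C (cnj a) (c_star A C D f)"
    and star_star: "C \<in> c_obj A \<Longrightarrow> D \<in> c_obj A \<Longrightarrow> f \<in> c_hom A C D \<Longrightarrow>
      c_star A D C (c_star A C D f) = f"
    and star_comp: "C \<in> c_obj A \<Longrightarrow> D \<in> c_obj A \<Longrightarrow> E \<in> c_obj A \<Longrightarrow>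
      f \<in> c_hom A C D \<Longrightarrow> g \<in> c_hom A D E \<Longrightarrow>
      c_star A C E (c_comp A C D E g f) = c_comp A E D C (c_star A C D f) (c_star A D E g)"
    and norm_star_comp: "C \<in> c_obj A \<Longrightarrow> D \<in> c_obj A \<Longrightarrow> f \<in> c_hom A C D \<Longrightarrow>
      c_norm A C C (c_comp A C D C (c_star A C D f) f) = (c_norm A C D f)\<^sup>2"

locale cstar_category = pre_cstar_category A for A :: "('o,'m) cstarcat" +
  assumes positive_star_comp: "C \<in> c_obj A \<Longrightarrow> D \<in> c_obj A \<Longrightarrow> f \<in> c_hom A C D \<Longrightarrow>
      positive_el A C (c_comp A C D C (c_star A C D f) f)"

lemma cstar_cat_iff: "cstar_cat A \<longleftrightarrow> cstar_category A"
  unfolding cstar_cat_def cstar_category_def cstar_category_axioms_def pre_cstar_category_def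
    banach_carrier_def
  by (auto simp: Ball_def)

context pre_cstar_category
begin

lemmas hom_simps [simp] =
  banach_carrier.zero_in[OF hom_banach] banach_carrier.add_in[OF hom_banach]
  banach_carrier.scale_in[OF hom_banach] comp_in star_in
  banach_carrier.norm_zero[OF hom_banach] banach_carrier.scale_zero_right[OF hom_banach]
  banach_carrier.norm_nonneg[OF hom_banach] banach_carrier.dist_nonneg[OF hom_banach]

lemmas hom_add_assoc = banach_carrier.add_assoc[OF hom_banach]
lemmas hom_add_commute = banach_carrier.add_commute[OF hom_banach]
lemmas hom_add_zero_left = banach_carrier.add_zero_left[OF hom_banach]
lemmas hom_add_neg = banach_carrier.add_neg[OF hom_banach]
lemmas hom_scale_one = banach_carrier.scale_one[OF hom_banach]
lemmas hom_scale_scale = banach_carrier.scale_scale[OF hom_banach]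
lemmas hom_scale_add_left = banach_carrier.scale_add_left[OF hom_banach]
lemmas hom_scale_add_right = banach_carrier.scale_add_right[OF hom_banach]
lemmas hom_scale_zero_left = banach_carrier.scale_zero_left[OF hom_banach]
lemmas hom_norm_eq_0 = banach_carrier.norm_eq_0[OF hom_banach]
lemmas hom_norm_triangle = banach_carrier.norm_triangle[OF hom_banach]
lemmas hom_norm_scale = banach_carrier.norm_scale[OF hom_banach]
lemmas hom_norm_le_dist_add = banach_carrier.norm_le_dist_add[OF hom_banach]
lemmas hom_dist_eq_0 = banach_carrier.dist_eq_0[OF hom_banach]
lemmas hom_complete = banach_carrier.complete[OF hom_banach]
lemmas hom_limit_unique = banach_carrier.limit_unique[OF hom_banach]
lemmas hom_limit_dist_le = banach_carrier.limit_dist_le[OF hom_banach]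
lemmas hom_convergent_imp_Cauchy_seq = banach_carrier.convergent_imp_Cauchy_seq[OF hom_banach]

lemma comp_zero_right:
  assumes [simp]: "C \<in> c_obj A" "D \<in> c_obj A" "E \<in> c_obj A" "g \<in> c_hom A D E"
  shows "c_comp A C D E g (c_zero A C D) = c_zero A C E"
  using comp_scale_right[of C D E "c_zero A C D" g 0] by (simp add: hom_scale_zero_left)

lemma comp_zero_left:
  assumes [simp]: "C \<in> c_obj A" "D \<in> c_obj A" "E \<in> c_obj A" "f \<in> c_hom A C D"
  shows "c_comp A C D E (c_zero A D E) f = c_zero A C E"
  using comp_scale_left[of C D E f "c_zero A D E" 0] by (simp add: hom_scale_zero_left)

lemma comp_left_tendsto:
  assumes [simp]: "C \<in> c_obj A" "D \<in> c_obj A" "E \<in> c_obj A"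
    "\<And>n. X n \<in> c_hom A C D" "f \<in> c_hom A C D" "g \<in> c_hom A D E"
    and lim: "(\<lambda>n. c_dist A C D (X n) f) \<longlonglongrightarrow> 0"
  shows "(\<lambda>n. c_dist A C E (c_comp A C D E g (X n)) (c_comp A C D E g f)) \<longlonglongrightarrow> 0"
proof (rule tendsto_0_le[OF lim, of _ "c_norm A D E g"], intro always_eventually allI)
  fix n
  have "c_dist A C E (c_comp A C D E g (X n)) (c_comp A C D E g f)
      \<le> c_norm A D E g * c_dist A C D (X n) f"
    using norm_comp_le[of C D E "c_add A C D (X n) (c_scale A C D (-1) f)" g]
    by (simp add: norm_dist_def comp_add_right comp_scale_right)
  then show "norm (c_dist A C E (c_comp A C D E g (X n)) (c_comp A C D E g f))
      \<le> norm (c_dist A C D (X n) f) * c_norm A D E g"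
    by (simp add: mult.commute)
qed

lemma norm_star:
  assumes [simp]: "C \<in> c_obj A" "D \<in> c_obj A" "f \<in> c_hom A C D"
  shows "c_norm A D C (c_star A C D f) = c_norm A C D f"
proof -
  have le_star: "c_norm A C D f \<le> c_norm A D C (c_star A C D f)"
    if [simp]: "C \<in> c_obj A" "D \<in> c_obj A" "f \<in> c_hom A C D" for C D f
    by (rule square_le_mult_imp_le)
      (use norm_comp_le[of C D C f "c_star A C D f"] norm_star_comp[of C D f] in
        \<open>simp_all add: power2_eq_square\<close>)
  show ?thesis using le_star[of C D f] le_star[of D C "c_star A C D f"] by (simp add: star_star)
qed

lemma norm_comp_star:
  assumes [simp]: "C \<in> c_obj A" "D \<in> c_obj A" "f \<in> c_hom A C D"
  shows "c_norm A D D (c_comp A D C D f (c_star A C D f)) = (c_norm A C D f)\<^sup>2"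
  using norm_star_comp[of D C "c_star A C D f"] by (simp add: star_star norm_star)

lemma star_zero:
  assumes [simp]: "C \<in> c_obj A" "D \<in> c_obj A"
  shows "c_star A C D (c_zero A C D) = c_zero A D C"
  using star_scale[of C D "c_zero A C D" 0] by (simp add: hom_scale_zero_left)

lemma hom_eqI_comp_left:
  assumes [simp]: "C \<in> c_obj A" "D \<in> c_obj A" "x \<in> c_hom A C D" "y \<in> c_hom A C D"
    and eq: "\<And>E g. E \<in> c_obj A \<Longrightarrow> g \<in> c_hom A D E \<Longrightarrow> c_comp A C D E g x = c_comp A C D E g y"
  shows "x = y"
proof -
  let ?u = "c_add A C D x (c_scale A C D (-1) y)"
  have "c_comp A C D C (c_star A C D ?u) ?u = c_zero A C C"
    using eq[of C "c_star A C D ?u"] by (simp add: comp_add_right comp_scale_right hom_add_neg)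
  then have "c_norm A C D ?u = 0" using norm_star_comp[of C D ?u] by simp
  then show ?thesis by (intro hom_dist_eq_0[of C D]) (simp_all add: norm_dist_def)
qed

end

definition op_cat :: "('o,'m) cstarcat \<Rightarrow> ('o,'m) cstarcat" where
  "op_cat A = \<lparr>c_obj = c_obj A, c_hom = \<lambda>C D. c_hom A D C, c_zero = \<lambda>C D. c_zero A D C,
     c_add = \<lambda>C D. c_add A D C, c_scale = \<lambda>C D. c_scale A D C, c_norm = \<lambda>C D. c_norm A D C,
     c_comp = \<lambda>C D E g f. c_comp A E D C f g, c_star = \<lambda>C D. c_star A D C\<rparr>"

lemma op_cat_sel [simp]:
  "c_obj (op_cat A) = c_obj A"
  "c_hom (op_cat A) C D = c_hom A D C"
  "c_zero (op_cat A) C D = c_zero A D C"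
  "c_add (op_cat A) C D = c_add A D C"
  "c_scale (op_cat A) C D = c_scale A D C"
  "c_norm (op_cat A) C D = c_norm A D C"
  "c_comp (op_cat A) C D E g f = c_comp A E D C f g"
  "c_star (op_cat A) C D = c_star A D C"
  by (simp_all add: op_cat_def)

context pre_cstar_category
begin

lemma pre_cstar_category_op: "pre_cstar_category (op_cat A)"
proof unfold_locales
  fix C D E f g
  assume "C \<in> c_obj (op_cat A)" "D \<in> c_obj (op_cat A)" "E \<in> c_obj (op_cat A)"
    "f \<in> c_hom (op_cat A) C D" "g \<in> c_hom (op_cat A) D E"
  then show "c_norm (op_cat A) C E (c_comp (op_cat A) C D E g f)
      \<le> c_norm (op_cat A) D E g * c_norm (op_cat A) C D f"
    using norm_comp_le[of E D C g f] by (simp add: mult.commute)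
qed (simp_all add: hom_banach[unfolded banach_carrier_def] comp_assoc comp_add_left comp_add_right
    comp_scale_left comp_scale_right star_add star_scale star_star star_comp norm_comp_star)

lemma hom_eqI_comp_right:
  assumes "C \<in> c_obj A" "D \<in> c_obj A" "x \<in> c_hom A C D" "y \<in> c_hom A C D"
    and "\<And>E f. E \<in> c_obj A \<Longrightarrow> f \<in> c_hom A E C \<Longrightarrow> c_comp A E C D x f = c_comp A E C D y f"
  shows "x = y"
  by (rule pre_cstar_category.hom_eqI_comp_left[OF pre_cstar_category_op, of D C])
    (simp_all add: assms)

lemma comp_right_tendsto:
  assumes "C \<in> c_obj A" "D \<in> c_obj A" "E \<in> c_obj A"
    "f \<in> c_hom A C D" "\<And>n. X n \<in> c_hom A D E" "g \<in> c_hom A D E"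
    and "(\<lambda>n. c_dist A D E (X n) g) \<longlonglongrightarrow> 0"
  shows "(\<lambda>n. c_dist A C E (c_comp A C D E (X n) f) (c_comp A C D E g f)) \<longlonglongrightarrow> 0"
  using pre_cstar_category.comp_left_tendsto[OF pre_cstar_category_op, of E D C X g f] assms by simp

end

section \<open>The multiplier category\<close>

lemma
  assumes "T \<in> mult_hom A C D"
  shows mult_src: "C \<in> c_obj A" and mult_tgt: "D \<in> c_obj A"
    and multL_in: "E \<in> c_obj A \<Longrightarrow> h \<in> c_hom A E C \<Longrightarrow> fst T E h \<in> c_hom A E D"
    and multR_in: "E \<in> c_obj A \<Longrightarrow> g \<in> c_hom A D E \<Longrightarrow> snd T E g \<in> c_hom A C E"
    and multL_ext: "E \<notin> c_obj A \<or> h \<notin> c_hom A E C \<Longrightarrow> fst T E h = undefined"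
    and multR_ext: "E \<notin> c_obj A \<or> g \<notin> c_hom A D E \<Longrightarrow> snd T E g = undefined"
    and multL_add: "E \<in> c_obj A \<Longrightarrow> h \<in> c_hom A E C \<Longrightarrow> h' \<in> c_hom A E C \<Longrightarrow>
      fst T E (c_add A E C h h') = c_add A E D (fst T E h) (fst T E h')"
    and multL_scale: "E \<in> c_obj A \<Longrightarrow> h \<in> c_hom A E C \<Longrightarrow>
      fst T E (c_scale A E C a h) = c_scale A E D a (fst T E h)"
    and multL_comp: "E \<in> c_obj A \<Longrightarrow> F \<in> c_obj A \<Longrightarrow> h \<in> c_hom A E C \<Longrightarrow> f \<in> c_hom A F E \<Longrightarrow>
      fst T F (c_comp A F E C h f) = c_comp A F E D (fst T E h) f"
    and multL_bounded:
      "\<exists>K. \<forall>E\<in>c_obj A. \<forall>h\<in>c_hom A E C. c_norm A E D (fst T E h) \<le> K * c_norm A E C h"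
    and mult_compat: "E \<in> c_obj A \<Longrightarrow> F \<in> c_obj A \<Longrightarrow> f \<in> c_hom A F C \<Longrightarrow> g \<in> c_hom A D E \<Longrightarrow>
      c_comp A F D E g (fst T F f) = c_comp A F C E (snd T E g) f"
  using assms by (cases T, simp add: mult_hom_def; elim conjE; simp)+

lemma swap_in_mult_hom_op: "T \<in> mult_hom A C D \<Longrightarrow> prod.swap T \<in> mult_hom (op_cat A) D C"
  by (cases T) (auto simp: mult_hom_def)

definition mk_mult ::
  "('o,'m) cstarcat \<Rightarrow> 'o \<Rightarrow> 'o \<Rightarrow> ('o \<Rightarrow> 'm \<Rightarrow> 'm) \<Rightarrow> ('o \<Rightarrow> 'm \<Rightarrow> 'm) \<Rightarrow> ('o,'m) mult" where
  "mk_mult A C D L R =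
    (\<lambda>E h. if E \<in> c_obj A \<and> h \<in> c_hom A E C then L E h else undefined,
     \<lambda>E g. if E \<in> c_obj A \<and> g \<in> c_hom A D E then R E g else undefined)"

lemma mk_mult_eval [simp]:
  "E \<in> c_obj A \<Longrightarrow> h \<in> c_hom A E C \<Longrightarrow> fst (mk_mult A C D L R) E h = L E h"
  "E \<in> c_obj A \<Longrightarrow> g \<in> c_hom A D E \<Longrightarrow> snd (mk_mult A C D L R) E g = R E g"
  by (simp_all add: mk_mult_def)

lemma mult_cat_sel [simp]:
  "c_obj (mult_cat A) = c_obj A"
  "c_hom (mult_cat A) = mult_hom A"
  by (simp_all add: mult_cat_def)

lemma mult_cat_eq_mk_mult:
  "c_zero (mult_cat A) C D = mk_mult A C D (\<lambda>E h. c_zero A E D) (\<lambda>E g. c_zero A C E)"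
  "c_add (mult_cat A) C D S T =
    mk_mult A C D (\<lambda>E h. c_add A E D (fst S E h) (fst T E h))
      (\<lambda>E g. c_add A C E (snd S E g) (snd T E g))"
  "c_scale (mult_cat A) C D a T =
    mk_mult A C D (\<lambda>E h. c_scale A E D a (fst T E h)) (\<lambda>E g. c_scale A C E a (snd T E g))"
  "c_comp (mult_cat A) C D E S T =
    mk_mult A C E (\<lambda>F h. fst S F (fst T F h)) (\<lambda>F g. snd T F (snd S F g))"
  "c_star (mult_cat A) C D T =
    mk_mult A D C (\<lambda>E h. c_star A C E (snd T E (c_star A E D h)))
      (\<lambda>E g. c_star A E D (fst T E (c_star A C E g)))"
  "snd (mult_embed A) C D f = mk_mult A C D (\<lambda>E h. c_comp A E C D f h) (\<lambda>E g. c_comp A C D E g f)"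
  by (simp_all add: mult_cat_def mult_embed_def mk_mult_def)

lemma mult_cat_eval [simp]:
  "E \<in> c_obj A \<Longrightarrow> h \<in> c_hom A E C \<Longrightarrow> fst (c_zero (mult_cat A) C D) E h = c_zero A E D"
  "E \<in> c_obj A \<Longrightarrow> h \<in> c_hom A E C \<Longrightarrow>
    fst (c_add (mult_cat A) C D S T) E h = c_add A E D (fst S E h) (fst T E h)"
  "E \<in> c_obj A \<Longrightarrow> g \<in> c_hom A D E \<Longrightarrow>
    snd (c_add (mult_cat A) C D S T) E g = c_add A C E (snd S E g) (snd T E g)"
  "E \<in> c_obj A \<Longrightarrow> h \<in> c_hom A E C \<Longrightarrow>
    fst (c_scale (mult_cat A) C D a T) E h = c_scale A E D a (fst T E h)"
  "E \<in> c_obj A \<Longrightarrow> g \<in> c_hom A D E \<Longrightarrow>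
    snd (c_scale (mult_cat A) C D a T) E g = c_scale A C E a (snd T E g)"
  "E \<in> c_obj A \<Longrightarrow> h \<in> c_hom A E C \<Longrightarrow>
    fst (c_comp (mult_cat A) C D F S T) E h = fst S E (fst T E h)"
  "E \<in> c_obj A \<Longrightarrow> g \<in> c_hom A F E \<Longrightarrow>
    snd (c_comp (mult_cat A) C D F S T) E g = snd T E (snd S E g)"
  "E \<in> c_obj A \<Longrightarrow> h \<in> c_hom A E D \<Longrightarrow>
    fst (c_star (mult_cat A) C D T) E h = c_star A C E (snd T E (c_star A E D h))"
  "E \<in> c_obj A \<Longrightarrow> g \<in> c_hom A C E \<Longrightarrow>
    snd (c_star (mult_cat A) C D T) E g = c_star A E D (fst T E (c_star A C E g))"
  "E \<in> c_obj A \<Longrightarrow> h \<in> c_hom A E C \<Longrightarrow> fst (snd (mult_embed A) C D f) E h = c_comp A E C D f h"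
  "E \<in> c_obj A \<Longrightarrow> g \<in> c_hom A D E \<Longrightarrow> snd (snd (mult_embed A) C D f) E g = c_comp A C D E g f"
  by (simp_all add: mult_cat_eq_mk_mult)

lemma mult_embed_obj [simp]: "fst (mult_embed A) C = C"
  by (simp add: mult_embed_def)

context pre_cstar_category
begin

abbreviation M :: "('o, ('o,'m) mult) cstarcat" where
  "M \<equiv> mult_cat A"

subsection \<open>The norm of a multiplier\<close>

lemma compat_norm_le:
  assumes [simp]: "C \<in> c_obj A" "D \<in> c_obj A" "E \<in> c_obj A" "g \<in> c_hom A D E" "x \<in> c_hom A C E"
    and L [simp]: "\<And>h. h \<in> c_hom A E C \<Longrightarrow> L h \<in> c_hom A E D"
    and compat: "\<And>f. f \<in> c_hom A E C \<Longrightarrow> c_comp A E D E g (L f) = c_comp A E C E x f"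
    and K_nonneg: "0 \<le> K"
    and bound: "\<And>h. h \<in> c_hom A E C \<Longrightarrow> c_norm A E D (L h) \<le> K * c_norm A E C h"
  shows "c_norm A C E x \<le> K * c_norm A D E g"
proof (rule square_le_mult_imp_le)
  have "c_norm A C E x * c_norm A C E x = c_norm A E E (c_comp A E D E g (L (c_star A C E x)))"
    using norm_comp_star[of C E x] by (simp add: compat power2_eq_square)
  also have "\<dots> \<le> c_norm A D E g * c_norm A E D (L (c_star A C E x))"
    by (rule norm_comp_le) simp_all
  also have "\<dots> \<le> c_norm A D E g * (K * c_norm A C E x)"
    using bound[of "c_star A C E x"] by (intro mult_left_mono) (simp_all add: norm_star)
  finally show "c_norm A C E x * c_norm A C E x \<le> K * c_norm A D E g * c_norm A C E x"
    by (simp add: ac_simps)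
qed (use K_nonneg in simp_all)

lemma multL_norms_bdd_above:
  assumes T: "T \<in> mult_hom A C D"
  shows "bdd_above (insert 0 {c_norm A E D (fst T E h) |E h.
    E \<in> c_obj A \<and> h \<in> c_hom A E C \<and> c_norm A E C h \<le> 1})"
proof -
  obtain K where bound: "\<And>E h. E \<in> c_obj A \<Longrightarrow> h \<in> c_hom A E C \<Longrightarrow>
      c_norm A E D (fst T E h) \<le> K * c_norm A E C h"
    using multL_bounded[OF T] by blast
  have "c_norm A E D (fst T E h) \<le> \<bar>K\<bar>"
    if "E \<in> c_obj A" "h \<in> c_hom A E C" and "c_norm A E C h \<le> 1" for E h
  proof -
    have "K * c_norm A E C h \<le> \<bar>K\<bar> * 1"
      using that mult_src[OF T] by (intro mult_mono) auto
    then show ?thesis using bound that by fastforce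
  qed
  then show ?thesis by (intro bdd_aboveI[of _ "\<bar>K\<bar>"]) auto
qed

lemma multL_norm_nonneg: "T \<in> mult_hom A C D \<Longrightarrow> 0 \<le> mult_normL A C D (fst T)"
  unfolding mult_normL_def by (rule cSup_upper[OF _ multL_norms_bdd_above]) auto

lemma multL_norm_bound:
  assumes T: "T \<in> mult_hom A C D" and [simp]: "E \<in> c_obj A" "h \<in> c_hom A E C"
  shows "c_norm A E D (fst T E h) \<le> mult_normL A C D (fst T) * c_norm A E C h"
proof (cases "c_norm A E C h = 0")
  case True
  then show ?thesis using multL_bounded[OF T] assms(2,3) by fastforce
next
  case False
  note [simp] = mult_src[OF T] mult_tgt[OF T] multL_in[OF T]
  define r where "r = c_norm A E C h"
  have r_pos: "0 < r" using False by (simp add: r_def less_le)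
  let ?u = "c_scale A E C (of_real (1 / r)) h"
  have "c_norm A E C ?u = 1" using r_pos by (simp add: hom_norm_scale norm_divide r_def[symmetric])
  then have "c_norm A E D (fst T E ?u) \<le> mult_normL A C D (fst T)"
    unfolding mult_normL_def by (intro cSup_upper[OF _ multL_norms_bdd_above[OF T]]) force
  then show ?thesis
    using r_pos
    by (simp add: multL_scale[OF T] hom_norm_scale norm_divide r_def[symmetric] divide_le_eq)
qed

lemma multL_norm_least:
  assumes "0 \<le> K"
    and "\<And>E h. E \<in> c_obj A \<Longrightarrow> h \<in> c_hom A E C \<Longrightarrow> c_norm A E D (L E h) \<le> K * c_norm A E C h"
  shows "mult_normL A C D L \<le> K"
  unfolding mult_normL_def
  by (rule cSup_least) (use assms mult_left_le[of _ K] in \<open>fastforce intro: order_trans\<close>)+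

end

lemma mult_normL_op: "mult_normL (op_cat A) D C R = mult_normR A C D R"
  by (simp add: mult_normL_def mult_normR_def)

lemma mult_normR_op: "mult_normR (op_cat A) D C L = mult_normL A C D L"
  by (simp add: mult_normL_def mult_normR_def)

context pre_cstar_category
begin

lemma multR_norm_bound:
  assumes "T \<in> mult_hom A C D" "E \<in> c_obj A" "g \<in> c_hom A D E"
  shows "c_norm A C E (snd T E g) \<le> mult_normR A C D (snd T) * c_norm A D E g"
  using pre_cstar_category.multL_norm_bound[OF pre_cstar_category_op
      swap_in_mult_hom_op[OF assms(1)], of E g]
    assms(2,3) by (simp add: mult_normL_op)

lemma multR_norm_le_multL_norm:
  assumes T: "T \<in> mult_hom A C D"
  shows "mult_normR A C D (snd T) \<le> mult_normL A C D (fst T)"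
  unfolding mult_normL_op[symmetric]
proof (rule pre_cstar_category.multL_norm_least[OF pre_cstar_category_op])
  fix E g assume "E \<in> c_obj (op_cat A)" "g \<in> c_hom (op_cat A) E D"
  then have [simp]: "E \<in> c_obj A" "g \<in> c_hom A D E" by simp_all
  have "c_norm A C E (snd T E g) \<le> mult_normL A C D (fst T) * c_norm A D E g"
    by (rule compat_norm_le[of C D E g _ "fst T E"])
      (simp_all add: mult_src[OF T] mult_tgt[OF T] multL_in[OF T] multR_in[OF T]
        mult_compat[OF T] multL_norm_bound[OF T] multL_norm_nonneg[OF T])
  then show "c_norm (op_cat A) E C (snd T E g) \<le> mult_normL A C D (fst T) * c_norm (op_cat A) E D g"
    by simp
qed (rule multL_norm_nonneg[OF T])

lemma mult_normL_eq_mult_normR: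
  assumes T: "T \<in> mult_hom A C D"
  shows "mult_normL A C D (fst T) = mult_normR A C D (snd T)"
  using multR_norm_le_multL_norm[OF T]
    pre_cstar_category.multR_norm_le_multL_norm[OF pre_cstar_category_op swap_in_mult_hom_op[OF T]]
  by (simp add: mult_normL_op mult_normR_op)

lemma mult_norm_eq: "T \<in> mult_hom A C D \<Longrightarrow> c_norm M C D T = mult_normL A C D (fst T)"
  by (simp add: mult_cat_def mult_normL_eq_mult_normR)

lemma mult_norm_nonneg: "T \<in> mult_hom A C D \<Longrightarrow> 0 \<le> c_norm M C D T"
  by (simp add: mult_norm_eq multL_norm_nonneg)

lemma mult_norm_boundL:
  assumes "T \<in> mult_hom A C D" "E \<in> c_obj A" "h \<in> c_hom A E C"
  shows "c_norm A E D (fst T E h) \<le> c_norm M C D T * c_norm A E C h"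
  using assms by (simp add: mult_norm_eq multL_norm_bound)

lemma mult_norm_boundR:
  assumes "T \<in> mult_hom A C D" "E \<in> c_obj A" "g \<in> c_hom A D E"
  shows "c_norm A C E (snd T E g) \<le> c_norm M C D T * c_norm A D E g"
  using assms by (simp add: mult_norm_eq mult_normL_eq_mult_normR multR_norm_bound)

lemma mult_norm_least:
  assumes "T \<in> mult_hom A C D" "0 \<le> K"
    and "\<And>E h. E \<in> c_obj A \<Longrightarrow> h \<in> c_hom A E C \<Longrightarrow> c_norm A E D (fst T E h) \<le> K * c_norm A E C h"
  shows "c_norm M C D T \<le> K"
  using assms by (simp add: mult_norm_eq multL_norm_least)

lemma mk_mult_in_norm_le:
  assumes obj [simp]: "C \<in> c_obj A" "D \<in> c_obj A"
    and L [simp]: "\<And>E h. E \<in> c_obj A \<Longrightarrow> h \<in> c_hom A E C \<Longrightarrow> L E h \<in> c_hom A E D"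
    and R [simp]: "\<And>E g. E \<in> c_obj A \<Longrightarrow> g \<in> c_hom A D E \<Longrightarrow> R E g \<in> c_hom A C E"
    and compat: "\<And>E F f g. E \<in> c_obj A \<Longrightarrow> F \<in> c_obj A \<Longrightarrow> f \<in> c_hom A F C \<Longrightarrow> g \<in> c_hom A D E \<Longrightarrow>
      c_comp A F D E g (L F f) = c_comp A F C E (R E g) f"
    and K_nonneg: "0 \<le> K"
    and bound: "\<And>E h. E \<in> c_obj A \<Longrightarrow> h \<in> c_hom A E C \<Longrightarrow> c_norm A E D (L E h) \<le> K * c_norm A E C h"
  shows "mk_mult A C D L R \<in> mult_hom A C D \<and> c_norm M C D (mk_mult A C D L R) \<le> K"
proof -
  have L_add: "L E (c_add A E C h h') = c_add A E D (L E h) (L E h')"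
    if [simp]: "E \<in> c_obj A" "h \<in> c_hom A E C" "h' \<in> c_hom A E C" for E h h'
    by (rule hom_eqI_comp_left[of E D]) (simp_all add: compat comp_add_right)
  have L_scale: "L E (c_scale A E C a h) = c_scale A E D a (L E h)"
    if [simp]: "E \<in> c_obj A" "h \<in> c_hom A E C" for E h a
    by (rule hom_eqI_comp_left[of E D]) (simp_all add: compat comp_scale_right)
  have L_comp: "L F (c_comp A F E C h f) = c_comp A F E D (L E h) f"
    if [simp]: "E \<in> c_obj A" "F \<in> c_obj A" "h \<in> c_hom A E C" "f \<in> c_hom A F E" for E F h f
    by (rule hom_eqI_comp_left[of F D]) (simp_all add: compat comp_assoc)
  have R_add: "R E (c_add A D E g g') = c_add A C E (R E g) (R E g')"
    if [simp]: "E \<in> c_obj A" "g \<in> c_hom A D E" "g' \<in> c_hom A D E" for E g g'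
    by (rule hom_eqI_comp_right[of C E]) (simp_all add: compat[symmetric] comp_add_left)
  have R_scale: "R E (c_scale A D E a g) = c_scale A C E a (R E g)"
    if [simp]: "E \<in> c_obj A" "g \<in> c_hom A D E" for E g a
    by (rule hom_eqI_comp_right[of C E]) (simp_all add: compat[symmetric] comp_scale_left)
  have R_comp: "R F (c_comp A D E F f g) = c_comp A C E F f (R E g)"
    if [simp]: "E \<in> c_obj A" "F \<in> c_obj A" "g \<in> c_hom A D E" "f \<in> c_hom A E F" for E F g f
    by (rule hom_eqI_comp_right[of C F]) (simp_all add: compat[symmetric] comp_assoc[symmetric])
  have R_bound: "c_norm A C E (R E g) \<le> K * c_norm A D E g"
    if [simp]: "E \<in> c_obj A" "g \<in> c_hom A D E" for E g
    by (rule compat_norm_le[of C D E g _ "L E"]) (simp_all add: compat K_nonneg bound)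
  have T: "mk_mult A C D L R \<in> mult_hom A C D"
    unfolding mult_hom_def mk_mult_def
    by (auto simp: L_add L_scale L_comp R_add R_scale R_comp compat
        intro!: exI[of _ K] bound R_bound)
  moreover have "c_norm M C D (mk_mult A C D L R) \<le> K"
    using T K_nonneg by (rule mult_norm_least) (simp add: bound)
  ultimately show ?thesis ..
qed

lemma mult_eqI:
  assumes S: "S \<in> mult_hom A C D" and T: "T \<in> mult_hom A C D"
    and eq: "\<And>E h. E \<in> c_obj A \<Longrightarrow> h \<in> c_hom A E C \<Longrightarrow> fst S E h = fst T E h"
  shows "S = T"
proof (rule prod_eqI; rule ext; rule ext)
  note [simp] = mult_src[OF S] mult_tgt[OF S]
  fix E x
  show "fst S E x = fst T E x"
    using eq multL_ext[OF S] multL_ext[OF T] by (cases "E \<in> c_obj A \<and> x \<in> c_hom A E C") auto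
  show "snd S E x = snd T E x"
  proof (cases "E \<in> c_obj A \<and> x \<in> c_hom A D E")
    case True
    then have [simp]: "E \<in> c_obj A" "x \<in> c_hom A D E" by auto
    show ?thesis
      by (rule hom_eqI_comp_right[of C E])
        (simp_all add: multR_in[OF S] multR_in[OF T] eq flip: mult_compat[OF S] mult_compat[OF T])
  next
    case False
    then show ?thesis using multR_ext[OF S] multR_ext[OF T] by auto
  qed
qed

subsection \<open>Operations on multipliers\<close>

lemma mult_zero_in:
  assumes [simp]: "C \<in> c_obj A" "D \<in> c_obj A"
  shows "c_zero M C D \<in> mult_hom A C D"
  unfolding mult_cat_eq_mk_mult
  by (rule mk_mult_in_norm_le[where K = 0, THEN conjunct1])
    (simp_all add: comp_zero_left comp_zero_right)

lemma
  assumes S: "S \<in> mult_hom A C D" and T: "T \<in> mult_hom A C D"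
  shows mult_add_in: "c_add M C D S T \<in> mult_hom A C D"
    and mult_norm_add_le: "c_norm M C D (c_add M C D S T) \<le> c_norm M C D S + c_norm M C D T"
proof -
  note [simp] = mult_src[OF T] mult_tgt[OF T] multL_in[OF S] multR_in[OF S] multL_in[OF T]
    multR_in[OF T]
  have "c_add M C D S T \<in> mult_hom A C D \<and>
      c_norm M C D (c_add M C D S T) \<le> c_norm M C D S + c_norm M C D T"
    unfolding mult_cat_eq_mk_mult
  proof (rule mk_mult_in_norm_le)
    fix E h assume [simp]: "E \<in> c_obj A" "h \<in> c_hom A E C"
    have "c_norm A E D (c_add A E D (fst S E h) (fst T E h))
        \<le> c_norm A E D (fst S E h) + c_norm A E D (fst T E h)"
      by (simp add: hom_norm_triangle)
    also have "\<dots> \<le> (c_norm M C D S + c_norm M C D T) * c_norm A E C h"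
      using mult_norm_boundL[OF S] mult_norm_boundL[OF T] by (simp add: distrib_right add_mono)
    finally show "c_norm A E D (c_add A E D (fst S E h) (fst T E h))
        \<le> (c_norm M C D S + c_norm M C D T) * c_norm A E C h" .
  qed (simp_all add: mult_norm_nonneg[OF S] mult_norm_nonneg[OF T] comp_add_left comp_add_right
      mult_compat[OF S] mult_compat[OF T])
  then show "c_add M C D S T \<in> mult_hom A C D"
    "c_norm M C D (c_add M C D S T) \<le> c_norm M C D S + c_norm M C D T" by simp_all
qed

lemma
  assumes T: "T \<in> mult_hom A C D"
  shows mult_scale_in: "c_scale M C D a T \<in> mult_hom A C D"
    and mult_norm_scale_le: "c_norm M C D (c_scale M C D a T) \<le> cmod a * c_norm M C D T"
proof -
  note [simp] = mult_src[OF T] mult_tgt[OF T] multL_in[OF T] multR_in[OF T]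
  have "c_scale M C D a T \<in> mult_hom A C D \<and>
      c_norm M C D (c_scale M C D a T) \<le> cmod a * c_norm M C D T"
    unfolding mult_cat_eq_mk_mult
    by (rule mk_mult_in_norm_le)
      (simp_all add: mult_norm_nonneg[OF T] comp_scale_left comp_scale_right mult_compat[OF T]
        hom_norm_scale mult.assoc mult_left_mono mult_norm_boundL[OF T])
  then show "c_scale M C D a T \<in> mult_hom A C D"
    "c_norm M C D (c_scale M C D a T) \<le> cmod a * c_norm M C D T" by simp_all
qed

lemma
  assumes T: "T \<in> mult_hom A C D" and S: "S \<in> mult_hom A D E"
  shows mult_comp_in: "c_comp M C D E S T \<in> mult_hom A C E"
    and mult_norm_comp_le: "c_norm M C E (c_comp M C D E S T) \<le> c_norm M D E S * c_norm M C D T"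
proof -
  note [simp] = mult_src[OF T] mult_src[OF S] mult_tgt[OF S]
    multL_in[OF T] multR_in[OF T] multL_in[OF S] multR_in[OF S]
  have "c_comp M C D E S T \<in> mult_hom A C E \<and>
      c_norm M C E (c_comp M C D E S T) \<le> c_norm M D E S * c_norm M C D T"
    unfolding mult_cat_eq_mk_mult
  proof (rule mk_mult_in_norm_le)
    fix F h assume [simp]: "F \<in> c_obj A" "h \<in> c_hom A F C"
    have "c_norm A F E (fst S F (fst T F h)) \<le> c_norm M D E S * c_norm A F D (fst T F h)"
      by (simp add: mult_norm_boundL[OF S])
    also have "\<dots> \<le> c_norm M D E S * (c_norm M C D T * c_norm A F C h)"
      by (simp add: mult_norm_boundL[OF T] mult_norm_nonneg[OF S] mult_left_mono)
    finally show "c_norm A F E (fst S F (fst T F h))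
        \<le> c_norm M D E S * c_norm M C D T * c_norm A F C h"
      by (simp add: mult.assoc)
  qed (simp_all add: mult_norm_nonneg[OF S] mult_norm_nonneg[OF T] mult_compat[OF S]
    mult_compat[OF T])
  then show "c_comp M C D E S T \<in> mult_hom A C E"
    "c_norm M C E (c_comp M C D E S T) \<le> c_norm M D E S * c_norm M C D T" by simp_all
qed

lemma
  assumes T: "T \<in> mult_hom A C D"
  shows mult_star_in: "c_star M C D T \<in> mult_hom A D C"
    and mult_norm_star_le: "c_norm M D C (c_star M C D T) \<le> c_norm M C D T"
proof -
  note [simp] = mult_src[OF T] mult_tgt[OF T] multL_in[OF T] multR_in[OF T]
  have "c_star M C D T \<in> mult_hom A D C \<and> c_norm M D C (c_star M C D T) \<le> c_norm M C D T"
    unfolding mult_cat_eq_mk_mult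
  proof (rule mk_mult_in_norm_le)
    fix E h assume [simp]: "E \<in> c_obj A" "h \<in> c_hom A E D"
    show "c_norm A E C (c_star A C E (snd T E (c_star A E D h))) \<le> c_norm M C D T * c_norm A E D h"
      using mult_norm_boundR[OF T, of E "c_star A E D h"] by (simp add: norm_star)
  next
    fix E F f g
    assume [simp]: "E \<in> c_obj A" "F \<in> c_obj A" "f \<in> c_hom A F D" "g \<in> c_hom A C E"
    have "c_comp A F C E g (c_star A C F (snd T F (c_star A F D f)))
        = c_star A E F (c_comp A E C F (snd T F (c_star A F D f)) (c_star A C E g))"
      by (simp add: star_comp star_star)
    also have "\<dots> = c_star A E F (c_comp A E D F (c_star A F D f) (fst T E (c_star A C E g)))"
      by (simp add: mult_compat[OF T])
    also have "\<dots> = c_comp A F D E (c_star A E D (fst T E (c_star A C E g))) f"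
      by (simp add: star_comp star_star)
    finally show "c_comp A F C E g (c_star A C F (snd T F (c_star A F D f)))
        = c_comp A F D E (c_star A E D (fst T E (c_star A C E g))) f" .
  qed (simp_all add: mult_norm_nonneg[OF T])
  then show "c_star M C D T \<in> mult_hom A D C" "c_norm M D C (c_star M C D T) \<le> c_norm M C D T"
    by simp_all
qed

lemma
  assumes [simp]: "C \<in> c_obj A" "D \<in> c_obj A" "f \<in> c_hom A C D"
  shows mult_embed_in: "snd (mult_embed A) C D f \<in> mult_hom A C D"
    and mult_embed_norm_le: "c_norm M C D (snd (mult_embed A) C D f) \<le> c_norm A C D f"
proof -
  have "snd (mult_embed A) C D f \<in> mult_hom A C D \<and>
      c_norm M C D (snd (mult_embed A) C D f) \<le> c_norm A C D f"
    unfolding mult_cat_eq_mk_mult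
    by (rule mk_mult_in_norm_le) (simp_all add: norm_comp_le comp_assoc)
  then show "snd (mult_embed A) C D f \<in> mult_hom A C D"
    "c_norm M C D (snd (mult_embed A) C D f) \<le> c_norm A C D f" by simp_all
qed

definition mult_unit :: "'o \<Rightarrow> ('o,'m) mult" where
  "mult_unit C = mk_mult A C C (\<lambda>E h. h) (\<lambda>E g. g)"

lemma mult_unit_in: "C \<in> c_obj A \<Longrightarrow> mult_unit C \<in> mult_hom A C C"
  unfolding mult_unit_def by (rule mk_mult_in_norm_le[where K = 1, THEN conjunct1]) simp_all

lemma mult_unit_eval [simp]:
  "E \<in> c_obj A \<Longrightarrow> h \<in> c_hom A E C \<Longrightarrow> fst (mult_unit C) E h = h"
  by (simp add: mult_unit_def)

lemma is_unit_mult_unit: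
  assumes [simp]: "C \<in> c_obj A"
  shows "is_unit M C (mult_unit C)"
  unfolding is_unit_def
proof (intro conjI ballI)
  note [simp] = mult_unit_in mult_comp_in
  show "mult_unit C \<in> c_hom M C C" by simp
  fix D T assume "D \<in> c_obj M"
  then have [simp]: "D \<in> c_obj A" by simp
  show "c_comp M C C D T (mult_unit C) = T" if "T \<in> c_hom M C D"
    by (rule mult_eqI[of _ C D]) (use that in simp_all)
  show "c_comp M D C C (mult_unit C) T = T" if "T \<in> c_hom M D C"
    by (rule mult_eqI[of _ D C]) (use that in \<open>simp_all add: multL_in\<close>)
qed

lemma unital_mult_cat: "unital M"
  unfolding unital_def using is_unit_mult_unit by (metis mult_cat_sel(1))

lemma
  assumes S: "S \<in> mult_hom A C D"
  shows mult_star_scale: "c_star M C D (c_scale M C D a S) = c_scale M D C (cnj a) (c_star M C D S)"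
    and mult_star_star: "c_star M D C (c_star M C D S) = S"
    and mult_star_add: "T \<in> mult_hom A C D \<Longrightarrow>
      c_star M C D (c_add M C D S T) = c_add M D C (c_star M C D S) (c_star M C D T)"
    and mult_star_comp: "U \<in> mult_hom A D E \<Longrightarrow>
      c_star M C E (c_comp M C D E U S) = c_comp M E D C (c_star M C D S) (c_star M D E U)"
proof -
  note [simp] = S mult_src[OF S] mult_tgt[OF S] multL_in[OF S] multR_in[OF S]
    mult_scale_in mult_add_in mult_star_in mult_comp_in
  show "c_star M C D (c_scale M C D a S) = c_scale M D C (cnj a) (c_star M C D S)"
    by (rule mult_eqI[of _ D C]) (simp_all add: star_scale)
  show "c_star M D C (c_star M C D S) = S"
    by (rule mult_eqI[of _ C D]) (simp_all add: star_star)
  show "c_star M C D (c_add M C D S T) = c_add M D C (c_star M C D S) (c_star M C D T)"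
    if T: "T \<in> mult_hom A C D"
    by (rule mult_eqI[of _ D C]) (simp_all add: T multR_in[OF T] star_add)
  show "c_star M C E (c_comp M C D E U S) = c_comp M E D C (c_star M C D S) (c_star M D E U)"
    if U: "U \<in> mult_hom A D E"
    by (rule mult_eqI[of _ E C]) (simp_all add: U mult_tgt[OF U] multR_in[OF U] star_star)
qed

lemma
  assumes S: "S \<in> mult_hom A C D" and T: "T \<in> mult_hom A D E"
  shows mult_comp_scale_right:
      "c_comp M C D E T (c_scale M C D a S) = c_scale M C E a (c_comp M C D E T S)"
    and mult_comp_scale_left:
      "c_comp M C D E (c_scale M D E a T) S = c_scale M C E a (c_comp M C D E T S)"
    and mult_comp_add_right: "S' \<in> mult_hom A C D \<Longrightarrow>
      c_comp M C D E T (c_add M C D S S') = c_add M C E (c_comp M C D E T S) (c_comp M C D E T S')"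
    and mult_comp_add_left: "T' \<in> mult_hom A D E \<Longrightarrow>
      c_comp M C D E (c_add M D E T T') S = c_add M C E (c_comp M C D E T S) (c_comp M C D E T' S)"
    and mult_comp_assoc: "U \<in> mult_hom A E F \<Longrightarrow>
      c_comp M C E F U (c_comp M C D E T S) = c_comp M C D F (c_comp M D E F U T) S"
proof -
  note [simp] = S T mult_tgt[OF S] mult_tgt[OF T] multL_in[OF S] multL_in[OF T]
    mult_scale_in mult_add_in mult_comp_in
  show "c_comp M C D E T (c_scale M C D a S) = c_scale M C E a (c_comp M C D E T S)"
    by (rule mult_eqI[of _ C E]) (simp_all add: multL_scale[OF T])
  show "c_comp M C D E (c_scale M D E a T) S = c_scale M C E a (c_comp M C D E T S)"
    by (rule mult_eqI[of _ C E]) simp_all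
  show "c_comp M C D E T (c_add M C D S S')
      = c_add M C E (c_comp M C D E T S) (c_comp M C D E T S')"
    if S': "S' \<in> mult_hom A C D"
    by (rule mult_eqI[of _ C E]) (simp_all add: S' multL_in[OF S'] multL_add[OF T])
  show "c_comp M C D E (c_add M D E T T') S
      = c_add M C E (c_comp M C D E T S) (c_comp M C D E T' S)"
    if T': "T' \<in> mult_hom A D E"
    by (rule mult_eqI[of _ C E]) (simp_all add: T')
  show "c_comp M C E F U (c_comp M C D E T S) = c_comp M C D F (c_comp M D E F U T) S"
    if U: "U \<in> mult_hom A E F"
    by (rule mult_eqI[of _ C F]) (simp_all add: U)
qed

subsection \<open>The multiplier category is a C*-category up to positivity\<close>

lemma star_comp_mult:
  assumes T: "T \<in> mult_hom A C D" and [simp]: "E \<in> c_obj A" "h \<in> c_hom A E C"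
  shows "c_comp A E C E (c_star A E C h) (fst (c_comp M C D C (c_star M C D T) T) E h)
    = c_comp A E D E (c_star A E D (fst T E h)) (fst T E h)"
proof -
  note [simp] = mult_src[OF T] mult_tgt[OF T] multL_in[OF T] multR_in[OF T]
  let ?x = "fst T E h"
  have "c_comp A E C E (c_star A E C h) (c_star A C E (snd T E (c_star A E D ?x)))
      = c_star A E E (c_comp A E C E (snd T E (c_star A E D ?x)) h)"
    by (simp add: star_comp)
  also have "\<dots> = c_star A E E (c_comp A E D E (c_star A E D ?x) ?x)"
    by (simp add: mult_compat[OF T])
  finally show ?thesis by (simp add: star_comp star_star)
qed

lemma mult_norm_star_comp:
  assumes T: "T \<in> mult_hom A C D"
  shows "c_norm M C C (c_comp M C D C (c_star M C D T) T) = (c_norm M C D T)\<^sup>2"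
proof (rule antisym)
  note [simp] = mult_src[OF T] mult_tgt[OF T] multL_in[OF T]
  define a where "a = c_comp M C D C (c_star M C D T) T"
  have a: "a \<in> mult_hom A C C" unfolding a_def by (rule mult_comp_in[OF T mult_star_in[OF T]])
  have "c_norm M C C a \<le> c_norm M D C (c_star M C D T) * c_norm M C D T"
    unfolding a_def by (rule mult_norm_comp_le[OF T mult_star_in[OF T]])
  also have "\<dots> \<le> c_norm M C D T * c_norm M C D T"
    using mult_norm_star_le[OF T] mult_norm_nonneg[OF T] by (rule mult_right_mono)
  finally show "c_norm M C C a \<le> (c_norm M C D T)\<^sup>2" by (simp add: power2_eq_square)
  have nonneg: "0 \<le> c_norm M C C a" using a by (rule mult_norm_nonneg)
  have "c_norm M C D T \<le> sqrt (c_norm M C C a)"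
  proof (rule mult_norm_least[OF T])
    fix E h assume [simp]: "E \<in> c_obj A" "h \<in> c_hom A E C"
    have "(c_norm A E D (fst T E h))\<^sup>2 = c_norm A E E (c_comp A E C E (c_star A E C h) (fst a E h))"
      by (simp add: a_def star_comp_mult[OF T] norm_star_comp del: mult_cat_eval)
    also have "\<dots> \<le> c_norm A C E (c_star A E C h) * c_norm A E C (fst a E h)"
      using multL_in[OF a, of E h] by (intro norm_comp_le) simp_all
    also have "\<dots> \<le> c_norm A E C h * (c_norm M C C a * c_norm A E C h)"
      using mult_norm_boundL[OF a, of E h] by (simp add: norm_star mult_left_mono)
    also have "\<dots> = (sqrt (c_norm M C C a) * c_norm A E C h)\<^sup>2"
      using nonneg by (simp add: power_mult_distrib) (simp add: power2_eq_square)
    finally show "c_norm A E D (fst T E h) \<le> sqrt (c_norm M C C a) * c_norm A E C h"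
      by (rule power2_le_imp_le) (use nonneg in simp)
  qed (use nonneg in simp)
  then show "(c_norm M C D T)\<^sup>2 \<le> c_norm M C C a"
    using mult_norm_nonneg[OF T] nonneg by (metis power_mono real_sqrt_pow2)
qed

lemma mult_norm_eq_0:
  assumes T: "T \<in> mult_hom A C D"
  shows "c_norm M C D T = 0 \<longleftrightarrow> T = c_zero M C D"
proof
  note [simp] = mult_src[OF T] mult_tgt[OF T] multL_in[OF T]
  show "T = c_zero M C D" if "c_norm M C D T = 0"
  proof (rule mult_eqI[OF T mult_zero_in])
    fix E h assume [simp]: "E \<in> c_obj A" "h \<in> c_hom A E C"
    have "c_norm A E D (fst T E h) = 0"
      using mult_norm_boundL[OF T, of E h] that by (intro antisym) simp_all
    then show "fst T E h = fst (c_zero M C D) E h" by (simp add: hom_norm_eq_0)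
  qed simp_all
  show "c_norm M C D T = 0" if "T = c_zero M C D"
    using mult_norm_least[OF T order_refl] mult_norm_nonneg[OF T] that by simp
qed

lemma mult_norm_scale:
  assumes T: "T \<in> mult_hom A C D"
  shows "c_norm M C D (c_scale M C D a T) = cmod a * c_norm M C D T"
proof (rule antisym[OF mult_norm_scale_le[OF T]])
  note [simp] = mult_src[OF T] mult_tgt[OF T] multL_in[OF T]
  show "cmod a * c_norm M C D T \<le> c_norm M C D (c_scale M C D a T)"
  proof (cases "a = 0")
    case True
    then show ?thesis using mult_norm_nonneg[OF mult_scale_in[OF T]] by simp
  next
    case False
    have "c_scale M C D (1 / a) (c_scale M C D a T) = T"
      by (rule mult_eqI[OF mult_scale_in[OF mult_scale_in[OF T]] T])
        (use False in \<open>simp_all add: hom_scale_scale hom_scale_one\<close>)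
    then have "c_norm M C D T \<le> cmod (1 / a) * c_norm M C D (c_scale M C D a T)"
      using mult_norm_scale_le[OF mult_scale_in[OF T]] by metis
    then show ?thesis using False by (simp add: norm_divide field_simps)
  qed
qed

lemma
  assumes S: "S \<in> mult_hom A C D" and T: "T \<in> mult_hom A C D" and [simp]: "E \<in> c_obj A"
  shows mult_distL_le: "h \<in> c_hom A E C \<Longrightarrow>
      c_dist A E D (fst S E h) (fst T E h) \<le> c_dist M C D S T * c_norm A E C h"
    and mult_distR_le: "g \<in> c_hom A D E \<Longrightarrow>
      c_dist A C E (snd S E g) (snd T E g) \<le> c_dist M C D S T * c_norm A D E g"
proof -
  let ?d = "c_add M C D S (c_scale M C D (-1) T)"
  have d: "?d \<in> mult_hom A C D" by (intro mult_add_in mult_scale_in S T)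
  show "c_dist A E D (fst S E h) (fst T E h) \<le> c_dist M C D S T * c_norm A E C h"
    if "h \<in> c_hom A E C" using mult_norm_boundL[OF d, of E h] that by (simp add: norm_dist_def)
  show "c_dist A C E (snd S E g) (snd T E g) \<le> c_dist M C D S T * c_norm A D E g"
    if "g \<in> c_hom A D E" using mult_norm_boundR[OF d, of E g] that by (simp add: norm_dist_def)
qed

lemma mult_dist_nonneg: "S \<in> mult_hom A C D \<Longrightarrow> T \<in> mult_hom A C D \<Longrightarrow> 0 \<le> c_dist M C D S T"
  unfolding norm_dist_def by (intro mult_norm_nonneg mult_add_in mult_scale_in)

lemma mult_dist_least:
  assumes "S \<in> mult_hom A C D" "T \<in> mult_hom A C D" "0 \<le> K"
    and "\<And>E h. E \<in> c_obj A \<Longrightarrow> h \<in> c_hom A E C \<Longrightarrow>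
      c_dist A E D (fst S E h) (fst T E h) \<le> K * c_norm A E C h"
  shows "c_dist M C D S T \<le> K"
  unfolding norm_dist_def
  by (rule mult_norm_least) (use assms in \<open>simp_all add: mult_add_in mult_scale_in norm_dist_def\<close>)

lemma
  assumes X: "\<And>n. X n \<in> mult_hom A C D" and Cauchy: "Cauchy_seq (c_dist M C D) X"
    and [simp]: "E \<in> c_obj A"
  shows multL_Cauchy_convergent: "h \<in> c_hom A E C \<Longrightarrow>
      \<exists>y\<in>c_hom A E D. (\<lambda>n. c_dist A E D (fst (X n) E h) y) \<longlonglongrightarrow> 0"
    and multR_Cauchy_convergent: "g \<in> c_hom A D E \<Longrightarrow>
      \<exists>y\<in>c_hom A C E. (\<lambda>n. c_dist A C E (snd (X n) E g) y) \<longlonglongrightarrow> 0"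
proof -
  note [simp] = mult_src[OF X] mult_tgt[OF X] multL_in[OF X] multR_in[OF X]
  show "\<exists>y\<in>c_hom A E D. (\<lambda>n. c_dist A E D (fst (X n) E h) y) \<longlonglongrightarrow> 0"
    if h [simp]: "h \<in> c_hom A E C"
    by (intro hom_complete Cauchy_seq_dominated[OF Cauchy, of "c_norm A E C h"] mult_distL_le X)
      simp_all
  show "\<exists>y\<in>c_hom A C E. (\<lambda>n. c_dist A C E (snd (X n) E g) y) \<longlonglongrightarrow> 0"
    if g [simp]: "g \<in> c_hom A D E"
    by (intro hom_complete Cauchy_seq_dominated[OF Cauchy, of "c_norm A D E g"] mult_distR_le X)
      simp_all
qed

lemma mult_compat_limit:
  assumes X: "\<And>n. X n \<in> mult_hom A C D"
    and [simp]: "E \<in> c_obj A" "F \<in> c_obj A" "f \<in> c_hom A F C" "g \<in> c_hom A D E"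
      "y \<in> c_hom A F D" "x \<in> c_hom A C E"
    and limL: "(\<lambda>n. c_dist A F D (fst (X n) F f) y) \<longlonglongrightarrow> 0"
    and limR: "(\<lambda>n. c_dist A C E (snd (X n) E g) x) \<longlonglongrightarrow> 0"
  shows "c_comp A F D E g y = c_comp A F C E x f"
proof (rule hom_limit_unique[where X = "\<lambda>n. c_comp A F D E g (fst (X n) F f)"])
  note [simp] = mult_src[OF X] mult_tgt[OF X] multL_in[OF X] multR_in[OF X]
  show "(\<lambda>n. c_dist A F E (c_comp A F D E g (fst (X n) F f)) (c_comp A F D E g y)) \<longlonglongrightarrow> 0"
    by (rule comp_left_tendsto) (simp_all add: limL)
  have "(\<lambda>n. c_dist A F E (c_comp A F C E (snd (X n) E g) f) (c_comp A F C E x f)) \<longlonglongrightarrow> 0"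
    by (rule comp_right_tendsto) (simp_all add: limR)
  then show "(\<lambda>n. c_dist A F E (c_comp A F D E g (fst (X n) F f)) (c_comp A F C E x f)) \<longlonglongrightarrow> 0"
    by (simp add: mult_compat[OF X])
qed (use multL_in[OF X] mult_src[OF X] mult_tgt[OF X] in simp_all)

lemma mult_limit_dist_le:
  assumes X: "\<And>n. X n \<in> mult_hom A C D"
    and near: "\<And>m n. N \<le> m \<Longrightarrow> N \<le> n \<Longrightarrow> c_dist M C D (X m) (X n) < e" and n_ge: "N \<le> n"
    and [simp]: "E \<in> c_obj A" "h \<in> c_hom A E C" "y \<in> c_hom A E D"
    and lim: "(\<lambda>n. c_dist A E D (fst (X n) E h) y) \<longlonglongrightarrow> 0"
  shows "c_dist A E D (fst (X n) E h) y \<le> e * c_norm A E C h"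
proof (rule hom_limit_dist_le[OF _ _ _ _ _ lim])
  note [simp] = mult_src[OF X] mult_tgt[OF X] multL_in[OF X]
  fix m assume "N \<le> m"
  have "c_dist A E D (fst (X n) E h) (fst (X m) E h) \<le> c_dist M C D (X n) (X m) * c_norm A E C h"
    by (intro mult_distL_le X) simp_all
  also have "\<dots> \<le> e * c_norm A E C h"
    using near[OF n_ge \<open>N \<le> m\<close>] by (intro mult_right_mono) simp_all
  finally show "c_dist A E D (fst (X n) E h) (fst (X m) E h) \<le> e * c_norm A E C h" .
qed (use multL_in[OF X] mult_src[OF X] mult_tgt[OF X] in simp_all)

lemma mk_mult_limit_in:
  assumes [simp]: "C \<in> c_obj A" "D \<in> c_obj A" and X: "\<And>n. X n \<in> mult_hom A C D"
    and Cauchy: "Cauchy_seq (c_dist M C D) X"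
    and L [simp]: "\<And>E h. E \<in> c_obj A \<Longrightarrow> h \<in> c_hom A E C \<Longrightarrow> L E h \<in> c_hom A E D"
    and R: "\<And>E g. E \<in> c_obj A \<Longrightarrow> g \<in> c_hom A D E \<Longrightarrow> R E g \<in> c_hom A C E"
    and limL: "\<And>E h. E \<in> c_obj A \<Longrightarrow> h \<in> c_hom A E C \<Longrightarrow>
      (\<lambda>n. c_dist A E D (fst (X n) E h) (L E h)) \<longlonglongrightarrow> 0"
    and limR: "\<And>E g. E \<in> c_obj A \<Longrightarrow> g \<in> c_hom A D E \<Longrightarrow>
      (\<lambda>n. c_dist A C E (snd (X n) E g) (R E g)) \<longlonglongrightarrow> 0"
  shows "mk_mult A C D L R \<in> mult_hom A C D"
proof -
  obtain N where near: "\<And>m n. N \<le> m \<Longrightarrow> N \<le> n \<Longrightarrow> c_dist M C D (X m) (X n) < 1"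
    using Cauchy_seqD[OF Cauchy, of 1] by auto
  note [simp] = multL_in[OF X]
  show ?thesis
  proof (rule mk_mult_in_norm_le[THEN conjunct1])
    show "0 \<le> 1 + c_norm M C D (X N)" using mult_norm_nonneg[OF X] by simp
    fix E h assume [simp]: "E \<in> c_obj A" "h \<in> c_hom A E C"
    have "c_norm A E D (L E h)
        \<le> c_dist A E D (fst (X N) E h) (L E h) + c_norm A E D (fst (X N) E h)"
      by (rule hom_norm_le_dist_add) simp_all
    also have "\<dots> \<le> 1 * c_norm A E C h + c_norm M C D (X N) * c_norm A E C h"
      by (intro add_mono mult_limit_dist_le[where X = X, OF X near order_refl]
          mult_norm_boundL[OF X] limL) simp_all
    finally show "c_norm A E D (L E h) \<le> (1 + c_norm M C D (X N)) * c_norm A E C h"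
      by (simp add: distrib_right)
  next
    fix E F f g assume "E \<in> c_obj A" "F \<in> c_obj A" "f \<in> c_hom A F C" "g \<in> c_hom A D E"
    then show "c_comp A F D E g (L F f) = c_comp A F C E (R E g) f"
      by (intro mult_compat_limit[where X = X] X limL limR L R)
  qed (simp_all add: R)
qed

lemma mult_complete:
  assumes [simp]: "C \<in> c_obj A" "D \<in> c_obj A" and X: "\<And>n. X n \<in> mult_hom A C D"
    and Cauchy: "Cauchy_seq (c_dist M C D) X"
  shows "\<exists>T\<in>mult_hom A C D. (\<lambda>n. c_dist M C D (X n) T) \<longlonglongrightarrow> 0"
proof -
  obtain L where L: "\<And>E h. E \<in> c_obj A \<Longrightarrow> h \<in> c_hom A E C \<Longrightarrow> L E h \<in> c_hom A E D"
    and limL: "\<And>E h. E \<in> c_obj A \<Longrightarrow> h \<in> c_hom A E C \<Longrightarrow>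
      (\<lambda>n. c_dist A E D (fst (X n) E h) (L E h)) \<longlonglongrightarrow> 0"
    using multL_Cauchy_convergent[OF X Cauchy] by metis
  obtain R where R: "\<And>E g. E \<in> c_obj A \<Longrightarrow> g \<in> c_hom A D E \<Longrightarrow> R E g \<in> c_hom A C E"
    and limR: "\<And>E g. E \<in> c_obj A \<Longrightarrow> g \<in> c_hom A D E \<Longrightarrow>
      (\<lambda>n. c_dist A C E (snd (X n) E g) (R E g)) \<longlonglongrightarrow> 0"
    using multR_Cauchy_convergent[OF X Cauchy] by metis
  define T where "T = mk_mult A C D L R"
  have T: "T \<in> mult_hom A C D"
    unfolding T_def by (rule mk_mult_limit_in[where X = X]) (simp_all add: X Cauchy L R limL limR)
  have "(\<lambda>n. c_dist M C D (X n) T) \<longlonglongrightarrow> 0"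
  proof (rule LIMSEQ_I)
    fix r :: real assume r_pos: "0 < r"
    then obtain N where near: "\<And>m n. N \<le> m \<Longrightarrow> N \<le> n \<Longrightarrow> c_dist M C D (X m) (X n) < r / 2"
      using Cauchy_seqD[OF Cauchy, of "r / 2"] by auto
    have "c_dist M C D (X n) T \<le> r / 2" if n_ge: "N \<le> n" for n
    proof (rule mult_dist_least[OF X T])
      fix E h assume "E \<in> c_obj A" "h \<in> c_hom A E C"
      then show "c_dist A E D (fst (X n) E h) (fst T E h) \<le> r / 2 * c_norm A E C h"
        using mult_limit_dist_le[where X = X, OF X near n_ge] L limL by (simp add: T_def)
    qed (use r_pos in simp)
    then show "\<exists>N. \<forall>n\<ge>N. norm (c_dist M C D (X n) T - 0) < r"
      using r_pos mult_dist_nonneg[OF X T] by (intro exI[of _ N]) force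
  qed
  then show ?thesis using T by blast
qed

lemma mult_banach:
  assumes [simp]: "C \<in> c_obj A" "D \<in> c_obj A"
  shows "banach_on (mult_hom A C D) (c_zero M C D) (c_add M C D) (c_scale M C D) (c_norm M C D)"
  unfolding banach_on_def
proof (intro conjI ballI allI impI)
  note [simp] = mult_zero_in mult_add_in mult_scale_in multL_in[of _ A C D]
  note vector_space = hom_add_assoc hom_scale_scale hom_scale_one hom_add_zero_left
    hom_scale_add_left hom_scale_add_right
  fix S T U :: "('o,'m) mult" and a b :: complex
  assume [simp]: "S \<in> mult_hom A C D"
  show "c_add M C D (c_zero M C D) S = S" "c_scale M C D 1 S = S"
    "c_scale M C D a (c_scale M C D b S) = c_scale M C D (a * b) S"
    "c_scale M C D (a + b) S = c_add M C D (c_scale M C D a S) (c_scale M C D b S)"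
    by (rule mult_eqI[of _ C D]; simp add: vector_space)+
  show "\<exists>T\<in>mult_hom A C D. c_add M C D S T = c_zero M C D"
    by (rule bexI[of _ "c_scale M C D (-1) S"]; (rule mult_eqI[of _ C D])?)
      (simp_all add: hom_add_neg)
  show "c_norm M C D S = 0 \<longleftrightarrow> S = c_zero M C D"
    "c_norm M C D (c_scale M C D a S) = cmod a * c_norm M C D S"
    by (simp_all add: mult_norm_eq_0 mult_norm_scale)
  assume [simp]: "T \<in> mult_hom A C D"
  show "c_add M C D S T = c_add M C D T S"
    by (rule mult_eqI[of _ C D]) (simp_all add: hom_add_commute)
  show "c_scale M C D a (c_add M C D S T) = c_add M C D (c_scale M C D a S) (c_scale M C D a T)"
    by (rule mult_eqI[of _ C D]) (simp_all add: vector_space)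
  show "c_norm M C D (c_add M C D S T) \<le> c_norm M C D S + c_norm M C D T"
    by (simp add: mult_norm_add_le)
  assume [simp]: "U \<in> mult_hom A C D"
  show "c_add M C D (c_add M C D S T) U = c_add M C D S (c_add M C D T U)"
    by (rule mult_eqI[of _ C D]) (simp_all add: vector_space)
next
  fix X :: "nat \<Rightarrow> ('o,'m) mult"
  assume "(\<forall>n. X n \<in> mult_hom A C D) \<and>
    (\<forall>e>0. \<exists>N. \<forall>m\<ge>N. \<forall>n\<ge>N. c_norm M C D (c_add M C D (X m) (c_scale M C D (-1) (X n))) < e)"
  then show "\<exists>T\<in>mult_hom A C D. (\<lambda>n. c_norm M C D (c_add M C D (X n) (c_scale M C D (-1) T))) \<longlonglongrightarrow> 0"
    using mult_complete[of C D X] by (simp add: Cauchy_seq_def norm_dist_def)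
qed (simp_all add: mult_zero_in mult_add_in mult_scale_in)

lemma pre_cstar_category_mult_cat: "pre_cstar_category M"
  by unfold_locales
    (simp_all add: mult_banach mult_comp_in mult_comp_assoc mult_comp_add_right mult_comp_add_left
      mult_comp_scale_right mult_comp_scale_left mult_norm_comp_le mult_star_in mult_star_add
      mult_star_scale mult_star_star mult_star_comp mult_norm_star_comp)

end

section \<open>Positivity in endomorphism algebras\<close>

locale unital_object = pre_cstar_category A for A :: "('o,'m) cstarcat" +
  fixes C :: 'o
  assumes obj [simp]: "C \<in> c_obj A" and has_unit: "\<exists>u. is_unit A C u"
begin

definition unit :: 'm where
  "unit = (SOME u. is_unit A C u)"

lemma is_unit_unit: "is_unit A C unit"
  unfolding unit_def using has_unit by (rule someI_ex)

lemma
  shows unit_in [simp]: "unit \<in> c_hom A C C"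
    and comp_unit_right [simp]: "D \<in> c_obj A \<Longrightarrow> f \<in> c_hom A C D \<Longrightarrow> c_comp A C C D f unit = f"
    and comp_unit_left [simp]: "D \<in> c_obj A \<Longrightarrow> g \<in> c_hom A D C \<Longrightarrow> c_comp A D C C unit g = g"
  using is_unit_unit by (simp_all add: is_unit_def)

lemma comp_scaled_unit:
  assumes "x \<in> c_hom A C C"
  shows "c_comp A C C C (c_scale A C C a unit) x = c_scale A C C a x"
    and "c_comp A C C C x (c_scale A C C a unit) = c_scale A C C a x"
  using assms by (simp_all add: comp_scale_left comp_scale_right)

lemma star_unit: "c_star A C C unit = unit"
proof -
  have "unit = c_star A C C (c_comp A C C C (c_star A C C unit) unit)" by (simp add: star_star)
  also have "\<dots> = c_comp A C C C (c_star A C C unit) unit"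
    by (subst star_comp) (simp_all add: star_star)
  finally show ?thesis by simp
qed

end

lemmas unital_object_hom_simps = unital_object.axioms(1) unital_object.obj unital_object.unit_in
  unital_object.comp_unit_left unital_object.comp_unit_right pre_cstar_category.hom_simps

text \<open>The spectral arguments need ring arithmetic on a type, but each algebra of endomorphisms lives
  on a carrier set. The product of all unital endomorphism algebras, over all categories with the
  given types of objects and morphisms, is a ring on a type, and the norm of a single factor is a
  seminorm on it.\<close>

typedef ('o,'m) endo_family =
  "{u :: ('o,'m) cstarcat \<Rightarrow> 'o \<Rightarrow> 'm.
    \<forall>A C. if unital_object A C then u A C \<in> c_hom A C C else u A C = undefined}"
  morphisms endo_at endo_family
proof
  show "(\<lambda>A C. if unital_object A C then unital_object.unit A C else undefined) \<in>
      {u. \<forall>A C. if unital_object A C then u A C \<in> c_hom A C C else u A C = undefined}"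
    by (simp add: unital_object.unit_in)
qed

definition mk_endo :: "(('o,'m) cstarcat \<Rightarrow> 'o \<Rightarrow> 'm) \<Rightarrow> ('o,'m) endo_family" where
  "mk_endo f = endo_family (\<lambda>A C. if unital_object A C then f A C else undefined)"

lemma endo_at_mk_endo:
  assumes "\<And>A C. unital_object A C \<Longrightarrow> f A C \<in> c_hom A C C" "unital_object A C"
  shows "endo_at (mk_endo f) A C = f A C"
  unfolding mk_endo_def using assms by (subst endo_family_inverse) auto

lemma endo_at_in: "unital_object A C \<Longrightarrow> endo_at u A C \<in> c_hom A C C"
  using endo_at[of u] by (auto split: if_splits)

lemma endo_family_eqI:
  assumes "\<And>A C. unital_object A C \<Longrightarrow> endo_at u A C = endo_at v A C"
  shows "u = v"
proof -
  have "endo_at u A C = endo_at v A C" for A C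
    using assms[of A C] endo_at[of u] endo_at[of v] by (cases "unital_object A C") auto
  then show ?thesis by (metis endo_at_inject ext)
qed

instantiation endo_family :: (type, type) "{ring, monoid_mult}"
begin

definition "0 = mk_endo (\<lambda>A C. c_zero A C C)"
definition "1 = mk_endo (\<lambda>A C. unital_object.unit A C)"
definition "u + v = mk_endo (\<lambda>A C. c_add A C C (endo_at u A C) (endo_at v A C))"
definition "- u = mk_endo (\<lambda>A C. c_scale A C C (-1) (endo_at u A C))"
definition "u - v =
  mk_endo (\<lambda>A C. c_add A C C (endo_at u A C) (c_scale A C C (-1) (endo_at v A C)))"
definition "u * v = mk_endo (\<lambda>A C. c_comp A C C C (endo_at u A C) (endo_at v A C))"

lemma endo_at_ring:
  assumes "unital_object A C"
  shows "endo_at 0 A C = c_zero A C C"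
    and "endo_at 1 A C = unital_object.unit A C"
    and "endo_at (u + v) A C = c_add A C C (endo_at u A C) (endo_at v A C)"
    and "endo_at (- u) A C = c_scale A C C (-1) (endo_at u A C)"
    and "endo_at (u - v) A C = c_add A C C (endo_at u A C) (c_scale A C C (-1) (endo_at v A C))"
    and "endo_at (u * v) A C = c_comp A C C C (endo_at u A C) (endo_at v A C)"
  unfolding zero_endo_family_def one_endo_family_def plus_endo_family_def uminus_endo_family_def
    minus_endo_family_def times_endo_family_def
  by (subst endo_at_mk_endo; simp add: assms endo_at_in unital_object_hom_simps)+

instance
proof
  fix u v w :: "('a,'b) endo_family"
  note endo_simps = endo_at_ring endo_at_in unital_object_hom_simps
  show "u + v + w = u + (v + w)" "0 + u = u" "u - v = u + - v"
    "u * v * w = u * (v * w)" "(u + v) * w = u * w + v * w" "u * (v + w) = u * v + u * w"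
    "1 * u = u" "u * 1 = u"
    by (rule endo_family_eqI, simp add: endo_simps pre_cstar_category.hom_add_assoc
        pre_cstar_category.hom_add_zero_left pre_cstar_category.comp_assoc
        pre_cstar_category.comp_add_left pre_cstar_category.comp_add_right)+
  show add_commute: "u + v = v + u" for u v :: "('a,'b) endo_family"
    by (rule endo_family_eqI)
      (simp add: endo_simps, simp add: endo_simps pre_cstar_category.hom_add_commute)
  have "u + - u = 0"
    by (rule endo_family_eqI) (simp add: endo_simps pre_cstar_category.hom_add_neg)
  then show "- u + u = 0" by (simp add: add_commute)
qed

end

definition endo_scalar :: "complex \<Rightarrow> ('o,'m) endo_family" where
  "endo_scalar a = mk_endo (\<lambda>A C. c_scale A C C a (unital_object.unit A C))"

definition endo_star :: "('o,'m) endo_family \<Rightarrow> ('o,'m) endo_family" where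
  "endo_star u = mk_endo (\<lambda>A C. c_star A C C (endo_at u A C))"

definition endo_single :: "('o,'m) cstarcat \<Rightarrow> 'o \<Rightarrow> 'm \<Rightarrow> ('o,'m) endo_family" where
  "endo_single A C x = mk_endo (\<lambda>A' C'. if A' = A \<and> C' = C then x else c_zero A' C' C')"

lemma endo_at_scalar:
  "unital_object A C \<Longrightarrow> endo_at (endo_scalar a) A C = c_scale A C C a (unital_object.unit A C)"
  unfolding endo_scalar_def by (rule endo_at_mk_endo) (simp_all add: unital_object_hom_simps)

lemma endo_at_star: "unital_object A C \<Longrightarrow> endo_at (endo_star u) A C = c_star A C C (endo_at u A C)"
  unfolding endo_star_def
  by (rule endo_at_mk_endo) (simp_all add: endo_at_in unital_object_hom_simps)

context unital_object
begin

lemma endo_at_single: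
  assumes "x \<in> c_hom A C C" "unital_object A' C'"
  shows "endo_at (endo_single A C x) A' C' = (if A' = A \<and> C' = C then x else c_zero A' C' C')"
  unfolding endo_single_def
  by (rule endo_at_mk_endo) (use assms in \<open>auto simp: unital_object_hom_simps\<close>)

lemmas endo_at_simps [simp] =
  endo_at_in[OF unital_object_axioms] endo_at_ring[OF unital_object_axioms]
  endo_at_scalar[OF unital_object_axioms] endo_at_star[OF unital_object_axioms]
  endo_at_single[OF _ unital_object_axioms]

lemma endo_star_single:
  assumes "a \<in> c_hom A C C" "c_star A C C a = a"
  shows "endo_star (endo_single A C a) = endo_single A C a"
proof (rule endo_family_eqI)
  fix A' :: "('o,'m) cstarcat" and C'
  assume A': "unital_object A' C'"
  then show "endo_at (endo_star (endo_single A C a)) A' C' = endo_at (endo_single A C a) A' C'"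
    using assms
    by (simp add: endo_at_star endo_at_single unital_object_hom_simps pre_cstar_category.star_zero)
qed

sublocale endo: seminormed_cstar_algebra endo_scalar endo_star "\<lambda>u. c_norm A C C (endo_at u A C)"
proof
  fix a b :: complex and x y :: "('o,'m) endo_family"
  note endo_simps = endo_at_ring endo_at_scalar endo_at_star endo_at_in unital_object_hom_simps
    unital_object.comp_scaled_unit
  show "endo_scalar (a + b) = (endo_scalar a + endo_scalar b :: ('o,'m) endo_family)"
    by (rule endo_family_eqI) (simp add: endo_simps pre_cstar_category.hom_scale_add_left)
  show "endo_scalar (a * b) = (endo_scalar a * endo_scalar b :: ('o,'m) endo_family)"
    by (rule endo_family_eqI) (simp add: endo_simps pre_cstar_category.hom_scale_scale mult.commute)
  show "endo_scalar 1 = (1 :: ('o,'m) endo_family)"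
    by (rule endo_family_eqI) (simp add: endo_simps pre_cstar_category.hom_scale_one)
  show "x * endo_scalar a = endo_scalar a * x"
    by (rule endo_family_eqI) (simp add: endo_simps)
  show "endo_star (x - y) = endo_star x - endo_star y"
    by (rule endo_family_eqI)
      (simp add: endo_simps pre_cstar_category.star_add pre_cstar_category.star_scale)
  show "endo_star (x * y) = endo_star y * endo_star x"
    by (rule endo_family_eqI) (simp add: endo_simps pre_cstar_category.star_comp)
  show "endo_star (endo_star x) = x"
    by (rule endo_family_eqI) (simp add: endo_simps pre_cstar_category.star_star)
  show "endo_star (endo_scalar a) = (endo_scalar (cnj a) :: ('o,'m) endo_family)"
    by (rule endo_family_eqI)
      (simp add: endo_simps pre_cstar_category.star_scale unital_object.star_unit)
  show "c_norm A C C (endo_at (x + y) A C)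
      \<le> c_norm A C C (endo_at x A C) + c_norm A C C (endo_at y A C)"
    by (simp add: hom_norm_triangle)
  show "c_norm A C C (endo_at (x * y) A C)
      \<le> c_norm A C C (endo_at x A C) * c_norm A C C (endo_at y A C)"
    by (simp add: norm_comp_le)
  show "c_norm A C C (endo_at (endo_scalar a * x) A C) = cmod a * c_norm A C C (endo_at x A C)"
    by (simp add: comp_scaled_unit hom_norm_scale)
  show "c_norm A C C (endo_at (endo_star x * x) A C) = (c_norm A C C (endo_at x A C))\<^sup>2"
    by (simp add: norm_star_comp)
  fix X :: "nat \<Rightarrow> ('o,'m) endo_family"
  assume "\<And>e. e > 0 \<Longrightarrow> \<exists>M. \<forall>m\<ge>M. \<forall>n\<ge>M. c_norm A C C (endo_at (X m - X n) A C) < e"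
  then have "Cauchy_seq (c_dist A C C) (\<lambda>n. endo_at (X n) A C)"
    by (simp add: Cauchy_seq_def norm_dist_def)
  then obtain x where "x \<in> c_hom A C C" "(\<lambda>n. c_dist A C C (endo_at (X n) A C) x) \<longlonglongrightarrow> 0"
    using hom_complete[of C C "\<lambda>n. endo_at (X n) A C"] by auto
  then show "\<exists>x. (\<lambda>n. c_norm A C C (endo_at (X n - x) A C)) \<longlonglongrightarrow> 0"
    by (intro exI[of _ "endo_single A C x"]) (simp add: norm_dist_def)
qed

lemma positive_el_iff_invertible:
  assumes [simp]: "a \<in> c_hom A C C"
  shows "positive_el A C a \<longleftrightarrow> c_star A C C a = a \<and>
    (\<forall>l. \<not> (l \<in> \<real> \<and> 0 \<le> Re l) \<longrightarrow> endo.invertible (endo_single A C a - endo_scalar l))"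
proof -
  have "(\<exists>b\<in>c_hom A C C.
      c_add A C C (c_add A C C (c_comp A C C C a b) (c_scale A C C (- l) b))
        (c_scale A C C (- (1 / l)) a) = c_zero A C C \<and>
      c_add A C C (c_add A C C (c_comp A C C C b a) (c_scale A C C (- l) b))
        (c_scale A C C (- (1 / l)) a) = c_zero A C C) \<longleftrightarrow>
    endo.invertible (endo_single A C a - endo_scalar l)" (is "(\<exists>b\<in>_. ?quasi_inverse b) \<longleftrightarrow> _")
    if l_nonzero: "l \<noteq> 0" for l
  proof -
    have "(\<exists>b\<in>c_hom A C C. ?quasi_inverse b) \<longleftrightarrow> (\<exists>u. ?quasi_inverse (endo_at u A C))"
    proof
      assume "\<exists>b\<in>c_hom A C C. ?quasi_inverse b"
      then obtain b where "b \<in> c_hom A C C" "?quasi_inverse b" by blast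
      then show "\<exists>u. ?quasi_inverse (endo_at u A C)" by (intro exI[of _ "endo_single A C b"]) simp
    qed (use endo_at_in[OF unital_object_axioms] in blast)
    then show ?thesis
      by (simp add: endo.invertible_iff_quasi_inverse[OF l_nonzero] hom_norm_eq_0 comp_scaled_unit)
  qed
  moreover have "l \<noteq> 0" if "\<not> (l \<in> \<real> \<and> 0 \<le> Re l)" for l :: complex using that by auto
  ultimately show ?thesis unfolding positive_el_def by auto
qed

lemma positive_el_imp_positive:
  assumes "positive_el A C p"
  shows "endo.positive (endo_single A C p)"
  unfolding endo.positive_def
proof (intro conjI allI impI)
  have p: "p \<in> c_hom A C C" "c_star A C C p = p" using assms by (auto simp: positive_el_def)
  then show "endo_star (endo_single A C p) = endo_single A C p" by (rule endo_star_single)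
  fix s :: real assume s_pos: "0 < s"
  have "endo.invertible (endo_single A C p - endo_scalar (of_real (- s)))"
    using assms s_pos p(1) by (simp add: positive_el_iff_invertible del: of_real_minus)
  then show "\<exists>c>0. endo.bounded_below (endo_single A C p + endo_scalar (of_real s)) c"
    using endo.invertible_imp_bounded_below by (fastforce simp: endo.scalar_minus)
qed

lemma positive_el_norm_mono_unital:
  assumes "positive_el A C p" "positive_el A C q"
  shows "c_norm A C C q \<le> c_norm A C C (c_add A C C p q)"
proof -
  have "p \<in> c_hom A C C" "q \<in> c_hom A C C" using assms by (auto simp: positive_el_def)
  then show ?thesis
    using endo.positive_norm_mono[OF assms[THEN positive_el_imp_positive]] by simp
qed

lemma positive_elI_bounded_below:
  assumes a [simp]: "a \<in> c_hom A C C" and self_adjoint: "c_star A C C a = a"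
    and bounded: "\<And>s m. 0 < s \<Longrightarrow> m \<in> c_hom A C C \<Longrightarrow>
      s * c_norm A C C m
        \<le> c_norm A C C (c_add A C C (c_comp A C C C a m) (c_scale A C C (of_real s) m))"
  shows "positive_el A C a"
  unfolding positive_el_iff_invertible[OF a]
proof (intro conjI allI impI self_adjoint)
  fix l :: complex assume off_half_line: "\<not> (l \<in> \<real> \<and> 0 \<le> Re l)"
  have "endo.bounded_below (endo_single A C a + endo_scalar (of_real s)) s" if "0 < s" for s
    unfolding endo.bounded_below_def using bounded[OF that]
    by (simp add: comp_add_left comp_scaled_unit)
  then show "endo.invertible (endo_single A C a - endo_scalar l)"
    using endo.self_adjoint_resolvent_off_half_line[OF endo_star_single[OF a self_adjoint]
        _ off_half_line]
    by blast
qed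

end

section \<open>The ideal inclusion\<close>

lemma
  assumes "star_functor A B F"
  shows star_functor_obj: "C \<in> c_obj A \<Longrightarrow> fst F C \<in> c_obj B"
    and star_functor_hom: "C \<in> c_obj A \<Longrightarrow> D \<in> c_obj A \<Longrightarrow> f \<in> c_hom A C D \<Longrightarrow>
      snd F C D f \<in> c_hom B (fst F C) (fst F D)"
    and star_functor_add: "C \<in> c_obj A \<Longrightarrow> D \<in> c_obj A \<Longrightarrow> f \<in> c_hom A C D \<Longrightarrow> g \<in> c_hom A C D \<Longrightarrow>
      snd F C D (c_add A C D f g) = c_add B (fst F C) (fst F D) (snd F C D f) (snd F C D g)"
    and star_functor_scale: "C \<in> c_obj A \<Longrightarrow> D \<in> c_obj A \<Longrightarrow> f \<in> c_hom A C D \<Longrightarrow>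
      snd F C D (c_scale A C D a f) = c_scale B (fst F C) (fst F D) a (snd F C D f)"
    and star_functor_comp: "C \<in> c_obj A \<Longrightarrow> D \<in> c_obj A \<Longrightarrow> E \<in> c_obj A \<Longrightarrow>
      f \<in> c_hom A C D \<Longrightarrow> g \<in> c_hom A D E \<Longrightarrow>
      snd F C E (c_comp A C D E g f)
        = c_comp B (fst F C) (fst F D) (fst F E) (snd F D E g) (snd F C D f)"
    and star_functor_star: "C \<in> c_obj A \<Longrightarrow> D \<in> c_obj A \<Longrightarrow> f \<in> c_hom A C D \<Longrightarrow>
      snd F D C (c_star A C D f) = c_star B (fst F C) (fst F D) (snd F C D f)"
  using assms unfolding star_functor_def by simp_all

context pre_cstar_category
begin

lemma star_functor_mult_embed: "star_functor A M (mult_embed A)"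
  unfolding star_functor_def mult_embed_obj mult_cat_sel
proof (intro conjI ballI allI)
  fix C D E f g a
  note [simp] = mult_embed_in mult_add_in mult_scale_in mult_comp_in mult_star_in
  assume [simp]: "C \<in> c_obj A"
  then show "C \<in> c_obj A" .
  assume [simp]: "D \<in> c_obj A" "f \<in> c_hom A C D"
  show "snd (mult_embed A) C D f \<in> mult_hom A C D" by simp
  show "snd (mult_embed A) C D (c_scale A C D a f) = c_scale M C D a (snd (mult_embed A) C D f)"
    by (rule mult_eqI[of _ C D]) (simp_all add: comp_scale_left)
  show "snd (mult_embed A) D C (c_star A C D f) = c_star M C D (snd (mult_embed A) C D f)"
    by (rule mult_eqI[of _ D C]) (simp_all add: star_comp star_star)
  show "snd (mult_embed A) C D (c_add A C D f g)
      = c_add M C D (snd (mult_embed A) C D f) (snd (mult_embed A) C D g)" if "g \<in> c_hom A C D"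
    by (rule mult_eqI[of _ C D]) (simp_all add: comp_add_left that)
  show "snd (mult_embed A) C E (c_comp A C D E g f)
      = c_comp M C D E (snd (mult_embed A) D E g) (snd (mult_embed A) C D f)"
    if [simp]: "E \<in> c_obj A" "g \<in> c_hom A D E"
    by (rule mult_eqI[of _ C E]) (simp_all add: comp_assoc)
qed

lemmas mult_embed_add = star_functor_add[OF star_functor_mult_embed, unfolded mult_embed_obj]
lemmas mult_embed_scale = star_functor_scale[OF star_functor_mult_embed, unfolded mult_embed_obj]
lemmas mult_embed_comp = star_functor_comp[OF star_functor_mult_embed, unfolded mult_embed_obj]
lemmas mult_embed_star = star_functor_star[OF star_functor_mult_embed, unfolded mult_embed_obj]

lemma mult_embed_zero:
  assumes [simp]: "C \<in> c_obj A" "D \<in> c_obj A"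
  shows "snd (mult_embed A) C D (c_zero A C D) = c_zero M C D"
  by (rule mult_eqI[of _ C D]) (simp_all add: mult_embed_in mult_zero_in comp_zero_left)

lemma mult_embed_inj:
  assumes [simp]: "C \<in> c_obj A" "D \<in> c_obj A"
  shows "inj_on (snd (mult_embed A) C D) (c_hom A C D)"
proof (rule inj_onI)
  fix f g
  assume [simp]: "f \<in> c_hom A C D" "g \<in> c_hom A C D"
    and eq: "snd (mult_embed A) C D f = snd (mult_embed A) C D g"
  show "f = g"
  proof (rule hom_eqI_comp_right[of C D])
    fix E h assume "E \<in> c_obj A" "h \<in> c_hom A E C"
    then show "c_comp A E C D f h = c_comp A E C D g h"
      using arg_cong[OF eq, of "\<lambda>T. fst T E h"] by simp
  qed simp_all
qed

lemma mult_embed_norm: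
  assumes [simp]: "C \<in> c_obj A" "D \<in> c_obj A" "f \<in> c_hom A C D"
  shows "c_norm M C D (snd (mult_embed A) C D f) = c_norm A C D f"
proof (rule antisym[OF mult_embed_norm_le])
  have embed_in: "snd (mult_embed A) C D f \<in> mult_hom A C D" by (simp add: mult_embed_in)
  show "c_norm A C D f \<le> c_norm M C D (snd (mult_embed A) C D f)"
  proof (rule square_le_mult_imp_le)
    show "c_norm A C D f * c_norm A C D f
        \<le> c_norm M C D (snd (mult_embed A) C D f) * c_norm A C D f"
      using mult_norm_boundL[OF embed_in, of D "c_star A C D f"]
      by (simp add: norm_comp_star norm_star power2_eq_square)
  qed (simp_all add: mult_norm_nonneg[OF embed_in])
qed simp_all

lemma mult_embed_dist:
  assumes "C \<in> c_obj A" "D \<in> c_obj A" "f \<in> c_hom A C D" "g \<in> c_hom A C D"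
  shows "c_dist M C D (snd (mult_embed A) C D f) (snd (mult_embed A) C D g) = c_dist A C D f g"
  unfolding norm_dist_def using assms
  by (simp add: mult_embed_norm flip: mult_embed_add mult_embed_scale)

lemma mult_comp_embed:
  assumes [simp]: "C \<in> c_obj A" "f \<in> c_hom A C D" and T: "T \<in> mult_hom A D E"
  shows "c_comp M C D E T (snd (mult_embed A) C D f) = snd (mult_embed A) C E (fst T C f)"
proof -
  note [simp] = mult_src[OF T] mult_tgt[OF T] multL_in[OF T]
  show ?thesis
    by (rule mult_eqI[of _ C E]) (simp_all add: mult_embed_in mult_comp_in[OF _ T] multL_comp[OF T])
qed

lemma embed_comp_mult:
  assumes [simp]: "D \<in> c_obj A" "f \<in> c_hom A C D" and T: "T \<in> mult_hom A E C"
  shows "c_comp M E C D (snd (mult_embed A) C D f) T = snd (mult_embed A) E D (snd T D f)"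
proof -
  note [simp] = mult_src[OF T] mult_tgt[OF T] multL_in[OF T] multR_in[OF T]
  show ?thesis
    by (rule mult_eqI[of _ E D]) (simp_all add: mult_embed_in mult_comp_in[OF T] mult_compat[OF T])
qed

lemma mult_embed_closed:
  assumes [simp]: "C \<in> c_obj A" "D \<in> c_obj A"
    and X: "\<And>n. X n \<in> snd (mult_embed A) C D ` c_hom A C D" and T: "T \<in> mult_hom A C D"
    and lim: "(\<lambda>n. c_dist M C D (X n) T) \<longlonglongrightarrow> 0"
  shows "T \<in> snd (mult_embed A) C D ` c_hom A C D"
proof -
  interpret M: pre_cstar_category M by (rule pre_cstar_category_mult_cat)
  let ?e = "snd (mult_embed A) C D"
  obtain x where x [simp]: "\<And>n. x n \<in> c_hom A C D" and X_eq: "\<And>n. X n = ?e (x n)"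
    using X unfolding image_iff by metis
  have X_in: "X n \<in> mult_hom A C D" for n by (simp add: X_eq mult_embed_in)
  have "Cauchy_seq (c_dist M C D) X"
    using M.hom_convergent_imp_Cauchy_seq[of C D X T] X_in T lim by simp
  then have "Cauchy_seq (c_dist A C D) x"
    by (rule Cauchy_seq_dominated[where b = 1]) (simp_all add: X_eq mult_embed_dist)
  then obtain y where y [simp]: "y \<in> c_hom A C D" and "(\<lambda>n. c_dist A C D (x n) y) \<longlonglongrightarrow> 0"
    using hom_complete[of C D x] by auto
  then have "(\<lambda>n. c_dist M C D (X n) (?e y)) \<longlonglongrightarrow> 0" by (simp add: X_eq mult_embed_dist)
  then have "T = ?e y"
    using M.hom_limit_unique[of C D X T "?e y"] X_in T lim by (simp add: mult_embed_in)
  then show ?thesis by simp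
qed

lemma ideal_inclusion_mult_embed: "ideal_inclusion A M (mult_embed A)"
  unfolding ideal_inclusion_def mult_embed_obj mult_cat_sel
proof (intro conjI ballI allI impI)
  show "star_functor A M (mult_embed A)" by (rule star_functor_mult_embed)
  show "bij_betw (\<lambda>C. C) (c_obj A) (c_obj A)"
    by (simp add: bij_betw_def inj_on_def image_def)
  fix C D assume [simp]: "C \<in> c_obj A" "D \<in> c_obj A"
  show "inj_on (snd (mult_embed A) C D) (c_hom A C D)" by (simp add: mult_embed_inj)
  show "T \<in> snd (mult_embed A) C D ` c_hom A C D"
    if "(\<forall>n. X n \<in> snd (mult_embed A) C D ` c_hom A C D) \<and> T \<in> mult_hom A C D \<and>
      (\<lambda>n. c_norm M C D (c_add M C D (X n) (c_scale M C D (-1) T))) \<longlonglongrightarrow> 0" for X T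
    using that mult_embed_closed[of C D X T] by (simp add: norm_dist_def)
  fix f assume [simp]: "f \<in> c_hom A C D"
  show "c_norm M C D (snd (mult_embed A) C D f) = c_norm A C D f" by (simp add: mult_embed_norm)
  fix E T assume [simp]: "E \<in> c_obj A"
  show "c_comp M C D E T (snd (mult_embed A) C D f) \<in> snd (mult_embed A) C E ` c_hom A C E"
    if T: "T \<in> mult_hom A D E"
    using mult_comp_embed[OF _ _ T, of C f] multL_in[OF T, of C f] by simp
  show "c_comp M E C D (snd (mult_embed A) C D f) T \<in> snd (mult_embed A) E D ` c_hom A E D"
    if T: "T \<in> mult_hom A E C"
    using embed_comp_mult[OF _ _ T, of D f] multR_in[OF T, of D f] by simp
qed

section \<open>Positivity in the multiplier category\<close>

lemma unital_object_mult_cat: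
  assumes "C \<in> c_obj A"
  shows "unital_object M C"
proof -
  interpret M: pre_cstar_category M by (rule pre_cstar_category_mult_cat)
  show ?thesis by unfold_locales (use assms is_unit_mult_unit[OF assms] in \<open>simp, blast\<close>)
qed

lemma positive_el_mult_embed:
  assumes [simp]: "C \<in> c_obj A" and p: "positive_el A C p"
  shows "positive_el M C (snd (mult_embed A) C C p)"
  unfolding positive_el_def
proof (intro conjI allI impI)
  let ?e = "snd (mult_embed A) C C"
  have [simp]: "p \<in> c_hom A C C" and star: "c_star A C C p = p"
    using p by (auto simp: positive_el_def)
  show "?e p \<in> c_hom M C C" by (simp add: mult_embed_in)
  show "c_star M C C (?e p) = ?e p" using mult_embed_star[of C C p] star by simp
  fix l :: complex assume "\<not> (l \<in> \<real> \<and> 0 \<le> Re l)"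
  then obtain b where b [simp]: "b \<in> c_hom A C C"
    and right: "c_add A C C (c_add A C C (c_comp A C C C p b) (c_scale A C C (- l) b))
        (c_scale A C C (- (1 / l)) p) = c_zero A C C"
    and left: "c_add A C C (c_add A C C (c_comp A C C C b p) (c_scale A C C (- l) b))
        (c_scale A C C (- (1 / l)) p) = c_zero A C C"
    using p unfolding positive_el_def by blast
  show "\<exists>b\<in>c_hom M C C.
      c_add M C C (c_add M C C (c_comp M C C C (?e p) b) (c_scale M C C (- l) b))
        (c_scale M C C (- (1 / l)) (?e p)) = c_zero M C C \<and>
      c_add M C C (c_add M C C (c_comp M C C C b (?e p)) (c_scale M C C (- l) b))
        (c_scale M C C (- (1 / l)) (?e p)) = c_zero M C C"
    using arg_cong[OF right, of ?e] arg_cong[OF left, of ?e]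
    by (intro bexI[of _ "?e b"])
      (simp_all add: mult_embed_add mult_embed_scale mult_embed_comp mult_embed_zero mult_embed_in)
qed

text \<open>The category itself need not have units, so the estimate is made in its multiplier category.\<close>

lemma positive_el_norm_mono:
  assumes [simp]: "C \<in> c_obj A" and p: "positive_el A C p" and q: "positive_el A C q"
  shows "c_norm A C C q \<le> c_norm A C C (c_add A C C p q)"
proof -
  have [simp]: "p \<in> c_hom A C C" "q \<in> c_hom A C C" using p q by (auto simp: positive_el_def)
  show ?thesis
    using unital_object.positive_el_norm_mono_unital[OF unital_object_mult_cat
        positive_el_mult_embed[OF _ p] positive_el_mult_embed[OF _ q]]
    by (simp add: mult_embed_norm flip: mult_embed_add)
qed

end

context cstar_category
begin

lemma mult_square_bounded_below:
  assumes T: "T \<in> mult_hom A C D" and [simp]: "E \<in> c_obj A" "x \<in> c_hom A E C" and s_pos: "0 < s"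
  defines
    "y \<equiv> c_add A E C (fst (c_comp M C D C (c_star M C D T) T) E x) (c_scale A E C (of_real s) x)"
  shows "s * c_norm A E C x \<le> c_norm A E C y"
proof (rule square_le_mult_imp_le)
  note [simp] = mult_src[OF T] mult_tgt[OF T] multL_in[OF T]
  define a where "a = c_comp M C D C (c_star M C D T) T"
  have a: "a \<in> mult_hom A C C" unfolding a_def by (rule mult_comp_in[OF T mult_star_in[OF T]])
  note [simp] = multL_in[OF a]
  have y_eq: "y = c_add A E C (fst a E x) (c_scale A E C (of_real s) x)" by (simp add: y_def a_def)
  then have [simp]: "y \<in> c_hom A E C" by simp
  let ?p = "c_comp A E D E (c_star A E D (fst T E x)) (fst T E x)"
  let ?z = "c_scale A E C (of_real (sqrt s)) x"
  let ?q = "c_comp A E C E (c_star A E C ?z) ?z"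
  have q_eq: "?q = c_scale A E E (of_real s) (c_comp A E C E (c_star A E C x) x)"
    using s_pos
    by (simp add: star_scale comp_scale_left comp_scale_right hom_scale_scale flip: of_real_mult)
  have "c_norm A E C ?z = sqrt s * c_norm A E C x" using s_pos by (simp add: hom_norm_scale)
  then have "s * c_norm A E C x * c_norm A E C x = c_norm A E E ?q"
    using s_pos norm_star_comp[of E C ?z]
    by (simp add: power_mult_distrib) (simp add: power2_eq_square)
  also have "\<dots> \<le> c_norm A E E (c_add A E E ?p ?q)"
    by (intro positive_el_norm_mono positive_star_comp) simp_all
  also have "c_add A E E ?p ?q = c_comp A E C E (c_star A E C x) y"
    unfolding q_eq y_eq using star_comp_mult[OF T, of E x]
    by (simp add: comp_add_right comp_scale_right flip: a_def)
  also have "c_norm A E E \<dots> \<le> c_norm A E C y * c_norm A E C x"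
    using norm_comp_le[of E C E y "c_star A E C x"] by (simp add: norm_star mult.commute)
  finally show "s * c_norm A E C x * (s * c_norm A E C x) \<le> c_norm A E C y * (s * c_norm A E C x)"
    using s_pos by (simp add: mult.left_commute mult.assoc)
  show "0 \<le> s * c_norm A E C x" using s_pos by simp
  show "0 \<le> c_norm A E C y" by simp
qed

lemma positive_el_mult_star_comp:
  assumes T: "T \<in> mult_hom A C D"
  shows "positive_el M C (c_comp M C D C (c_star M C D T) T)"
proof (rule unital_object.positive_elI_bounded_below[OF unital_object_mult_cat[OF mult_src[OF T]]])
  interpret M: pre_cstar_category M by (rule pre_cstar_category_mult_cat)
  note [simp] = mult_src[OF T] mult_tgt[OF T]
  let ?a = "c_comp M C D C (c_star M C D T) T"
  have a: "?a \<in> mult_hom A C C" by (rule mult_comp_in[OF T mult_star_in[OF T]])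
  then show "?a \<in> c_hom M C C" by simp
  show "c_star M C C ?a = ?a"
    using T by (simp add: mult_star_comp[OF T] mult_star_star mult_star_in)
  fix s :: real and m :: "('o,'m) mult"
  assume s_pos: "0 < s" and "m \<in> c_hom M C C"
  then have m: "m \<in> mult_hom A C C" by simp
  let ?w = "c_add M C C (c_comp M C C C ?a m) (c_scale M C C (of_real s) m)"
  have w: "?w \<in> mult_hom A C C" by (intro mult_add_in mult_comp_in mult_scale_in a m)
  have "c_norm M C C m \<le> c_norm M C C ?w / s"
  proof (rule mult_norm_least[OF m])
    fix E h assume [simp]: "E \<in> c_obj A" "h \<in> c_hom A E C"
    have "s * c_norm A E C (fst m E h) \<le> c_norm A E C (fst ?w E h)"
      using mult_square_bounded_below[OF T _ multL_in[OF m] s_pos, of E h] by simp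
    also have "\<dots> \<le> c_norm M C C ?w * c_norm A E C h" using w by (rule mult_norm_boundL) simp_all
    finally show "c_norm A E C (fst m E h) \<le> c_norm M C C ?w / s * c_norm A E C h"
      using s_pos by (simp add: le_divide_eq mult.commute)
  qed (use s_pos mult_norm_nonneg[OF w] in simp)
  then show "s * c_norm M C C m \<le> c_norm M C C ?w"
    using s_pos by (simp add: le_divide_eq mult.commute)
qed

lemma cstar_cat_mult_cat: "cstar_cat M"
  unfolding cstar_cat_iff cstar_category_def cstar_category_axioms_def
  using pre_cstar_category_mult_cat positive_el_mult_star_comp by simp

end

section \<open>The universal property\<close>

locale ideal_extension =
  A: pre_cstar_category A + B: pre_cstar_category B
  for A :: "('o,'m) cstarcat" and B :: "('o2,'m2) cstarcat" +
  fixes i :: "('o,'m,'o2,'m2) cfun"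
  assumes ideal: "ideal_inclusion A B i"
begin

abbreviation "iO \<equiv> fst i"
abbreviation "iM \<equiv> snd i"

lemma i_functor: "star_functor A B i"
  and i_bij: "bij_betw iO (c_obj A) (c_obj B)"
  and i_inj: "C \<in> c_obj A \<Longrightarrow> D \<in> c_obj A \<Longrightarrow> inj_on (iM C D) (c_hom A C D)"
  and i_norm: "C \<in> c_obj A \<Longrightarrow> D \<in> c_obj A \<Longrightarrow> f \<in> c_hom A C D \<Longrightarrow>
    c_norm B (iO C) (iO D) (iM C D f) = c_norm A C D f"
  and i_absorbs_left: "C \<in> c_obj A \<Longrightarrow> D \<in> c_obj A \<Longrightarrow> E \<in> c_obj A \<Longrightarrow> f \<in> c_hom A C D \<Longrightarrow>
    g \<in> c_hom B (iO D) (iO E) \<Longrightarrow> c_comp B (iO C) (iO D) (iO E) g (iM C D f) \<in> iM C E ` c_hom A C E"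
  and i_absorbs_right: "C \<in> c_obj A \<Longrightarrow> D \<in> c_obj A \<Longrightarrow> E \<in> c_obj A \<Longrightarrow> f \<in> c_hom A C D \<Longrightarrow>
    g \<in> c_hom B (iO E) (iO C) \<Longrightarrow> c_comp B (iO E) (iO C) (iO D) (iM C D f) g \<in> iM E D ` c_hom A E D"
  by (insert ideal[unfolded ideal_inclusion_def]; elim conjE; simp)+

lemmas i_obj [simp] = star_functor_obj[OF i_functor]
lemmas i_in [simp] = star_functor_hom[OF i_functor]
lemmas i_add = star_functor_add[OF i_functor]
lemmas i_scale = star_functor_scale[OF i_functor]
lemmas i_comp = star_functor_comp[OF i_functor]
lemmas i_star = star_functor_star[OF i_functor]

lemma i_eqD:
  "iM C D f = iM C D g \<Longrightarrow> C \<in> c_obj A \<Longrightarrow> D \<in> c_obj A \<Longrightarrow> f \<in> c_hom A C D \<Longrightarrow> g \<in> c_hom A C D \<Longrightarrow> f = g"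
  using i_inj by (meson inj_onD)

definition pull_obj :: "'o2 \<Rightarrow> 'o" where
  "pull_obj = inv_into (c_obj A) iO"

lemma pull_obj:
  "C \<in> c_obj A \<Longrightarrow> pull_obj (iO C) = C"
  "X \<in> c_obj B \<Longrightarrow> pull_obj X \<in> c_obj A"
  "X \<in> c_obj B \<Longrightarrow> iO (pull_obj X) = X"
  unfolding pull_obj_def using i_bij
  by (auto simp: bij_betw_def inv_into_into f_inv_into_f)

definition pull :: "'o \<Rightarrow> 'o \<Rightarrow> 'm2 \<Rightarrow> 'm" where
  "pull C D = inv_into (c_hom A C D) (iM C D)"

definition ideal_action :: "'o \<Rightarrow> 'o \<Rightarrow> 'm2 \<Rightarrow> ('o,'m) mult" where
  "ideal_action C D b = mk_mult A C D
    (\<lambda>E h. pull E D (c_comp B (iO E) (iO C) (iO D) b (iM E C h)))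
    (\<lambda>E g. pull C E (c_comp B (iO C) (iO D) (iO E) (iM D E g) b))"

lemma ideal_action_eval:
  assumes "C \<in> c_obj A" "D \<in> c_obj A" "E \<in> c_obj A" "b \<in> c_hom B (iO C) (iO D)"
  shows "h \<in> c_hom A E C \<Longrightarrow> fst (ideal_action C D b) E h \<in> c_hom A E D"
    and "h \<in> c_hom A E C \<Longrightarrow>
      iM E D (fst (ideal_action C D b) E h) = c_comp B (iO E) (iO C) (iO D) b (iM E C h)"
    and "g \<in> c_hom A D E \<Longrightarrow> snd (ideal_action C D b) E g \<in> c_hom A C E"
    and "g \<in> c_hom A D E \<Longrightarrow>
      iM C E (snd (ideal_action C D b) E g) = c_comp B (iO C) (iO D) (iO E) (iM D E g) b"
  using assms i_absorbs_left i_absorbs_right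
  by (simp_all add: ideal_action_def pull_def inv_into_into f_inv_into_f)

lemma ideal_action_in:
  assumes [simp]: "C \<in> c_obj A" "D \<in> c_obj A" "b \<in> c_hom B (iO C) (iO D)"
  shows "ideal_action C D b \<in> mult_hom A C D"
proof -
  note [simp] = ideal_action_eval
  have "mk_mult A C D (fst (ideal_action C D b)) (snd (ideal_action C D b)) \<in> mult_hom A C D"
  proof (rule A.mk_mult_in_norm_le[where K = "c_norm B (iO C) (iO D) b", THEN conjunct1])
    fix E h assume [simp]: "E \<in> c_obj A" "h \<in> c_hom A E C"
    have "c_norm A E D (fst (ideal_action C D b) E h)
        = c_norm B (iO E) (iO D) (c_comp B (iO E) (iO C) (iO D) b (iM E C h))"
      using i_norm[of E D "fst (ideal_action C D b) E h"] by simp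
    also have "\<dots> \<le> c_norm B (iO C) (iO D) b * c_norm B (iO E) (iO C) (iM E C h)"
      by (rule B.norm_comp_le) simp_all
    finally show "c_norm A E D (fst (ideal_action C D b) E h)
        \<le> c_norm B (iO C) (iO D) b * c_norm A E C h"
      by (simp add: i_norm)
  next
    fix E F f g
    assume [simp]: "E \<in> c_obj A" "F \<in> c_obj A" "f \<in> c_hom A F C" "g \<in> c_hom A D E"
    show "c_comp A F D E g (fst (ideal_action C D b) F f)
        = c_comp A F C E (snd (ideal_action C D b) E g) f"
      by (rule i_eqD[of F E]) (simp_all add: i_comp B.comp_assoc)
  qed simp_all
  also have "mk_mult A C D (fst (ideal_action C D b)) (snd (ideal_action C D b))
      = ideal_action C D b"
    by (auto simp: ideal_action_def mk_mult_def fun_eq_iff)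
  finally show ?thesis .
qed

lemma ideal_action_eqI:
  assumes "C \<in> c_obj A" "D \<in> c_obj A" "b \<in> c_hom B (iO C) (iO D)" "T \<in> mult_hom A C D"
    and "\<And>E h. E \<in> c_obj A \<Longrightarrow> h \<in> c_hom A E C \<Longrightarrow>
      iM E D (fst T E h) = c_comp B (iO E) (iO C) (iO D) b (iM E C h)"
  shows "ideal_action C D b = T"
proof (rule A.mult_eqI[OF ideal_action_in assms(4)])
  fix E h assume "E \<in> c_obj A" "h \<in> c_hom A E C"
  then show "fst (ideal_action C D b) E h = fst T E h"
    using assms multL_in[OF assms(4)] by (intro i_eqD[of E D]) (simp_all add: ideal_action_eval)
qed (use assms in auto)

lemma
  assumes [simp]: "C \<in> c_obj A" "D \<in> c_obj A" and b [simp]: "b \<in> c_hom B (iO C) (iO D)"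
  shows ideal_action_scale:
      "ideal_action C D (c_scale B (iO C) (iO D) a b) = c_scale A.M C D a (ideal_action C D b)"
    and ideal_action_star:
      "ideal_action D C (c_star B (iO C) (iO D) b) = c_star A.M C D (ideal_action C D b)"
    and ideal_action_add: "b' \<in> c_hom B (iO C) (iO D) \<Longrightarrow>
      ideal_action C D (c_add B (iO C) (iO D) b b')
      = c_add A.M C D (ideal_action C D b) (ideal_action C D b')"
    and ideal_action_comp: "E \<in> c_obj A \<Longrightarrow> d \<in> c_hom B (iO D) (iO E) \<Longrightarrow>
      ideal_action C E (c_comp B (iO C) (iO D) (iO E) d b)
      = c_comp A.M C D E (ideal_action D E d) (ideal_action C D b)"
proof -
  note [simp] = ideal_action_in ideal_action_eval
    A.mult_add_in A.mult_scale_in A.mult_comp_in A.mult_star_in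
  show "ideal_action C D (c_scale B (iO C) (iO D) a b) = c_scale A.M C D a (ideal_action C D b)"
    by (rule ideal_action_eqI) (simp_all add: i_scale B.comp_scale_left)
  show "ideal_action D C (c_star B (iO C) (iO D) b) = c_star A.M C D (ideal_action C D b)"
    by (rule ideal_action_eqI) (simp_all add: i_star B.star_comp B.star_star)
  show "ideal_action C D (c_add B (iO C) (iO D) b b')
      = c_add A.M C D (ideal_action C D b) (ideal_action C D b')"
    if [simp]: "b' \<in> c_hom B (iO C) (iO D)"
    by (rule ideal_action_eqI) (simp_all add: i_add B.comp_add_left)
  show "ideal_action C E (c_comp B (iO C) (iO D) (iO E) d b)
      = c_comp A.M C D E (ideal_action D E d) (ideal_action C D b)"
    if [simp]: "E \<in> c_obj A" "d \<in> c_hom B (iO D) (iO E)"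
    by (rule ideal_action_eqI) (simp_all add: B.comp_assoc)
qed

lemma ideal_action_embed:
  assumes [simp]: "C \<in> c_obj A" "D \<in> c_obj A" "f \<in> c_hom A C D"
  shows "ideal_action C D (iM C D f) = snd (mult_embed A) C D f"
  by (rule ideal_action_eqI) (simp_all add: A.mult_embed_in i_comp)

lemma ideal_action_unit:
  assumes [simp]: "C \<in> c_obj A" and u: "is_unit B (iO C) u"
  shows "ideal_action C C u = A.mult_unit C"
  by (rule ideal_action_eqI) (use u in \<open>simp_all add: A.mult_unit_in is_unit_def\<close>)

definition ideal_action_functor :: "('o2,'m2,'o,('o,'m) mult) cfun" where
  "ideal_action_functor = (pull_obj, \<lambda>X Y. ideal_action (pull_obj X) (pull_obj Y))"

lemma star_functor_ideal_action: "star_functor B A.M ideal_action_functor"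
  unfolding star_functor_def ideal_action_functor_def fst_conv snd_conv mult_cat_sel
proof (intro conjI ballI allI)
  fix X Y Z b c a
  note [simp] = pull_obj
  assume [simp]: "X \<in> c_obj B"
  then show "pull_obj X \<in> c_obj A" by simp
  let ?C = "pull_obj X" and ?D = "pull_obj Y" and ?E = "pull_obj Z"
  assume [simp]: "Y \<in> c_obj B" "b \<in> c_hom B X Y"
  show "ideal_action ?C ?D b \<in> mult_hom A ?C ?D" by (simp add: ideal_action_in)
  show "ideal_action ?C ?D (c_scale B X Y a b) = c_scale A.M ?C ?D a (ideal_action ?C ?D b)"
    using ideal_action_scale[of ?C ?D b a] by simp
  show "ideal_action ?D ?C (c_star B X Y b) = c_star A.M ?C ?D (ideal_action ?C ?D b)"
    using ideal_action_star[of ?C ?D b] by simp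
  show "ideal_action ?C ?D (c_add B X Y b c)
      = c_add A.M ?C ?D (ideal_action ?C ?D b) (ideal_action ?C ?D c)" if "c \<in> c_hom B X Y"
    using ideal_action_add[of ?C ?D b c] that by simp
  show "ideal_action ?C ?E (c_comp B X Y Z c b)
      = c_comp A.M ?C ?D ?E (ideal_action ?D ?E c) (ideal_action ?C ?D b)"
    if "Z \<in> c_obj B" "c \<in> c_hom B Y Z"
    using ideal_action_comp[of ?C ?D b ?E c] that by simp
qed

lemma unital_ideal_action: "unital_functor B A.M ideal_action_functor"
  unfolding unital_functor_def ideal_action_functor_def fst_conv snd_conv
proof (intro ballI allI impI)
  fix X u assume "X \<in> c_obj B" "is_unit B X u"
  then show "is_unit A.M (pull_obj X) (ideal_action (pull_obj X) (pull_obj X) u)"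
    using A.is_unit_mult_unit[of "pull_obj X"] ideal_action_unit[of "pull_obj X" u]
    by (simp add: pull_obj)
qed

lemma ideal_action_extends: "functor_eq_on A (functor_comp i ideal_action_functor) (mult_embed A)"
  unfolding functor_eq_on_def functor_comp_def ideal_action_functor_def
  by (simp add: pull_obj ideal_action_embed)

context
  fixes G :: "('o2,'m2,'o,('o,'m) mult) cfun"
  assumes G: "star_functor B A.M G"
    and extends: "functor_eq_on A (functor_comp i G) (mult_embed A)"
begin

lemma extension_obj: "C \<in> c_obj A \<Longrightarrow> fst G (iO C) = C"
  using extends by (simp add: functor_eq_on_def functor_comp_def)

lemma extension_embed:
  "C \<in> c_obj A \<Longrightarrow> D \<in> c_obj A \<Longrightarrow> f \<in> c_hom A C D \<Longrightarrow>
    snd G (iO C) (iO D) (iM C D f) = snd (mult_embed A) C D f"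
  using extends by (simp add: functor_eq_on_def functor_comp_def)

lemma extension_eq_ideal_action:
  assumes [simp]: "C \<in> c_obj A" "D \<in> c_obj A" "b \<in> c_hom B (iO C) (iO D)"
  shows "ideal_action C D b = snd G (iO C) (iO D) b"
proof (rule ideal_action_eqI)
  let ?T = "snd G (iO C) (iO D) b"
  show T: "?T \<in> mult_hom A C D"
    using star_functor_hom[OF G, of "iO C" "iO D" b] by (simp add: extension_obj)
  fix E h assume [simp]: "E \<in> c_obj A" "h \<in> c_hom A E C"
  obtain f where f [simp]: "f \<in> c_hom A E D"
    and f_eq: "c_comp B (iO E) (iO C) (iO D) b (iM E C h) = iM E D f"
    using i_absorbs_left[of E C D h b] by auto
  have "snd (mult_embed A) E D (fst ?T E h) = c_comp A.M E C D ?T (snd (mult_embed A) E C h)"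
    using T by (simp add: A.mult_comp_embed)
  also have "\<dots> = snd G (iO E) (iO D) (iM E D f)"
    using star_functor_comp[OF G, of "iO E" "iO C" "iO D" "iM E C h" b]
    by (simp add: extension_obj extension_embed f_eq)
  also have "\<dots> = snd (mult_embed A) E D f" by (simp add: extension_embed)
  finally have "fst ?T E h = f"
    using multL_in[OF T, of E h] by (intro inj_onD[OF A.mult_embed_inj[of E D]]) simp_all
  then show "iM E D (fst ?T E h) = c_comp B (iO E) (iO C) (iO D) b (iM E C h)" by (simp add: f_eq)
qed simp_all

lemma ideal_action_unique: "functor_eq_on B ideal_action_functor G"
  unfolding functor_eq_on_def ideal_action_functor_def fst_conv snd_conv
proof (intro conjI ballI)
  fix X Y b assume X: "X \<in> c_obj B"
  then show "pull_obj X = fst G X" using extension_obj[of "pull_obj X"] by (simp add: pull_obj)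
  assume "Y \<in> c_obj B" "b \<in> c_hom B X Y"
  then show "ideal_action (pull_obj X) (pull_obj Y) b = snd G X Y b"
    using X extension_eq_ideal_action[of "pull_obj X" "pull_obj Y" b] by (simp add: pull_obj)
qed

end

end

theorem theorem3p4:
  fixes A :: "('o,'m) cstarcat"
    and B :: "('o2,'m2) cstarcat"
    and i :: "('o,'m,'o2,'m2) cfun"
  assumes "cstar_cat A"
  shows "cstar_cat (mult_cat A) \<and> unital (mult_cat A) \<and>
    (\<forall>C\<in>c_obj A. \<forall>D\<in>c_obj A. \<forall>LR\<in>mult_hom A C D.
        mult_normL A C D (fst LR) = mult_normR A C D (snd LR)) \<and>
    ideal_inclusion A (mult_cat A) (mult_embed A) \<and>
    (cstar_cat B \<and> unital B \<and> ideal_inclusion A B i \<longrightarrow>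
      (\<exists>F. star_functor B (mult_cat A) F \<and> unital_functor B (mult_cat A) F \<and>
           functor_eq_on A (functor_comp i F) (mult_embed A) \<and>
           (\<forall>G. star_functor B (mult_cat A) G \<and> unital_functor B (mult_cat A) G \<and>
                functor_eq_on A (functor_comp i G) (mult_embed A) \<longrightarrow> functor_eq_on B F G)))"
proof -
  interpret cstar_category A using assms by (simp add: cstar_cat_iff)
  have "\<exists>F. star_functor B M F \<and> unital_functor B M F \<and>
      functor_eq_on A (functor_comp i F) (mult_embed A) \<and>
      (\<forall>G. star_functor B M G \<and> unital_functor B M G \<and>
        functor_eq_on A (functor_comp i G) (mult_embed A) \<longrightarrow> functor_eq_on B F G)"
    if "cstar_cat B" "ideal_inclusion A B i"
  proof -
    interpret B: cstar_category B using that(1) by (simp add: cstar_cat_iff)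
    interpret ideal_extension A B i using that(2) by unfold_locales
    show ?thesis
      using star_functor_ideal_action unital_ideal_action ideal_action_extends ideal_action_unique
      by blast
  qed
  then show ?thesis
    using cstar_cat_mult_cat unital_mult_cat mult_normL_eq_mult_normR ideal_inclusion_mult_embed
    by blast
qed

end
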